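(* If there is an algorithm that solves List Allocation in $T(n,w(I))$ steps on instances $I$ with $n$ vertices, then there exists an algorithm that solves Arc-Specified List Digraph Homomorphism in $T\big(O(d(I)\cdot n),\,O(d(I))\big)+O(d(I)\cdot n^{4})$ steps, where $n=|V(G)|$.
   Context: List Allocation: input $I=(G,r,\lambda,\alpha)$ with $G$ a loopless graph (multiple edges allowed), $r\ge1$, $\lambda:V(G)\to2^{[r]}$, $\alpha:\binom{[r]}{2}\to\mathbb{Z}_{\ge0}$; output an $r$-tuple $\mathcal{V}=(\mathcal{V}^{(1)},\ldots,\mathcal{V}^{(r)})$ of pairwise disjoint possibly empty sets with union $V(G)$ such that for all distinct $i,j$ the number of edges between $\mathcal{V}^{(i)}$ and $\mathcal{V}^{(j)}$ equals $\alpha(i,j)$ and $v\in\mathcal{V}^{(i)}$ implies $i\in\lambda(v)$, or correctly report none exists; $w(I)=\sum\alpha$. Arc-Specified List Digraph Homomorphism: $G$, $H$ digraphs, $G$ simple, $H$ possibly with loops but no multiple arcs, $E_2(H)$ the non-loop arcs; input $I=(G,H,\lambda,\alpha)$ with $\lambda:V(G)\to2^{V(H)}$ and $\alpha:E_2(H)\to\mathbb{Z}_{\ge0}$; output a map $\chi:V(G)\to V(H)$ with $\chi(v)\in\lambda(v)$ for all $v$, $(\chi(u),\chi(v))\in E(H)$ for every arc $(u,v)$ of $G$, and for every $e=(a,b)\in E_2(H)$ exactly $\alpha(e)$ arcs $(u,v)$ of $G$ with $\chi(u)=a,\chi(v)=b$; or correctly report none exists. $d(I)=\sum_{e\in E_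2(H)}\alpha(e)$.
   Formalization: In O(d·n) and O(d·n^4), d is read as max(1,d), and in the latter n as max(1,n), since for d=0 the literal bound is a constant no algorithm can meet; steps are counted on a unit-cost RAM where basic set operations on lists cost one step. *)

theory Defs
  imports "Graph_Theory.Pair_Digraph" "HOL-Library.Multiset"
begin

section \<open>The machine model\<close>

text \<open>
  Algorithms are programs for a unit-cost random access machine, written in a deeply embedded
  structured language.  Memory consists of named two-dimensional arrays of natural numbers and of
  finite lists (sets of naturals), all initially \<open>0\<close> or empty except for the input.  Arithmetic is
  restricted to addition and truncated subtraction: unit-cost multiplication would produce
  numbers of exponential length.

  Lists are machine values because the time bound \<open>T (n, w)\<close> for List Allocation does not
  depend on \<open>r\<close>.  If a subset of \<open>{1..r}\<close> had to be read element by element, no algorithm could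
  meet any such bound, and the bound for the homomorphism problem, which does not mention
  the number of vertices of \<open>H\<close>, would be unattainable.
\<close>

record store =
  num :: "string \<Rightarrow> nat \<Rightarrow> nat \<Rightarrow> nat"
  lst :: "string \<Rightarrow> nat \<Rightarrow> nat \<Rightarrow> nat set"

datatype nexp =
    NConst nat
  | NCell string nexp nexp
  | NPlus nexp nexp
  | NMinus nexp nexp
  | NLeast sexp
and sexp =
    SEmpty
  | SSingle nexp
  | SCell string nexp nexp
  | SUnion sexp sexp
  | SInter sexp sexp
  | SDiff sexp sexp

datatype bexp =
    BLess nexp nexp
  | BMember nexp sexp
  | BNot bexp
  | BAnd bexp bexp

text \<open>The least element of the empty list is taken to be \<open>0\<close>.\<close>

primrec nval :: "nexp \<Rightarrow> store \<Rightarrow> nat" and sval :: "sexp \<Rightarrow> store \<Rightarrow> nat set" where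
  "nval (NConst k) s = k"
| "nval (NCell x i j) s = num s x (nval i s) (nval j s)"
| "nval (NPlus a b) s = nval a s + nval b s"
| "nval (NMinus a b) s = nval a s - nval b s"
| "nval (NLeast A) s = (if sval A s = {} then 0 else (LEAST k. k \<in> sval A s))"
| "sval SEmpty s = {}"
| "sval (SSingle a) s = {nval a s}"
| "sval (SCell x i j) s = lst s x (nval i s) (nval j s)"
| "sval (SUnion A B) s = sval A s \<union> sval B s"
| "sval (SInter A B) s = sval A s \<inter> sval B s"
| "sval (SDiff A B) s = sval A s - sval B s"

primrec bval :: "bexp \<Rightarrow> store \<Rightarrow> bool" where
  "bval (BLess a b) s \<longleftrightarrow> nval a s < nval b s"
| "bval (BMember a A) s \<longleftrightarrow> nval a s \<in> sval A s"
| "bval (BNot b) s \<longleftrightarrow> \<not> bval b s"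
| "bval (BAnd a b) s \<longleftrightarrow> bval a s \<and> bval b s"

datatype com =
    Skip
  | NAssign string nexp nexp nexp
  | SAssign string nexp nexp sexp
  | Seq com com
  | Cond bexp com com
  | While bexp com

definition upd :: "(string \<Rightarrow> nat \<Rightarrow> nat \<Rightarrow> 'v) \<Rightarrow> string \<Rightarrow> nat \<Rightarrow> nat \<Rightarrow> 'v \<Rightarrow> string \<Rightarrow> nat \<Rightarrow> nat \<Rightarrow> 'v"
  where "upd m x i j v = m(x := (m x)(i := (m x i)(j := v)))"

text \<open>
  \<open>exec c s t s'\<close>: started in \<open>s\<close>, the program \<open>c\<close> halts in \<open>s'\<close> after exactly \<open>t\<close> steps.  A step is
  an assignment, a test or a skip; the expressions of a fixed program have bounded size.
\<close>

inductive exec :: "com \<Rightarrow> store \<Rightarrow> nat \<Rightarrow> store \<Rightarrow> bool" where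
  Skip: "exec Skip s 1 s"
| NAssign: "exec (NAssign x i j e) s 1 (s\<lparr>num := upd (num s) x (nval i s) (nval j s) (nval e s)\<rparr>)"
| SAssign: "exec (SAssign x i j A) s 1 (s\<lparr>lst := upd (lst s) x (nval i s) (nval j s) (sval A s)\<rparr>)"
| Seq: "exec c s t s' \<Longrightarrow> exec c' s' t' s'' \<Longrightarrow> exec (Seq c c') s (t + t') s''"
| CondTrue: "bval b s \<Longrightarrow> exec c s t s' \<Longrightarrow> exec (Cond b c c') s (Suc t) s'"
| CondFalse: "\<not> bval b s \<Longrightarrow> exec c' s t s' \<Longrightarrow> exec (Cond b c c') s (Suc t) s'"
| WhileFalse: "\<not> bval b s \<Longrightarrow> exec (While b c) s 1 s"
| WhileTrue: "bval b s \<Longrightarrow> exec c s t s' \<Longrightarrow> exec (While b c) s' t' s'' \<Longrightarrow>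
    exec (While b c) s (Suc (t + t')) s''"

lemma exec_deterministic:
  "exec c s t s' \<Longrightarrow> exec c s u s'' \<Longrightarrow> t = u \<and> s' = s''"
proof (induction arbitrary: u s'' rule: exec.induct)
  case (Seq c s t s' c' t' s'')
  from Seq.prems show ?case by cases (use Seq.IH in blast)
next
  case (WhileTrue b s c t s' t' s'')
  from WhileTrue.prems show ?case by cases (use WhileTrue.IH WhileTrue.hyps in blast)+
qed (erule exec.cases; force)+


section \<open>List Allocation\<close>

text \<open>
  The vertices of every graph with \<open>k\<close> vertices are the numbers \<open>1, \<dots>, k\<close>.  A loopless
  multigraph is given by its multiset of edges, an edge being the set of its two ends.
\<close>

record la_instance =
  la_n :: nat
  la_edges :: "nat set multiset"
  la_r :: nat
  la_list :: "nat \<Rightarrow> nat set"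
  la_alpha :: "nat set \<Rightarrow> nat"

definition pairs :: "nat \<Rightarrow> nat set set" where
  "pairs k = {e. e \<subseteq> {1..k} \<and> card e = 2}"

definition la_valid :: "la_instance \<Rightarrow> bool" where
  "la_valid I \<longleftrightarrow>
     set_mset (la_edges I) \<subseteq> pairs (la_n I) \<and>
     la_r I \<ge> 1 \<and>
     (\<forall>v\<in>{1..la_n I}. la_list I v \<subseteq> {1..la_r I})"

definition la_w :: "la_instance \<Rightarrow> nat" where
  "la_w I = (\<Sum>e\<in>pairs (la_r I). la_alpha I e)"

definition edges_between :: "la_instance \<Rightarrow> nat set \<Rightarrow> nat set \<Rightarrow> nat" where
  "edges_between I A B = size {#e \<in># la_edges I. \<exists>u\<in>A. \<exists>v\<in>B. e = {u, v}#}"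

definition la_solution :: "la_instance \<Rightarrow> (nat \<Rightarrow> nat set) \<Rightarrow> bool" where
  "la_solution I V \<longleftrightarrow>
     (\<forall>i\<in>{1..la_r I}. \<forall>j\<in>{1..la_r I}. i \<noteq> j \<longrightarrow> V i \<inter> V j = {}) \<and>
     (\<Union>i\<in>{1..la_r I}. V i) = {1..la_n I} \<and>
     (\<forall>i\<in>{1..la_r I}. \<forall>j\<in>{1..la_r I}. i \<noteq> j \<longrightarrow>
        edges_between I (V i) (V j) = la_alpha I {i, j}) \<and>
     (\<forall>i\<in>{1..la_r I}. \<forall>v\<in>V i. i \<in> la_list I v)"

text \<open>
  The multigraph is stored as its matrix of multiplicities: with a list of edges the input would
  have unbounded length for given \<open>n\<close> and \<open>w\<close>.  For the same reason \<open>\<alpha>\<close> is stored as a list of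
  triples \<open>(i, j, \<alpha> {i, j})\<close> for the pairs with \<open>\<alpha> {i, j} > 0\<close>, in an arbitrary order \<open>ps\<close>.
\<close>

definition la_enum :: "la_instance \<Rightarrow> (nat \<times> nat) list \<Rightarrow> bool" where
  "la_enum I ps \<longleftrightarrow>
     distinct (map (\<lambda>(i, j). {i, j}) ps) \<and>
     set (map (\<lambda>(i, j). {i, j}) ps) = {e \<in> pairs (la_r I). la_alpha I e > 0}"

definition triples :: "(nat \<times> nat) list \<Rightarrow> (nat \<Rightarrow> nat \<Rightarrow> nat) \<Rightarrow> nat \<Rightarrow> nat \<Rightarrow> nat" where
  "triples ps a k m =
     (if k < length ps then
        (case ps ! k of (i, j) \<Rightarrow>
           if m = 0 then i else if m = 1 then j else if m = 2 then a i j else 0)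
      else 0)"

definition scalar :: "nat \<Rightarrow> nat \<Rightarrow> nat \<Rightarrow> nat" where
  "scalar k i j = (if i = 0 \<and> j = 0 then k else 0)"

definition la_store :: "la_instance \<Rightarrow> (nat \<times> nat) list \<Rightarrow> store" where
  "la_store I ps =
     \<lparr>num = (\<lambda>_ _ _. 0)
        (''n'' := scalar (la_n I),
         ''r'' := scalar (la_r I),
         ''E'' := (\<lambda>u v. count (la_edges I) {u, v}),
         ''len'' := scalar (length ps),
         ''alpha'' := triples ps (\<lambda>i j. la_alpha I {i, j})),
      lst = (\<lambda>_ _ _. {})
        (''lambda'' := (\<lambda>v j. if v \<in> {1..la_n I} \<and> j = 0 then la_list I v else {}))\<rparr>"

text \<open>
  Output convention for both problems: the scalar \<open>ans\<close> is \<open>1\<close> if a solution is returned and \<open>0\<close> if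
  there is none; in the former case \<open>out\<close> holds, for each vertex \<open>v\<close>, the index of its part
  (or its image under the homomorphism).
\<close>

definition la_correct :: "la_instance \<Rightarrow> store \<Rightarrow> bool" where
  "la_correct I s \<longleftrightarrow>
     (num s ''ans'' 0 0 = 1 \<and> la_solution I (\<lambda>i. {v \<in> {1..la_n I}. num s ''out'' v 0 = i})) \<or>
     (num s ''ans'' 0 0 = 0 \<and> (\<nexists>V. la_solution I V))"

definition solves_la :: "com \<Rightarrow> (la_instance \<Rightarrow> nat) \<Rightarrow> bool" where
  "solves_la P \<tau> \<longleftrightarrow>
     (\<forall>I ps. la_valid I \<and> la_enum I ps \<longrightarrow>
        (\<exists>t s. exec P (la_store I ps) t s \<and> t \<le> \<tau> I \<and> la_correct I s))"


section \<open>Arc-Specified List Digraph Homomorphism\<close>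

record hom_instance =
  hom_G :: "nat pair_pre_digraph"
  hom_H :: "nat pair_pre_digraph"
  hom_list :: "nat \<Rightarrow> nat set"
  hom_alpha :: "nat \<times> nat \<Rightarrow> nat"

definition hom_n :: "hom_instance \<Rightarrow> nat" where
  "hom_n I = card (pverts (hom_G I))"

definition hom_h :: "hom_instance \<Rightarrow> nat" where
  "hom_h I = card (pverts (hom_H I))"

definition hom_valid :: "hom_instance \<Rightarrow> bool" where
  "hom_valid I \<longleftrightarrow>
     pair_digraph (hom_G I) \<and> pverts (hom_G I) = {1..hom_n I} \<and>
     pair_fin_digraph (hom_H I) \<and> pverts (hom_H I) = {1..hom_h I} \<and>
     (\<forall>v\<in>pverts (hom_G I). hom_list I v \<subseteq> pverts (hom_H I))"

definition nonloop_arcs :: "nat pair_pre_digraph \<Rightarrow> (nat \<times> nat) set" where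
  "nonloop_arcs H = {(a, b) \<in> parcs H. a \<noteq> b}"

definition hom_d :: "hom_instance \<Rightarrow> nat" where
  "hom_d I = (\<Sum>e\<in>nonloop_arcs (hom_H I). hom_alpha I e)"

definition hom_solution :: "hom_instance \<Rightarrow> (nat \<Rightarrow> nat) \<Rightarrow> bool" where
  "hom_solution I \<chi> \<longleftrightarrow>
     (\<forall>v\<in>pverts (hom_G I). \<chi> v \<in> hom_list I v) \<and>
     (\<forall>(u, v)\<in>parcs (hom_G I). (\<chi> u, \<chi> v) \<in> parcs (hom_H I)) \<and>
     (\<forall>(a, b)\<in>nonloop_arcs (hom_H I).
        card {(u, v) \<in> parcs (hom_G I). \<chi> u = a \<and> \<chi> v = b} = hom_alpha I (a, b))"

text \<open>
  \<open>G\<close> and \<open>H\<close> are stored as adjacency matrices, together with the list of looped vertices of \<open>H\<close>;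
  \<open>\<alpha>\<close> is stored as above.
\<close>

definition hom_enum :: "hom_instance \<Rightarrow> (nat \<times> nat) list \<Rightarrow> bool" where
  "hom_enum I ps \<longleftrightarrow>
     distinct ps \<and> set ps = {e \<in> nonloop_arcs (hom_H I). hom_alpha I e > 0}"

definition hom_store :: "hom_instance \<Rightarrow> (nat \<times> nat) list \<Rightarrow> store" where
  "hom_store I ps =
     \<lparr>num = (\<lambda>_ _ _. 0)
        (''n'' := scalar (hom_n I),
         ''h'' := scalar (hom_h I),
         ''G'' := (\<lambda>u v. of_bool ((u, v) \<in> parcs (hom_G I))),
         ''H'' := (\<lambda>a b. of_bool ((a, b) \<in> parcs (hom_H I))),
         ''len'' := scalar (length ps),
         ''alpha'' := triples ps (\<lambda>a b. hom_alpha I (a, b))),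
      lst = (\<lambda>_ _ _. {})
        (''lambda'' := (\<lambda>v j. if v \<in> pverts (hom_G I) \<and> j = 0 then hom_list I v else {}),
         ''loops'' := (\<lambda>i j. if i = 0 \<and> j = 0 then {a. (a, a) \<in> parcs (hom_H I)} else {}))\<rparr>"

definition hom_correct :: "hom_instance \<Rightarrow> store \<Rightarrow> bool" where
  "hom_correct I s \<longleftrightarrow>
     (num s ''ans'' 0 0 = 1 \<and> hom_solution I (\<lambda>v. num s ''out'' v 0)) \<or>
     (num s ''ans'' 0 0 = 0 \<and> (\<nexists>\<chi>. hom_solution I \<chi>))"

definition solves_hom :: "com \<Rightarrow> (hom_instance \<Rightarrow> nat) \<Rightarrow> bool" where
  "solves_hom Q \<tau> \<longleftrightarrow>
     (\<forall>I ps. hom_valid I \<and> hom_enum I ps \<longrightarrow>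
        (\<exists>t s. exec Q (hom_store I ps) t s \<and> t \<le> \<tau> I \<and> hom_correct I s))"

end

theory Submission
  imports Defs
begin

text \<open>
  Put the arcs of \<open>G\<close> greedily into \<open>d + 1\<close> edge-disjoint forests, each arc into the first one in
  which its ends are not yet connected.  A homomorphism sends exactly \<open>d\<close> arcs to non-loops, so one of
  the forests has all its arcs sent to loops; hence the ends of an arc that fits into none of the
  forests have the same image, and the arc only demands that this image carries a loop, which is a
  condition on lists.  At most \<open>(d + 1) n\<close> arcs remain.

  A remaining arc \<open>(u, v)\<close> becomes a path \<open>u - x - y - v\<close>.  For every arc \<open>(a, b)\<close> of \<open>H\<close> with positive demand
  there are two new parts \<open>p\<close> and \<open>q\<close>, reserved for \<open>x\<close>- and \<open>y\<close>-vertices, and the pairs \<open>{a, p}\<close>, \<open>{p, q}\<close>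
  and \<open>{q, b}\<close> get the demand \<open>\<alpha> (a, b)\<close>, all other pairs the demand \<open>0\<close>.  Counting forces every path
  to lie inside one looped part, where edges are not counted, or to run through \<open>a, p, q, b\<close> in this
  order.  The instance has exactly \<open>n (2 d + 3)\<close> vertices and weight \<open>3 d\<close>.
\<close>

section \<open>Verification of programs\<close>

text \<open>\<open>T\<close> is arbitrary, not even monotone, so upper bounds on the size of the
  constructed instance would not suffice: its vertex count and weight must be exact functions of
  \<open>n\<close> and \<open>d\<close>. This is why every slot receives its two vertices, filled or
  not. The forests keep this number linear in \<open>d * n\<close>: each arc that stays costs two
  vertices, while \<open>G\<close> may have about \<open>n^2\<close> arcs. Two inner vertices per
  path are there to keep the orientation. With plain edges the demands of \<open>(a, b)\<close> and
  \<open>(b, a)\<close> would be added up. With a single inner vertex, in a part \<open>p\<close>,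
  the paths \<open>a - p - b\<close> and \<open>b - p - a\<close> contribute the same counts, and
  \<open>a - p - a\<close> together with \<open>b - p - b\<close> imitates two proper paths. Lists
  that tell \<open>x\<close> from \<open>y\<close> remove both confusions. On the machine side there
  is no multiplication, so the offsets of the vertex blocks are accumulated by additions; and lists
  are single values, so adding a part or intersecting with the looped vertices takes one step
  whatever \<open>h\<close> is.\<close>

primrec run :: "com \<Rightarrow> store \<Rightarrow> store" where
  "run Skip s = s"
| "run (NAssign x i j e) s = s\<lparr>num := upd (num s) x (nval i s) (nval j s) (nval e s)\<rparr>"
| "run (SAssign x i j A) s = s\<lparr>lst := upd (lst s) x (nval i s) (nval j s) (sval A s)\<rparr>"
| "run (Seq c c') s = run c' (run c s)"
| "run (Cond b c c') s = (if bval b s then run c s else run c' s)"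
| "run (While b c) s = s"

primrec cost :: "com \<Rightarrow> nat" where
  "cost Skip = 1"
| "cost (NAssign x i j e) = 1"
| "cost (SAssign x i j A) = 1"
| "cost (Seq c c') = cost c + cost c'"
| "cost (Cond b c c') = Suc (max (cost c) (cost c'))"
| "cost (While b c) = 0"

primrec loopfree :: "com \<Rightarrow> bool" where
  "loopfree Skip \<longleftrightarrow> True"
| "loopfree (NAssign x i j e) \<longleftrightarrow> True"
| "loopfree (SAssign x i j A) \<longleftrightarrow> True"
| "loopfree (Seq c c') \<longleftrightarrow> loopfree c \<and> loopfree c'"
| "loopfree (Cond b c c') \<longleftrightarrow> loopfree c \<and> loopfree c'"
| "loopfree (While b c) \<longleftrightarrow> False"

text \<open>Straight-line code is turned into a function that simp can evaluate; \<open>run\<close>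
  and \<open>cost\<close> carry their meaning for \<open>loopfree\<close> programs.
  \<open>cost\<close> charges the dearer branch of a conditional, hence only an inequality for the
  time.\<close>

lemma exec_run: "loopfree c \<Longrightarrow> \<exists>t\<le>cost c. exec c s t (run c s)"
proof (induction c arbitrary: s)
  case (Seq c c')
  obtain t t' where "t \<le> cost c" "exec c s t (run c s)" "t' \<le> cost c'" "exec c' (run c s) t' (run c' (run c s))"
    using Seq by (meson loopfree.simps)
  then show ?case by (auto intro!: exI[of _ "t + t'"] exec.Seq)
next
  case (Cond b c c')
  show ?case
  proof (cases "bval b s")
    case True
    obtain t where "t \<le> cost c" "exec c s t (run c s)" using Cond by (meson loopfree.simps)
    then show ?thesis using True by (auto intro!: exI[of _ "Suc t"] exec.CondTrue)
  next
    case False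
    obtain t where "t \<le> cost c'" "exec c' s t (run c' s)" using Cond by (meson loopfree.simps)
    then show ?thesis using False by (auto intro!: exI[of _ "Suc t"] exec.CondFalse)
  qed
next
  case Skip
  show ?case by (intro exI[of _ 1] conjI) (simp, simp only: run.simps exec.Skip)
next
  case (NAssign x i j e)
  show ?case by (intro exI[of _ 1] conjI) (simp, simp only: run.simps exec.NAssign)
next
  case (SAssign x i j A)
  show ?case by (intro exI[of _ 1] conjI) (simp, simp only: run.simps exec.SAssign)
qed simp

primrec nwrites :: "com \<Rightarrow> string set" where
  "nwrites Skip = {}"
| "nwrites (NAssign x i j e) = {x}"
| "nwrites (SAssign x i j A) = {}"
| "nwrites (Seq c c') = nwrites c \<union> nwrites c'"
| "nwrites (Cond b c c') = nwrites c \<union> nwrites c'"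
| "nwrites (While b c) = nwrites c"

primrec swrites :: "com \<Rightarrow> string set" where
  "swrites Skip = {}"
| "swrites (NAssign x i j e) = {}"
| "swrites (SAssign x i j A) = {x}"
| "swrites (Seq c c') = swrites c \<union> swrites c'"
| "swrites (Cond b c c') = swrites c \<union> swrites c'"
| "swrites (While b c) = swrites c"

lemma exec_frame:
  assumes "exec c s t s'"
  shows "x \<notin> nwrites c \<Longrightarrow> num s' x = num s x" and "x \<notin> swrites c \<Longrightarrow> lst s' x = lst s x"
  using assms by (induction rule: exec.induct) (auto simp: upd_def)

text \<open>Total correctness within a time budget. The frame condition is part of the judgement, so
  the rules for composition and loops pass on all untouched arrays, and invariants need only mention
  what a program changes.\<close>

definition halts :: "com \<Rightarrow> store \<Rightarrow> nat \<Rightarrow> (store \<Rightarrow> bool) \<Rightarrow> bool" where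
  "halts c s T Q \<longleftrightarrow> (\<exists>t s'. exec c s t s' \<and> t \<le> T \<and> Q s' \<and>
     (\<forall>x. x \<notin> nwrites c \<longrightarrow> num s' x = num s x) \<and> (\<forall>x. x \<notin> swrites c \<longrightarrow> lst s' x = lst s x))"

lemma haltsI: "exec c s t s' \<Longrightarrow> t \<le> T \<Longrightarrow> Q s' \<Longrightarrow> halts c s T Q"
  unfolding halts_def using exec_frame by blast

lemma halts_run: "loopfree c \<Longrightarrow> cost c \<le> T \<Longrightarrow> Q (run c s) \<Longrightarrow> halts c s T Q"
  using exec_run[of c s] haltsI le_trans by blast

lemma halts_mono: "halts c s T Q \<Longrightarrow> T \<le> T' \<Longrightarrow> (\<And>s'. Q s' \<Longrightarrow> Q' s') \<Longrightarrow> halts c s T' Q'"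
  unfolding halts_def by (meson le_trans)

lemma halts_seq:
  assumes "halts c s T Q"
    and "\<And>s'. Q s' \<Longrightarrow> (\<And>x. x \<notin> nwrites c \<Longrightarrow> num s' x = num s x) \<Longrightarrow>
      (\<And>x. x \<notin> swrites c \<Longrightarrow> lst s' x = lst s x) \<Longrightarrow> halts c' s' T' R"
  shows "halts (Seq c c') s (T + T') R"
proof -
  obtain t s' where 1: "exec c s t s'" "t \<le> T" "Q s'"
    and "\<And>x. x \<notin> nwrites c \<Longrightarrow> num s' x = num s x" "\<And>x. x \<notin> swrites c \<Longrightarrow> lst s' x = lst s x"
    using assms(1) unfolding halts_def by blast
  then have "halts c' s' T' R" using assms(2)[of s'] by blast
  then obtain t' s'' where "exec c' s' t' s''" "t' \<le> T'" "R s''" unfolding halts_def by blast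
  then show ?thesis using 1 by (intro haltsI[of _ _ "t + t'"] exec.Seq) auto
qed

lemma halts_cond:
  assumes "bval b s \<Longrightarrow> halts c s T Q" and "\<not> bval b s \<Longrightarrow> halts c' s T Q"
  shows "halts (Cond b c c') s (Suc T) Q"
proof (cases "bval b s")
  case True
  then obtain t s' where "exec c s t s'" "t \<le> T" "Q s'" using assms(1) unfolding halts_def by blast
  then show ?thesis using True by (intro haltsI[of _ _ "Suc t"] exec.CondTrue) auto
next
  case False
  then obtain t s' where "exec c' s t s'" "t \<le> T" "Q s'" using assms(2) unfolding halts_def by blast
  then show ?thesis using False by (intro haltsI[of _ _ "Suc t"] exec.CondFalse) auto
qed

text \<open>The number \<open>m\<close> of passes is known in advance; each pays for its test and
  its body, and the final failing test adds 1. In \<open>step\<close> and \<open>exit\<close> the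
  frame refers to the store before the whole loop.\<close>

lemma halts_while:
  assumes init: "Inv 0 s"
    and step: "\<And>k s'. k < m \<Longrightarrow> Inv k s' \<Longrightarrow>
      (\<And>x. x \<notin> nwrites c \<Longrightarrow> num s' x = num s x) \<Longrightarrow> (\<And>x. x \<notin> swrites c \<Longrightarrow> lst s' x = lst s x) \<Longrightarrow>
      bval b s' \<and> halts c s' T (Inv (Suc k))"
    and exit: "\<And>s'. Inv m s' \<Longrightarrow> (\<And>x. x \<notin> nwrites c \<Longrightarrow> num s' x = num s x) \<Longrightarrow> 
      (\<And>x. x \<notin> swrites c \<Longrightarrow> lst s' x = lst s x) \<Longrightarrow> \<not> bval b s'"
  shows "halts (While b c) s (m * Suc T + 1) (Inv m)"
proof -
  \<comment> \<open>Induction on the number \<open>j\<close> of passes still to come, so the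
    invariant has index \<open>m - j\<close>; the frame relative to the initial \<open>s\<close> is
    carried along.\<close>
  have "\<exists>t s''. exec (While b c) s' t s'' \<and> t \<le> j * Suc T + 1 \<and> Inv m s''"
    if "j \<le> m" "Inv (m - j) s'" "\<forall>x. x \<notin> nwrites c \<longrightarrow> num s' x = num s x"
      "\<forall>x. x \<notin> swrites c \<longrightarrow> lst s' x = lst s x" for j s'
    using that
  proof (induction j arbitrary: s')
    case 0
    then have "\<not> bval b s'" using exit by simp
    then show ?case using 0 exec.WhileFalse by fastforce
  next
    case (Suc j)
    then have "bval b s' \<and> halts c s' T (Inv (Suc (m - Suc j)))" by (intro step) auto
    then obtain t s'' where 1: "bval b s'" "exec c s' t s''" "t \<le> T" "Inv (m - j) s''"
      and fr: "\<forall>x. x \<notin> nwrites c \<longrightarrow> num s'' x = num s' x" "\<forall>x. x \<notin> swrites c \<longrightarrow> lst s'' x = lst s' x"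
      using Suc.prems unfolding halts_def by (auto simp: Suc_diff_Suc)
    then obtain t' s3 where "exec (While b c) s'' t' s3" "t' \<le> j * Suc T + 1" "Inv m s3"
      using Suc.IH[of s''] Suc.prems by auto
    then show ?case using 1 exec.WhileTrue[OF 1(1,2)] by (intro exI[of _ "Suc (t + t')"] exI[of _ s3]) auto
  qed
  from this[of m s] show ?thesis using init by (auto intro: haltsI)
qed

lemma haltsE:
  assumes "halts c s T Q"
  obtains t s' where "exec c s t s'" "t \<le> T" "Q s'"
  using assms unfolding halts_def by blast

lemma halts_frame:
  "halts c s T Q \<Longrightarrow> halts c s T (\<lambda>s'. Q s' \<and> (\<forall>x. x \<notin> nwrites c \<longrightarrow> num s' x = num s x) \<and>
     (\<forall>x. x \<notin> swrites c \<longrightarrow> lst s' x = lst s x))"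
  unfolding halts_def by blast

lemma halts_prefix:
  "loopfree c \<Longrightarrow> halts c' (run c s) T R \<Longrightarrow> halts (Seq c c') s (cost c + T) R"
  by (rule halts_seq[OF halts_run[where Q = "\<lambda>s'. s' = run c s"]]) auto

lemma halts_suffix:
  assumes "halts c s T Q" "loopfree c'"
    and "\<And>s'. Q s' \<Longrightarrow> (\<And>x. x \<notin> nwrites c \<Longrightarrow> num s' x = num s x) \<Longrightarrow>
      (\<And>x. x \<notin> swrites c \<Longrightarrow> lst s' x = lst s x) \<Longrightarrow> R (run c' s')"
  shows "halts (Seq c c') s (T + cost c') R"
  using assms by (intro halts_seq[OF assms(1)] halts_run) auto

section \<open>Renaming the arrays of a program\<close>

primrec nren :: "(string \<Rightarrow> string) \<Rightarrow> nexp \<Rightarrow> nexp" and sren :: "(string \<Rightarrow> string) \<Rightarrow> sexp \<Rightarrow> sexp" where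
  "nren f (NConst k) = NConst k"
| "nren f (NCell x i j) = NCell (f x) (nren f i) (nren f j)"
| "nren f (NPlus a b) = NPlus (nren f a) (nren f b)"
| "nren f (NMinus a b) = NMinus (nren f a) (nren f b)"
| "nren f (NLeast A) = NLeast (sren f A)"
| "sren f SEmpty = SEmpty"
| "sren f (SSingle a) = SSingle (nren f a)"
| "sren f (SCell x i j) = SCell (f x) (nren f i) (nren f j)"
| "sren f (SUnion A B) = SUnion (sren f A) (sren f B)"
| "sren f (SInter A B) = SInter (sren f A) (sren f B)"
| "sren f (SDiff A B) = SDiff (sren f A) (sren f B)"

primrec bren :: "(string \<Rightarrow> string) \<Rightarrow> bexp \<Rightarrow> bexp" where
  "bren f (BLess a b) = BLess (nren f a) (nren f b)"
| "bren f (BMember a A) = BMember (nren f a) (sren f A)"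
| "bren f (BNot b) = BNot (bren f b)"
| "bren f (BAnd a b) = BAnd (bren f a) (bren f b)"

primrec cren :: "(string \<Rightarrow> string) \<Rightarrow> com \<Rightarrow> com" where
  "cren f Skip = Skip"
| "cren f (NAssign x i j e) = NAssign (f x) (nren f i) (nren f j) (nren f e)"
| "cren f (SAssign x i j A) = SAssign (f x) (nren f i) (nren f j) (sren f A)"
| "cren f (Seq c c') = Seq (cren f c) (cren f c')"
| "cren f (Cond b c c') = Cond (bren f b) (cren f c) (cren f c')"
| "cren f (While b c) = While (bren f b) (cren f c)"

definition pullback :: "(string \<Rightarrow> string) \<Rightarrow> store \<Rightarrow> store" where
  "pullback f s = \<lparr>num = num s \<circ> f, lst = lst s \<circ> f\<rparr>"

lemma nval_nren: "nval (nren f e) s = nval e (pullback f s)"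
  and sval_sren: "sval (sren f A) s = sval A (pullback f s)"
  by (induction e and A) (simp_all add: pullback_def)

lemma bval_bren: "bval (bren f b) s = bval b (pullback f s)"
  by (induction b) (simp_all add: nval_nren sval_sren)

text \<open>A simulation: the renamed program does in \<open>s\<close> what the original does in
  \<open>s\<close> seen through \<open>f\<close>. Injectivity makes a write to \<open>f x\<close>
  visible under the name \<open>x\<close> alone.\<close>

lemma exec_cren:
  assumes "inj f" "exec c \<sigma> t \<sigma>'" "\<sigma> = pullback f s"
  shows "\<exists>s'. exec (cren f c) s t s' \<and> \<sigma>' = pullback f s'"
proof -
  have upd: "upd m (f x) i j v \<circ> f = upd (m \<circ> f) x i j v" for m :: "string \<Rightarrow> nat \<Rightarrow> nat \<Rightarrow> 'v" and x i j v
    using assms(1) by (auto simp: upd_def fun_eq_iff inj_eq)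
  show ?thesis using assms(2,3)
  proof (induction arbitrary: s rule: exec.induct)
    case (Skip \<sigma>)
    then show ?case by (metis cren.simps(1) exec.Skip)
  next
    case (NAssign x i j e \<sigma>)
    let ?s = "run (cren f (NAssign x i j e)) s"
    have "exec (cren f (NAssign x i j e)) s 1 ?s"
      using exec.NAssign[of "f x" "nren f i" "nren f j" "nren f e" s] by simp
    moreover have "\<sigma>\<lparr>num := upd (num \<sigma>) x (nval i \<sigma>) (nval j \<sigma>) (nval e \<sigma>)\<rparr> = pullback f ?s"
      unfolding NAssign run.simps cren.simps nval_nren by (simp add: pullback_def upd)
    ultimately show ?case by blast
  next
    case (SAssign x i j A \<sigma>)
    let ?s = "run (cren f (SAssign x i j A)) s"
    have "exec (cren f (SAssign x i j A)) s 1 ?s"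
      using exec.SAssign[of "f x" "nren f i" "nren f j" "sren f A" s] by simp
    moreover have "\<sigma>\<lparr>lst := upd (lst \<sigma>) x (nval i \<sigma>) (nval j \<sigma>) (sval A \<sigma>)\<rparr> = pullback f ?s"
      unfolding SAssign run.simps cren.simps nval_nren sval_sren by (simp add: pullback_def upd)
    ultimately show ?case by blast
  next
    case (Seq c \<sigma> t \<sigma>' c' t' \<sigma>'')
    then show ?case by (metis cren.simps(4) exec.Seq)
  next
    case (CondTrue b \<sigma> c t \<sigma>' c')
    then show ?case by (metis cren.simps(5) bval_bren exec.CondTrue)
  next
    case (CondFalse b \<sigma> c' t \<sigma>' c)
    then show ?case by (metis cren.simps(5) bval_bren exec.CondFalse)
  next
    case (WhileFalse b \<sigma> c)
    then show ?case by (metis cren.simps(6) bval_bren exec.WhileFalse)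
  next
    case (WhileTrue b \<sigma> c t \<sigma>' t' \<sigma>'')
    then show ?case by (metis cren.simps(6) bval_bren exec.WhileTrue)
  qed
qed

section \<open>Edge-disjoint forests\<close>

text \<open>
  \<open>C i v\<close> labels the component of \<open>v\<close> in the \<open>i\<close>-th forest.  An arc which merges the component
  labelled \<open>l\<close> into another one is stored in slot \<open>(i, l)\<close>; as the label \<open>l\<close> disappears from the
  \<open>i\<close>-th forest for good, every slot is filled at most once.  The arcs in \<open>D\<close> have been
  dropped because their ends are connected in each of the \<open>d + 1\<close> forests.
\<close>

locale forests =
  fixes n d :: nat and A :: "(nat \<times> nat) set" and S :: "nat \<Rightarrow> nat \<Rightarrow> (nat \<times> nat) option"
    and D :: "(nat \<times> nat) set" and C :: "nat \<Rightarrow> nat \<Rightarrow> nat"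
  assumes slot: "S i l = Some a \<Longrightarrow> i \<le> d \<and> l \<in> {1..n} \<and> a \<in> A"
    and slot_label: "S i l = Some a \<Longrightarrow> w \<in> {1..n} \<Longrightarrow> C i w \<noteq> l"
    and slot_inj: "S i l = Some a \<Longrightarrow> S i' l' = Some a \<Longrightarrow> i = i' \<and> l = l'"
    and slot_or_dropped: "a \<in> A \<Longrightarrow> a \<in> D \<or> (\<exists>i l. S i l = Some a)"
    and dropped_arcs: "D \<subseteq> A"
    and arc_ends: "A \<subseteq> {1..n} \<times> {1..n}"
    and dropped_label: "(u, v) \<in> D \<Longrightarrow> i \<le> d \<Longrightarrow> C i u = C i v"
    \<comment> \<open>Connectivity without paths: a function that is constant along the arcs stored
      in forest \<open>i\<close> is constant on each label class. This is the form in which it is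
      applied to vertex maps.\<close>
    and connected: "i \<le> d \<Longrightarrow> (\<And>l u v. S i l = Some (u, v) \<Longrightarrow> \<chi> u = \<chi> v) \<Longrightarrow>
      u \<in> {1..n} \<Longrightarrow> v \<in> {1..n} \<Longrightarrow> C i u = C i v \<Longrightarrow> \<chi> u = (\<chi> v :: nat)"
    and label_range: "i \<le> d \<Longrightarrow> w \<in> {1..n} \<Longrightarrow> C i w \<in> {1..n}"

lemma forests_empty:
  assumes "\<And>i l. i \<le> d \<Longrightarrow> l \<in> {1..n} \<Longrightarrow> C i l = l"
  shows "forests n d {} (\<lambda>_ _. None) {} C"
  by unfold_locales (use assms in auto)

text \<open>The bound \<open>k\<close> lets the same expression describe the labels after
  \<open>k\<close> passes of the relabelling loop; \<open>k = n\<close> is the complete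
  merge.\<close>

definition relabel :: "nat \<Rightarrow> nat \<Rightarrow> nat \<Rightarrow> nat \<Rightarrow> (nat \<Rightarrow> nat \<Rightarrow> nat) \<Rightarrow> nat \<Rightarrow> nat \<Rightarrow> nat" where
  "relabel k i l m C = C(i := (\<lambda>w. if w \<in> {1..k} \<and> C i w = l then m else C i w))"

text \<open>Merging gives the class of \<open>u\<close> the label of \<open>v\<close>. The old label
  of \<open>u\<close> then belongs to no vertex, and new labels are always taken from existing ones,
  so its slot can be filled now and is never asked for again.\<close>

lemma (in forests) forests_keep:
  assumes uv: "u \<in> {1..n}" "v \<in> {1..n}" "(u, v) \<notin> A"
    and i: "i \<le> d" "C i u \<noteq> C i v"
  shows "forests n d (insert (u, v) A) (S(i := (S i)(C i u := Some (u, v)))) D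
           (relabel n i (C i u) (C i v) C)"
    (is "forests n d ?A ?S D ?C")
proof
  \<comment> \<open>\<open>u\<close> still bears the label \<open>C i u\<close>, while labels of
    occupied slots are extinct.\<close>
  have free: "S i (C i u) = None" using slot_label[of i "C i u"] uv by (cases "S i (C i u)") auto
  have Crel: "?C j w = (if j = i \<and> C i w = C i u then C i v else C j w)" if "w \<in> {1..n}" for j w
    using that by (simp add: relabel_def)
  have old: "S j l = Some a" if "?S j l = Some a" "a \<noteq> (u, v)" for j l a
    using that by (auto simp: fun_upd_def split: if_splits)
  have mono: "?S j l = Some a" if "S j l = Some a" for j l a
    using that free by (auto simp: fun_upd_def)
  have new: "?S j l = Some (u, v) \<longleftrightarrow> j = i \<and> l = C i u" for j l
    using slot[of j l "(u, v)"] uv(3) by (auto simp: fun_upd_def)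
  show "j \<le> d \<and> l \<in> {1..n} \<and> a \<in> ?A" if "?S j l = Some a" for j l a
  proof (cases "a = (u, v)")
    case True
    then show ?thesis using that new label_range[OF i(1) uv(1)] i(1) by auto
  next
    case False
    then show ?thesis using slot[OF old[OF that]] by auto
  qed
  show "?C j w \<noteq> l" if "?S j l = Some a" "w \<in> {1..n}" for j l a w
  proof (cases "a = (u, v)")
    case True
    then show ?thesis using that new i(2) Crel by auto
  next
    case False
    then show ?thesis using slot_label[OF old[OF that(1)]] that(2) uv Crel by auto
  qed
  show "j = j' \<and> l = l'" if "?S j l = Some a" "?S j' l' = Some a" for j l j' l' a
  proof (cases "a = (u, v)")
    case True
    then show ?thesis using that new by simp
  next
    case False
    then show ?thesis using slot_inj[OF old[OF that(1)] old[OF that(2)]] by blast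
  qed
  show "a \<in> D \<or> (\<exists>j l. ?S j l = Some a)" if "a \<in> ?A" for a
  proof (cases "a = (u, v)")
    case True
    then show ?thesis using new by blast
  next
    case False
    then show ?thesis using that slot_or_dropped[of a] mono by blast
  qed
  show "D \<subseteq> ?A" using dropped_arcs by blast
  show "?A \<subseteq> {1..n} \<times> {1..n}" using arc_ends uv by blast
  show "?C j a = ?C j b" if "(a, b) \<in> D" "j \<le> d" for a b j
    using dropped_label[OF that] dropped_label[OF that(1) i(1)] dropped_arcs arc_ends that(1)
      Crel[of a j] Crel[of b j] by auto
  show "\<chi> a = \<chi> b" if j: "j \<le> d" and \<chi>: "\<And>l u v. ?S j l = Some (u, v) \<Longrightarrow> \<chi> u = \<chi> v"
    and ab: "a \<in> {1..n}" "b \<in> {1..n}" "?C j a = ?C j b" for j a b and \<chi> :: "nat \<Rightarrow> nat"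
  proof -
    have cl: "\<chi> a' = \<chi> b'" if "a' \<in> {1..n}" "b' \<in> {1..n}" "C j a' = C j b'" for a' b'
      by (rule connected[OF j _ that]) (rule \<chi>[OF mono])
    show ?thesis
    proof (cases "j = i")
      case False
      then have "C j a = C j b" using ab Crel by simp
      then show ?thesis by (rule cl[OF ab(1,2)])
    next
      case True
      have uv': "\<chi> u = \<chi> v" using \<chi> new True by blast
      \<comment> \<open>Either \<open>w\<close> was not relabelled, or it lay in the class of
        \<open>u\<close> and \<open>w'\<close> in that of \<open>v\<close>; in the latter case the
        new arc, along which \<open>\<chi>\<close> is constant, links the two classes.\<close>
      have "\<chi> w = \<chi> w'" if "w \<in> {1..n}" "w' \<in> {1..n}" "?C i w = C i w'" for w w'
      proof (cases "C i w = C i u")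
        case c: True
        then have "C j w = C j u" "C j w' = C j v" using that Crel[of w i] True by simp_all
        then have "\<chi> w = \<chi> u" "\<chi> w' = \<chi> v" using cl that uv by blast+
        then show ?thesis using uv' by simp
      next
        case c: False
        then have "C j w = C j w'" using that Crel[of w i] True by simp
        then show ?thesis by (rule cl[OF that(1,2)])
      qed
      \<comment> \<open>\<open>b\<close> is traded for a vertex \<open>w'\<close> whose old label is
        the new label of \<open>b\<close>, so that the preceding fact applies with
        \<open>w = a\<close>.\<close>
      moreover have "\<exists>w'\<in>{1..n}. ?C i b = C i w' \<and> \<chi> w' = \<chi> b"
      proof (cases "C i b = C i u")
        case c: True
        then have "\<chi> b = \<chi> u" using cl[OF ab(2) uv(1)] True by simp
        then show ?thesis using c Crel[OF ab(2), of i] uv(2) uv' by auto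
      next
        case False
        then show ?thesis using Crel[OF ab(2), of i] ab(2) by auto
      qed
      ultimately show ?thesis using ab True by metis
    qed
  qed
  show "?C j w \<in> {1..n}" if "j \<le> d" "w \<in> {1..n}" for j w
    using that Crel[of w j] label_range[of j w] label_range[of i v] uv i by auto
qed

lemma (in forests) forests_drop:
  assumes uv: "u \<in> {1..n}" "v \<in> {1..n}" "\<And>i. i \<le> d \<Longrightarrow> C i u = C i v"
  shows "forests n d (insert (u, v) A) S (insert (u, v) D) C"
proof
  show "i \<le> d \<and> l \<in> {1..n} \<and> a \<in> insert (u, v) A" if "S i l = Some a" for i l a
    using slot[OF that] by blast
  show "a \<in> insert (u, v) D \<or> (\<exists>i l. S i l = Some a)" if "a \<in> insert (u, v) A" for a
    using that slot_or_dropped by blast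
  show "insert (u, v) D \<subseteq> insert (u, v) A" using dropped_arcs by blast
  show "insert (u, v) A \<subseteq> {1..n} \<times> {1..n}" using arc_ends uv by blast
  show "C i a = C i b" if "(a, b) \<in> insert (u, v) D" "i \<le> d" for a b i
    using that dropped_label uv(3) by blast
qed (fact slot_label slot_inj connected label_range)+

section \<open>The List Allocation instance\<close>

text \<open>
  The vertices are divided into \<open>2 d + 3\<close> blocks of size \<open>n\<close>: block \<open>0\<close> is \<open>V(G)\<close>, and the paths of the arcs
  in the \<open>i\<close>-th forest have their vertices \<open>x\<close> and \<open>y\<close> in the blocks \<open>2 i + 1\<close> and \<open>2 i + 2\<close>.  Vertices of
  empty slots are isolated; they make the number of vertices depend on \<open>n\<close> and \<open>d\<close> only.
\<close>

definition xid :: "nat \<Rightarrow> nat \<Rightarrow> nat \<Rightarrow> nat" where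
  "xid n i l = n * (2 * i + 1) + l"

definition yid :: "nat \<Rightarrow> nat \<Rightarrow> nat \<Rightarrow> nat" where
  "yid n i l = n * (2 * i + 2) + l"

definition block :: "nat \<Rightarrow> nat \<Rightarrow> nat" where
  "block n v = (v - 1) div n"

text \<open>A common left inverse of \<open>xid\<close> and \<open>yid\<close>: the blocks
  \<open>2 * i + 1\<close> and \<open>2 * i + 2\<close> both yield \<open>i\<close> after
  subtracting 1 and halving. The shifts in the second component are due to labels starting at
  1.\<close>

definition slot_of :: "nat \<Rightarrow> nat \<Rightarrow> nat \<times> nat" where
  "slot_of n v = ((block n v - 1) div 2, (v - 1) mod n + 1)"

lemma block_mult_add: "l \<in> {1..n} \<Longrightarrow> block n (n * k + l) = k"
  by (cases l) (auto simp: block_def)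

lemma block_xid [simp]: "l \<in> {1..n} \<Longrightarrow> block n (xid n i l) = 2 * i + 1"
  unfolding xid_def by (rule block_mult_add)

lemma block_yid [simp]: "l \<in> {1..n} \<Longrightarrow> block n (yid n i l) = 2 * i + 2"
  unfolding yid_def by (rule block_mult_add)

lemma mod_mult_add_pred: "l \<in> {1..n} \<Longrightarrow> (n * k + l - 1) mod n + 1 = (l::nat)"
  by (cases l) (auto simp: mod_Suc)

lemma slot_of_xid [simp]: "l \<in> {1..n} \<Longrightarrow> slot_of n (xid n i l) = (i, l)"
  using mod_mult_add_pred[of l n "2 * i + 1"] by (simp add: slot_of_def) (simp add: xid_def)

lemma slot_of_yid [simp]: "l \<in> {1..n} \<Longrightarrow> slot_of n (yid n i l) = (i, l)"
  using mod_mult_add_pred[of l n "2 * i + 2"] by (simp add: slot_of_def) (simp add: yid_def)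

lemma mult_add_le: "l \<le> n \<Longrightarrow> Suc k \<le> m \<Longrightarrow> n * k + l \<le> n * (m::nat)"
proof -
  assume "l \<le> n" "Suc k \<le> m"
  then have "n * k + l \<le> n * Suc k" "n * Suc k \<le> n * m" by (simp, blast intro: mult_le_mono2)
  then show ?thesis by linarith
qed

lemma xid_bounds: "l \<in> {1..n} \<Longrightarrow> i \<le> d \<Longrightarrow> n < xid n i l \<and> xid n i l \<le> n * (2 * d + 3)"
  unfolding xid_def using mult_add_le[of l n "2*i+1" "2*d+3"] by auto

lemma yid_bounds: "l \<in> {1..n} \<Longrightarrow> i \<le> d \<Longrightarrow> n < yid n i l \<and> yid n i l \<le> n * (2 * d + 3)"
  unfolding yid_def using mult_add_le[of l n "2*i+2" "2*d+3"] by auto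

text \<open>Division of \<open>v - 1\<close> by \<open>n\<close>: the quotient is 0, odd, or even
  and positive.\<close>

lemma vertex_cases:
  assumes "v \<in> {1..n * (2 * d + 3)}"
  obtains "v \<in> {1..n}"
  | i l where "i \<le> d" "l \<in> {1..n}" "v = xid n i l"
  | i l where "i \<le> d" "l \<in> {1..n}" "v = yid n i l"
proof -
  have n: "n > 0" using assms by (cases n) auto
  define k where "k = (v - 1) div n"
  define l where "l = (v - 1) mod n + 1"
  have l: "l \<in> {1..n}" using n by (auto simp: l_def Suc_le_eq)
  have v: "v = n * k + l" using assms mult_div_mod_eq[of n "v - 1"] unfolding k_def l_def by auto
  have "v - 1 < (2 * d + 3) * n" using assms by (auto simp: mult.commute)
  then have k: "k < 2 * d + 3" unfolding k_def by (rule less_mult_imp_div_less)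
  consider "k = 0" | i where "k = 2 * i + 1" | i where "k = 2 * i + 2"
  proof (cases "even k")
    case True
    then obtain m where "k = 2 * m" by blast
    then show ?thesis using that by (cases m) auto
  next
    case False
    then show ?thesis using that by (auto elim!: oddE)
  qed
  then show thesis
  proof cases
    case 1
    then show ?thesis using v l that(1) by simp
  next
    case (2 i)
    then show ?thesis using v l k that(2)[of i l] by (simp add: xid_def)
  next
    case (3 i)
    then show ?thesis using v l k that(3)[of i l] by (simp add: yid_def)
  qed
qed

definition slot_edges:: "nat \<Rightarrow> (nat \<Rightarrow> nat \<Rightarrow> (nat \<times> nat) option) \<Rightarrow> nat set set" where
  "slot_edges n S = {e. \<exists>i l u v. S i l = Some (u, v) \<and>
     (e = {u, xid n i l} \<or> e = {xid n i l, yid n i l} \<or> e = {yid n i l, v})}"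

text \<open>The two parts of each gadget are numbered consecutively after the vertices of
  \<open>H\<close>, so that a counter advanced by 2 produces them.\<close>

definition ppart :: "nat \<Rightarrow> nat \<Rightarrow> nat" where
  "ppart h k = h + 2 * k + 1"

definition qpart :: "nat \<Rightarrow> nat \<Rightarrow> nat" where
  "qpart h k = h + 2 * k + 2"

definition gadget_pairs :: "nat \<Rightarrow> (nat \<times> nat) list \<Rightarrow> nat \<Rightarrow> (nat \<times> nat) list" where
  "gadget_pairs h ps k =
     [(fst (ps ! k), ppart h k), (ppart h k, qpart h k), (qpart h k, snd (ps ! k))]"

text \<open>A sum over gadgets suits the computation of the weight and of the counts. For arcs from
  a valid enumeration at most one term is nonzero, since gadgets share no pair.\<close>

definition gadget_alpha :: "nat \<Rightarrow> (nat \<times> nat) list \<Rightarrow> (nat \<times> nat \<Rightarrow> nat) \<Rightarrow> nat set \<Rightarrow> nat" where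
  "gadget_alpha h ps \<alpha> e = (\<Sum>k<length ps.
     if e \<in> (\<lambda>(i, j). {i, j}) ` set (gadget_pairs h ps k) then \<alpha> (ps ! k) else 0)"

definition gadget_enum :: "nat \<Rightarrow> (nat \<times> nat) list \<Rightarrow> nat \<Rightarrow> (nat \<times> nat) list" where
  "gadget_enum h ps k = concat (map (gadget_pairs h ps) [0..<k])"

text \<open>\<open>k\<close> counts the gadgets already processed, which makes the list usable in a
  loop invariant.\<close>

definition xlist :: "nat \<Rightarrow> nat set \<Rightarrow> nat \<Rightarrow> nat set" where
  "xlist h L k = L \<union> ppart h ` {..<k}"

definition ylist :: "nat \<Rightarrow> nat set \<Rightarrow> nat \<Rightarrow> nat set" where
  "ylist h L k = L \<union> qpart h ` {..<k}"

definition arc_list :: "(nat \<times> nat) set \<Rightarrow> nat set \<Rightarrow> (nat \<Rightarrow> nat set) \<Rightarrow> nat \<Rightarrow> nat set" where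
  "arc_list D L lam v = (if v \<in> Field D then lam v \<inter> L else lam v)"

definition loops :: "hom_instance \<Rightarrow> nat set" where
  "loops I = {a. (a, a) \<in> parcs (hom_H I)}"

text \<open>
  The part \<open>r\<close> accommodates the isolated vertices.  It may be in the lists of all \<open>x\<close> and \<open>y\<close>, since no
  vertex of \<open>G\<close> may use it and all demands on it are \<open>0\<close>.
\<close>

definition allocation :: "hom_instance \<Rightarrow> (nat \<times> nat) list \<Rightarrow>
    (nat \<Rightarrow> nat \<Rightarrow> (nat \<times> nat) option) \<Rightarrow> (nat \<times> nat) set \<Rightarrow> la_instance" where
  "allocation I ps S D =
     (let n = hom_n I; h = hom_h I; r = h + 2 * length ps + 1 in
      \<lparr>la_n = n * (2 * hom_d I + 3),
       la_edges = mset_set (slot_edges n S),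
       la_r = r,
       la_list = (\<lambda>v. if v \<le> n then arc_list D (loops I) (hom_list I) v
          else insert r (if odd (block n v) then xlist h (loops I) (length ps)
            else ylist h (loops I) (length ps))),
       la_alpha = gadget_alpha h ps (hom_alpha I)\<rparr>)"

section \<open>Demands of the gadgets\<close>

locale hom_input =
  fixes I :: hom_instance and ps :: "(nat \<times> nat) list"
  assumes valid: "hom_valid I" and enum: "hom_enum I ps"
begin

abbreviation "n \<equiv> hom_n I"
abbreviation "h \<equiv> hom_h I"
abbreviation "d \<equiv> hom_d I"
abbreviation "r \<equiv> h + 2 * length ps + 1"
abbreviation "N \<equiv> n * (2 * d + 3)"
abbreviation "p \<equiv> ppart h"
abbreviation "q \<equiv> qpart h"
abbreviation "a k \<equiv> fst (ps ! k)"
abbreviation "b k \<equiv> snd (ps ! k)"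
abbreviation "\<alpha> \<equiv> hom_alpha I"

lemma ps_arc: assumes "k < length ps"
  shows "(a k, b k) \<in> parcs (hom_H I)" "a k \<noteq> b k" "a k \<in> {1..h}" "b k \<in> {1..h}" "\<alpha> (ps ! k) > 0"
proof -
  have "ps ! k \<in> {e \<in> nonloop_arcs (hom_H I). \<alpha> e > 0}"
    using enum assms nth_mem unfolding hom_enum_def by blast
  then show 1: "(a k, b k) \<in> parcs (hom_H I)" "a k \<noteq> b k" "\<alpha> (ps ! k) > 0"
    by (auto simp: nonloop_arcs_def)
  have "pair_fin_digraph (hom_H I)" "pverts (hom_H I) = {1..h}" using valid by (auto simp: hom_valid_def)
  then show "a k \<in> {1..h}" "b k \<in> {1..h}"
    using pair_wf_digraph.arc_fst_in_verts[OF _ 1(1)] pair_wf_digraph.arc_snd_in_verts[OF _ 1(1)]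
    by (auto simp: pair_fin_digraph_def)
qed

lemma ps_inj: "k < length ps \<Longrightarrow> k' < length ps \<Longrightarrow> ps ! k = ps ! k' \<longleftrightarrow> k = k'"
  using enum by (simp add: hom_enum_def nth_eq_iff_index_eq)

lemma in_ps: "(u, v) \<in> parcs (hom_H I) \<Longrightarrow> u \<noteq> v \<Longrightarrow> \<alpha> (u, v) > 0 \<Longrightarrow> \<exists>k<length ps. ps ! k = (u, v)"
  using enum unfolding hom_enum_def nonloop_arcs_def in_set_conv_nth[symmetric] by auto

lemma loops_range: "loops I \<subseteq> {1..h}"
proof
  fix u assume "u \<in> loops I"
  then have 1: "(u, u) \<in> parcs (hom_H I)" by (simp add: loops_def)
  have "pair_fin_digraph (hom_H I)" "pverts (hom_H I) = {1..h}" using valid by (auto simp: hom_valid_def)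
  then show "u \<in> {1..h}" using pair_wf_digraph.arc_fst_in_verts[OF _ 1] by (auto simp: pair_fin_digraph_def)
qed

lemma hom_d_eq: "d = (\<Sum>k<length ps. \<alpha> (ps ! k))"
proof -
  have "pair_fin_digraph (hom_H I)" using valid by (auto simp: hom_valid_def)
  then have "finite (parcs (hom_H I))" by (rule pair_fin_digraph.pair_finite_arcs)
  then have fin: "finite (nonloop_arcs (hom_H I))"
    by (rule rev_finite_subset) (auto simp: nonloop_arcs_def)
  have "d = sum \<alpha> (set ps)" unfolding hom_d_def
    by (rule sum.mono_neutral_right) (use fin enum in \<open>auto simp: hom_enum_def\<close>)
  also have "\<dots> = (\<Sum>k<length ps. \<alpha> (ps ! k))"
    using enum sum.reindex_bij_betw[OF bij_betw_nth[OF _ refl refl], of ps \<alpha>]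
    unfolding hom_enum_def by simp
  finally show ?thesis .
qed

text \<open>The three pairs of one gadget differ, because \<open>a k\<close> and \<open>b k\<close>
  are at most \<open>h\<close> while \<open>p k\<close> and \<open>q k\<close> lie above
  \<open>h\<close>; membership in the gadget thus splits into three summands.\<close>

lemma gadget_alpha_sum3:
  "gadget_alpha h ps \<alpha> e = (\<Sum>k<length ps.
     (if e = {a k, p k} then \<alpha> (ps ! k) else 0) + (if e = {p k, q k} then \<alpha> (ps ! k) else 0) +
     (if e = {q k, b k} then \<alpha> (ps ! k) else 0))"
  unfolding gadget_alpha_def
proof (rule sum.cong)
  fix k assume "k \<in> {..<length ps}"
  then have "a k \<le> h" "b k \<le> h" using ps_arc[of k] by auto
  then have "{a k, p k} \<noteq> {p k, q k}" "{a k, p k} \<noteq> {q k, b k}" "{p k, q k} \<noteq> {q k, b k}"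
    by (auto simp: doubleton_eq_iff ppart_def qpart_def)
  then show "(if e \<in> (\<lambda>(i, j). {i, j}) ` set (gadget_pairs h ps k) then \<alpha> (ps ! k) else 0) =
     (if e = {a k, p k} then \<alpha> (ps ! k) else 0) + (if e = {p k, q k} then \<alpha> (ps ! k) else 0) +
     (if e = {q k, b k} then \<alpha> (ps ! k) else 0)"
    by (auto simp: gadget_pairs_def)
qed simp

lemma p_ne_q [simp]: "p k \<noteq> q k'" "q k' \<noteq> p k"
  unfolding ppart_def qpart_def by presburger+

lemma p_inj [simp]: "p k = p k' \<longleftrightarrow> k = k'" and q_inj [simp]: "q k = q k' \<longleftrightarrow> k = k'"
  by (auto simp: ppart_def qpart_def)

lemma p_q_range: "k < length ps \<Longrightarrow> h < p k \<and> p k < r \<and> h < q k \<and> q k < r"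
  by (auto simp: ppart_def qpart_def)

text \<open>Every pair of a gadget contains \<open>p k\<close> or \<open>q k\<close>, and these new
  parts determine \<open>k\<close>.\<close>

lemma gadget_pair_inj:
  assumes "k < length ps" "k' < length ps"
    and "e \<in> {{a k, p k}, {p k, q k}, {q k, b k}}" "e \<in> {{a k', p k'}, {p k', q k'}, {q k', b k'}}"
  shows "k = k'"
proof -
  have "a k \<le> h" "b k \<le> h" "a k' \<le> h" "b k' \<le> h" using ps_arc[of k] ps_arc[of k'] assms by auto
  then show ?thesis using assms(3,4) p_q_range[OF assms(1)] p_q_range[OF assms(2)]
    by (auto simp: doubleton_eq_iff)
qed

lemma gadget_alpha_eq:
  assumes k: "k < length ps" and e: "e \<in> {{a k, p k}, {p k, q k}, {q k, b k}}"
  shows "gadget_alpha h ps \<alpha> e = \<alpha> (ps ! k)"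
proof -
  have "gadget_alpha h ps \<alpha> e = (\<Sum>k'<length ps. if k' = k then \<alpha> (ps ! k) else 0)"
    unfolding gadget_alpha_def
  proof (rule sum.cong)
    fix k' assume "k' \<in> {..<length ps}"
    then have k': "k' < length ps" by simp
    have "e \<in> (\<lambda>(i, j). {i, j}) ` set (gadget_pairs h ps k') \<longleftrightarrow> k' = k"
      using gadget_pair_inj[OF k' k _ e] e by (auto simp: gadget_pairs_def)
    then show "(if e \<in> (\<lambda>(i, j). {i, j}) ` set (gadget_pairs h ps k') then \<alpha> (ps ! k') else 0) =
      (if k' = k then \<alpha> (ps ! k) else 0)" by auto
  qed simp
  then show ?thesis using k by simp
qed

lemma gadget_alpha_pos:
  assumes "gadget_alpha h ps \<alpha> e \<noteq> 0"
  shows "\<exists>k<length ps. e \<in> {{a k, p k}, {p k, q k}, {q k, b k}}"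
proof -
  obtain k where "k < length ps" "e \<in> (\<lambda>(i, j). {i, j}) ` set (gadget_pairs h ps k)"
    using assms unfolding gadget_alpha_def by (auto elim!: sum.not_neutral_contains_not_neutral split: if_splits)
  then show ?thesis by (auto simp: gadget_pairs_def)
qed

lemma gadget_pairs_mem:
  assumes "k < length ps"
  shows "{a k, p k} \<in> pairs r" "{p k, q k} \<in> pairs r" "{q k, b k} \<in> pairs r"
  using ps_arc[OF assms] p_q_range[OF assms] by (auto simp: pairs_def)

lemma hom_list_range: "v \<in> {1..n} \<Longrightarrow> hom_list I v \<subseteq> {1..h}"
  using valid unfolding hom_valid_def by metis

lemma xlist_range: "xlist h (loops I) (length ps) \<subseteq> {1..r}" "ylist h (loops I) (length ps) \<subseteq> {1..r}"
  using loops_range p_q_range by (force simp: xlist_def ylist_def)+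

end

section \<open>Correctness of the reduction, with edges counted through slots\<close>

locale reduction = hom_input +
  fixes S :: "nat \<Rightarrow> nat \<Rightarrow> (nat \<times> nat) option" and D :: "(nat \<times> nat) set" and C :: "nat \<Rightarrow> nat \<Rightarrow> nat"
  assumes forests: "forests (hom_n I) (hom_d I) (parcs (hom_G I)) S D C"
begin

abbreviation "J \<equiv> allocation I ps S D"

sublocale F: forests n d "parcs (hom_G I)" S D C by (rule forests)

definition slots :: "(nat \<times> nat) set" where
  "slots = {(i, l). S i l \<noteq> None}"

definition src :: "nat \<times> nat \<Rightarrow> nat" where "src s = fst (the (S (fst s) (snd s)))"
definition tgt :: "nat \<times> nat \<Rightarrow> nat" where "tgt s = snd (the (S (fst s) (snd s)))"
definition x :: "nat \<times> nat \<Rightarrow> nat" where "x s = xid n (fst s) (snd s)"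
definition y :: "nat \<times> nat \<Rightarrow> nat" where "y s = yid n (fst s) (snd s)"

lemma slotD: "s \<in> slots \<Longrightarrow> S (fst s) (snd s) = Some (src s, tgt s)"
  by (auto simp: slots_def src_def tgt_def)

lemma slot_range: "s \<in> slots \<Longrightarrow> fst s \<le> d \<and> snd s \<in> {1..n}"
  using F.slot[OF slotD] by blast

lemma finite_slots: "finite slots"
  by (rule finite_subset[of _ "{..d} \<times> {1..n}"]) (use slot_range in auto)

lemma arc_in: "s \<in> slots \<Longrightarrow> (src s, tgt s) \<in> parcs (hom_G I)"
  using F.slot[OF slotD] by blast

lemma end_range: assumes "s \<in> slots" shows "src s \<in> {1..n}" "tgt s \<in> {1..n}"
  using arc_in[OF assms] F.arc_ends by auto

lemma x_range: "s \<in> slots \<Longrightarrow> n < x s \<and> x s \<le> N"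
  unfolding x_def by (rule xid_bounds) (use slot_range in blast)+

lemma y_range: "s \<in> slots \<Longrightarrow> n < y s \<and> y s \<le> N"
  unfolding y_def by (rule yid_bounds) (use slot_range in blast)+

lemma block_x: "s \<in> slots \<Longrightarrow> block n (x s) = 2 * fst s + 1"
  using slot_range[of s] by (simp add: x_def)

lemma block_y: "s \<in> slots \<Longrightarrow> block n (y s) = 2 * fst s + 2"
  using slot_range[of s] by (simp add: y_def)

lemma slot_of_x: "s \<in> slots \<Longrightarrow> slot_of n (x s) = s"
  using slot_range[of s] by (simp add: x_def)

lemma slot_of_y: "s \<in> slots \<Longrightarrow> slot_of n (y s) = s"
  using slot_range[of s] by (simp add: y_def)

lemma x_inj: "s \<in> slots \<Longrightarrow> t \<in> slots \<Longrightarrow> x s = x t \<longleftrightarrow> s = t"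
  by (metis slot_of_x)

lemma y_inj: "s \<in> slots \<Longrightarrow> t \<in> slots \<Longrightarrow> y s = y t \<longleftrightarrow> s = t"
  by (metis slot_of_y)

lemma x_ne_y: assumes "s \<in> slots" "t \<in> slots" shows "x s \<noteq> y t"
proof
  assume "x s = y t"
  then have "2 * fst s + 1 = 2 * fst t + 2" using block_x[OF assms(1)] block_y[OF assms(2)] by simp
  then show False by presburger
qed

lemma slot_edges_eq:
  "slot_edges n S = (\<lambda>s. {src s, x s}) ` slots \<union> (\<lambda>s. {x s, y s}) ` slots \<union> (\<lambda>s. {y s, tgt s}) ` slots"
proof -
  have "S i l = Some (u, v) \<longleftrightarrow> (i, l) \<in> slots \<and> u = src (i, l) \<and> v = tgt (i, l)" for i l u v
    by (auto simp: slots_def src_def tgt_def)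
  then have "slot_edges n S = {e. \<exists>s\<in>slots. e = {src s, x s} \<or> e = {x s, y s} \<or> e = {y s, tgt s}}"
    unfolding slot_edges_def x_def y_def Bex_def split_paired_Ex fst_conv snd_conv by simp
  then show ?thesis by auto
qed

lemma finite_slot_edges: "finite (slot_edges n S)"
  using finite_slots by (simp add: slot_edges_eq)

definition cnt :: "(nat \<Rightarrow> nat) \<Rightarrow> nat set \<Rightarrow> nat" where
  "cnt \<phi> e = card {s \<in> slots. {\<phi> (src s), \<phi> (x s)} = e} +
     card {s \<in> slots. {\<phi> (x s), \<phi> (y s)} = e} +
     card {s \<in> slots. {\<phi> (y s), \<phi> (tgt s)} = e}"

text \<open>Edges are traded for slots: every edge contains an \<open>x\<close>- or
  \<open>y\<close>-vertex, which determines its slot, and the kinds of its ends tell which third of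
  the path it is. So no edge is counted twice.\<close>

lemma edges_between_parts:
  assumes "i \<noteq> j"
  shows "edges_between J {v \<in> {1..N}. \<phi> v = i} {v \<in> {1..N}. \<phi> v = j} = cnt \<phi> {i, j}"
proof -
  let ?Q = "\<lambda>e. \<exists>u\<in>{v \<in> {1..N}. \<phi> v = i}. \<exists>w\<in>{v \<in> {1..N}. \<phi> v = j}. e = {u, w}"
  have Q: "?Q {u, w} \<longleftrightarrow> {\<phi> u, \<phi> w} = {i, j}" if "u \<in> {1..N}" "w \<in> {1..N}" for u w
  proof
    assume "?Q {u, w}"
    then show "{\<phi> u, \<phi> w} = {i, j}" by (auto simp: doubleton_eq_iff)
  next
    assume "{\<phi> u, \<phi> w} = {i, j}"
    then consider "\<phi> u = i" "\<phi> w = j" | "\<phi> u = j" "\<phi> w = i" by (auto simp: doubleton_eq_iff)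
    then show "?Q {u, w}"
    proof cases
      case 1
      then show ?thesis using that by blast
    next
      case 2
      then show ?thesis using that by (auto simp: insert_commute)
    qed
  qed
  define B1 where "B1 = {s \<in> slots. {\<phi> (src s), \<phi> (x s)} = {i, j}}"
  define B2 where "B2 = {s \<in> slots. {\<phi> (x s), \<phi> (y s)} = {i, j}}"
  define B3 where "B3 = {s \<in> slots. {\<phi> (y s), \<phi> (tgt s)} = {i, j}}"
  have sub: "B1 \<subseteq> slots" "B2 \<subseteq> slots" "B3 \<subseteq> slots" by (auto simp: B1_def B2_def B3_def)
  have fin: "finite B1" "finite B2" "finite B3" using sub finite_slots finite_subset by blast+
  have nN: "n \<le> N" by simp
  have inN: "src s \<in> {1..N}" "tgt s \<in> {1..N}" "x s \<in> {1..N}" "y s \<in> {1..N}" if "s \<in> slots" for s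
    using end_range[OF that] x_range[OF that] y_range[OF that] nN
    by (auto intro: order_trans simp del: mult_Suc_right)
  have "{e \<in> slot_edges n S. ?Q e} =
      (\<lambda>s. {src s, x s}) ` B1 \<union> (\<lambda>s. {x s, y s}) ` B2 \<union> (\<lambda>s. {y s, tgt s}) ` B3" (is "?E = ?R")
  proof -
    have img: "f ` {s \<in> slots. P s} = {e \<in> f ` slots. ?Q e}"
      if "\<And>s. s \<in> slots \<Longrightarrow> ?Q (f s) \<longleftrightarrow> P s" for f :: "nat \<times> nat \<Rightarrow> nat set" and P
      by (rule set_eqI) (use that in blast)
    have "(\<lambda>s. {src s, x s}) ` B1 = {e \<in> (\<lambda>s. {src s, x s}) ` slots. ?Q e}"
      unfolding B1_def by (rule img, rule Q) (simp_all only: inN)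
    moreover have "(\<lambda>s. {x s, y s}) ` B2 = {e \<in> (\<lambda>s. {x s, y s}) ` slots. ?Q e}"
      unfolding B2_def by (rule img, rule Q) (simp_all only: inN)
    moreover have "(\<lambda>s. {y s, tgt s}) ` B3 = {e \<in> (\<lambda>s. {y s, tgt s}) ` slots. ?Q e}"
      unfolding B3_def by (rule img, rule Q) (simp_all only: inN)
    moreover have "{e \<in> A \<union> A' \<union> A''. ?Q e} = {e \<in> A. ?Q e} \<union> {e \<in> A'. ?Q e} \<union> {e \<in> A''. ?Q e}" for A A' A''
      by auto
    ultimately show ?thesis unfolding slot_edges_eq by simp
  qed
  moreover have "card ?R = card B1 + card B2 + card B3"
  proof -
    have ne: "src s \<noteq> x t" "src s \<noteq> y t" "tgt s \<noteq> x t" "tgt s \<noteq> y t" if "s \<in> slots" "t \<in> slots" for s t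
      using end_range[OF that(1)] x_range[OF that(2)] y_range[OF that(2)] by auto
    have i1: "inj_on (\<lambda>s. {src s, x s}) B1"
    proof (rule inj_onI)
      fix s t assume st: "s \<in> B1" "t \<in> B1" and "{src s, x s} = {src t, x t}"
      then have "x s = x t" using ne sub(1) by (metis doubleton_eq_iff subsetD)
      then show "s = t" using x_inj st sub(1) by blast
    qed
    have i2: "inj_on (\<lambda>s. {x s, y s}) B2"
    proof (rule inj_onI)
      fix s t assume st: "s \<in> B2" "t \<in> B2" and "{x s, y s} = {x t, y t}"
      then have "x s = x t" using x_ne_y sub(2) by (metis doubleton_eq_iff subsetD)
      then show "s = t" using x_inj st sub(2) by blast
    qed
    have i3: "inj_on (\<lambda>s. {y s, tgt s}) B3"
    proof (rule inj_onI)
      fix s t assume st: "s \<in> B3" "t \<in> B3" and "{y s, tgt s} = {y t, tgt t}"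
      then have "y s = y t" using ne sub(3) by (metis doubleton_eq_iff subsetD)
      then show "s = t" using y_inj st sub(3) by blast
    qed
    have d1: "{src s, x s} \<noteq> {x t, y t}" "{src s, x s} \<noteq> {y t, tgt t}" "{x s, y s} \<noteq> {y t, tgt t}"
      if "s \<in> slots" "t \<in> slots" for s t
      using ne[OF that] ne[OF that(2,1)] x_ne_y[OF that] by (auto simp: doubleton_eq_iff)
    have img: "f ` B \<inter> g ` B' = {}"
      if "\<And>s t. s \<in> slots \<Longrightarrow> t \<in> slots \<Longrightarrow> f s \<noteq> g t" "B \<subseteq> slots" "B' \<subseteq> slots"
      for f g :: "nat \<times> nat \<Rightarrow> nat set" and B B'
      using that by blast
    have disj: "(\<lambda>s. {src s, x s}) ` B1 \<inter> (\<lambda>s. {x s, y s}) ` B2 = {}"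
      "((\<lambda>s. {src s, x s}) ` B1 \<union> (\<lambda>s. {x s, y s}) ` B2) \<inter> (\<lambda>s. {y s, tgt s}) ` B3 = {}"
      unfolding Int_Un_distrib2 by (simp_all only: img[OF d1(1) sub(1,2)] img[OF d1(2) sub(1,3)]
          img[OF d1(3) sub(2,3)] Un_empty)
    show ?thesis
      using disj fin by (simp add: card_Un_disjoint card_image i1 i2 i3)
  qed
  ultimately show ?thesis
    by (simp add: edges_between_def allocation_def Let_def filter_mset_mset_set finite_slot_edges
        cnt_def B1_def B2_def B3_def)
qed

lemma la_J [simp]:
  "la_n J = N" "la_r J = r" "la_alpha J = gadget_alpha h ps \<alpha>" "la_edges J = mset_set (slot_edges n S)"
  by (simp_all add: allocation_def Let_def)

lemma la_list_J:
  "v \<le> n \<Longrightarrow> la_list J v = arc_list D (loops I) (hom_list I) v"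
  "n < v \<Longrightarrow> la_list J v = insert r (if odd (block n v) then xlist h (loops I) (length ps)
            else ylist h (loops I) (length ps))"
  by (simp_all add: allocation_def Let_def)

lemma la_list_x: "s \<in> slots \<Longrightarrow> la_list J (x s) = insert r (xlist h (loops I) (length ps))"
  by (simp add: la_list_J x_range block_x)

lemma la_list_y: "s \<in> slots \<Longrightarrow> la_list J (y s) = insert r (ylist h (loops I) (length ps))"
  by (simp add: la_list_J y_range block_y)

text \<open>An allocation is given as a function, whose fibres are disjoint by themselves; covering
  \<open>{1..N}\<close> becomes the range condition.\<close>

lemma la_solution_iff:
  "la_solution J (\<lambda>i. {v \<in> {1..N}. \<phi> v = i}) \<longleftrightarrow>
     (\<forall>v\<in>{1..N}. \<phi> v \<in> {1..r} \<and> \<phi> v \<in> la_list J v) \<and>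
     (\<forall>i\<in>{1..r}. \<forall>j\<in>{1..r}. i \<noteq> j \<longrightarrow> cnt \<phi> {i, j} = gadget_alpha h ps \<alpha> {i, j})"
proof -
  have "(\<Union>i\<in>{1..r}. {v \<in> {1..N}. \<phi> v = i}) = {1..N} \<longleftrightarrow> (\<forall>v\<in>{1..N}. \<phi> v \<in> {1..r})" by blast
  moreover have "(\<forall>i\<in>{1..r}. \<forall>v\<in>{v \<in> {1..N}. \<phi> v = i}. i \<in> la_list J v) \<longleftrightarrow>
     (\<forall>v\<in>{1..N}. \<phi> v \<in> {1..r} \<longrightarrow> \<phi> v \<in> la_list J v)" by blast
  moreover have "\<forall>i\<in>{1..r}. \<forall>j\<in>{1..r}. i \<noteq> j \<longrightarrow> {v \<in> {1..N}. \<phi> v = i} \<inter> {v \<in> {1..N}. \<phi> v = j} = {}"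
    by blast
  moreover have "(\<forall>i\<in>{1..r}. \<forall>j\<in>{1..r}. i \<noteq> j \<longrightarrow>
        edges_between J {v \<in> {1..N}. \<phi> v = i} {v \<in> {1..N}. \<phi> v = j} = la_alpha J {i, j}) \<longleftrightarrow>
      (\<forall>i\<in>{1..r}. \<forall>j\<in>{1..r}. i \<noteq> j \<longrightarrow> cnt \<phi> {i, j} = gadget_alpha h ps \<alpha> {i, j})"
    using edges_between_parts by simp
  ultimately show ?thesis unfolding la_solution_def la_J by blast
qed

text \<open>After exchanging the sums, every gadget contributes its demand at each of its three
  pairs, all of which belong to \<open>pairs r\<close>.\<close>

lemma la_w_J: "la_w J = 3 * d"
proof -
  have fin: "finite (pairs r)" unfolding pairs_def by (rule finite_subset[of _ "Pow {1..r}"]) auto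
  have "la_w J = (\<Sum>k<length ps. \<Sum>e\<in>pairs r.
     (if e = {a k, p k} then \<alpha> (ps ! k) else 0) + (if e = {p k, q k} then \<alpha> (ps ! k) else 0) +
     (if e = {q k, b k} then \<alpha> (ps ! k) else 0))"
    unfolding la_w_def la_J gadget_alpha_sum3 by (rule sum.swap)
  also have "\<dots> = (\<Sum>k<length ps. 3 * \<alpha> (ps ! k))"
    by (rule sum.cong) (use gadget_pairs_mem fin in \<open>simp_all add: sum.distrib\<close>)
  finally show ?thesis by (simp add: hom_d_eq sum_distrib_left)
qed

text \<open>Different gadgets have no pair in common and the arcs in \<open>ps\<close> have positive
  demand, so writing the pairs gadget by gadget meets each pair of positive demand exactly
  once.\<close>

lemma la_enum_J: "la_enum J (gadget_enum h ps (length ps))"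
proof -
  let ?f = "\<lambda>(i, j). {i, j :: nat}"
  have m: "set (map ?f (gadget_pairs h ps k)) = {{a k, p k}, {p k, q k}, {q k, b k}}" for k
    by (auto simp: gadget_pairs_def)
  have un: "set (map ?f (gadget_enum h ps m)) = (\<Union>k<m. set (map ?f (gadget_pairs h ps k)))" for m
    by (simp add: gadget_enum_def image_UN atLeast0LessThan)
  have dist: "distinct (map ?f (gadget_enum h ps m))" if "m \<le> length ps" for m
    using that
  proof (induction m)
    case (Suc m)
    have "a m \<le> h" "b m \<le> h" using ps_arc[of m] Suc.prems by auto
    then have "distinct (map ?f (gadget_pairs h ps m))"
      using p_q_range[of m] Suc.prems by (auto simp: gadget_pairs_def doubleton_eq_iff)
    moreover have "set (map ?f (gadget_enum h ps m)) \<inter> set (map ?f (gadget_pairs h ps m)) = {}"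
    proof (rule equals0I)
      fix e assume e: "e \<in> set (map ?f (gadget_enum h ps m)) \<inter> set (map ?f (gadget_pairs h ps m))"
      then obtain k where k: "k < m" "e \<in> set (map ?f (gadget_pairs h ps k))"
        unfolding un by blast
      then show False using e Suc.prems gadget_pair_inj[of k m e] unfolding m by auto
    qed
    ultimately show ?case using Suc by (simp add: gadget_enum_def del: set_map)
  qed (simp add: gadget_enum_def)
  have "set (map ?f (gadget_enum h ps (length ps))) = (\<Union>k<length ps. set (map ?f (gadget_pairs h ps k)))"
    by (rule un)
  also have "\<dots> = {e \<in> pairs r. gadget_alpha h ps \<alpha> e > 0}"
  proof (rule set_eqI)
    fix e
    show "e \<in> (\<Union>k<length ps. set (map ?f (gadget_pairs h ps k))) \<longleftrightarrow>
        e \<in> {e \<in> pairs r. gadget_alpha h ps \<alpha> e > 0}"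
    proof
      assume "e \<in> (\<Union>k<length ps. set (map ?f (gadget_pairs h ps k)))"
      then obtain k where k: "k < length ps" "e \<in> {{a k, p k}, {p k, q k}, {q k, b k}}"
        unfolding m by blast
      then show "e \<in> {e \<in> pairs r. gadget_alpha h ps \<alpha> e > 0}"
        using gadget_alpha_eq[OF k] ps_arc(5)[OF k(1)] gadget_pairs_mem[OF k(1)] by auto
    next
      assume "e \<in> {e \<in> pairs r. gadget_alpha h ps \<alpha> e > 0}"
      then have "\<exists>k<length ps. e \<in> {{a k, p k}, {p k, q k}, {q k, b k}}"
        by (intro gadget_alpha_pos) simp
      then show "e \<in> (\<Union>k<length ps. set (map ?f (gadget_pairs h ps k)))"
        unfolding m by blast
    qed
  qed
  finally show ?thesis using dist[of "length ps"] by (simp add: la_enum_def)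
qed

lemma arc_list_sub: "arc_list D (loops I) (hom_list I) v \<subseteq> hom_list I v"
  by (simp add: arc_list_def)

lemma la_list_range: assumes "v \<in> {1..N}" shows "la_list J v \<subseteq> {1..r}"
proof (cases "v \<le> n")
  case True
  then have "la_list J v \<subseteq> {1..h}" using la_list_J(1)[OF True] arc_list_sub[of v] hom_list_range[of v] assms
    by auto
  then show ?thesis by fastforce
next
  case False
  then show ?thesis using la_list_J(2)[of v] xlist_range by simp
qed

lemma la_valid_J: "la_valid J"
proof -
  have nN: "n \<le> N" by simp
  have "slot_edges n S \<subseteq> pairs N"
  proof
    fix e assume "e \<in> slot_edges n S"
    then obtain s where s: "s \<in> slots" "e = {src s, x s} \<or> e = {x s, y s} \<or> e = {y s, tgt s}"
      unfolding slot_edges_eq by blast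
    have "src s \<noteq> x s" "x s \<noteq> y s" "y s \<noteq> tgt s"
      using end_range[OF s(1)] x_range[OF s(1)] y_range[OF s(1)] x_ne_y[OF s(1) s(1)] by auto
    moreover have "{src s, x s, y s, tgt s} \<subseteq> {1..N}"
      using end_range[OF s(1)] x_range[OF s(1)] y_range[OF s(1)] nN
      by (auto intro: order_trans simp del: mult_Suc_right)
    ultimately show "e \<in> pairs N" using s(2) by (auto simp: pairs_def)
  qed
  then show ?thesis using la_list_range finite_slot_edges by (simp add: la_valid_def)
qed

text \<open>
  At most \<open>d\<close> slots are cut, so one of the \<open>d + 1\<close> forests has no cut arc, and it connects the ends of
  every dropped arc.
\<close>

lemma dropped_uncut:
  fixes \<phi> :: "nat \<Rightarrow> nat"
  assumes typed: "\<And>s. s \<in> slots \<Longrightarrow> \<phi> (src s) \<noteq> \<phi> (tgt s) \<Longrightarrow> \<exists>k<length ps. ps ! k = (\<phi> (src s), \<phi> (tgt s))"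
    and bound: "\<And>k. k < length ps \<Longrightarrow> card {s \<in> slots. (\<phi> (src s), \<phi> (tgt s)) = ps ! k} \<le> \<alpha> (ps ! k)"
    and uv: "(u, v) \<in> D"
  shows "\<phi> u = \<phi> v"
proof (rule ccontr)
  assume ne: "\<phi> u \<noteq> \<phi> v"
  let ?K = "{s \<in> slots. \<phi> (src s) \<noteq> \<phi> (tgt s)}"
  have finK: "finite ?K" using finite_slots by simp
  have "?K \<subseteq> (\<Union>k<length ps. {s \<in> slots. (\<phi> (src s), \<phi> (tgt s)) = ps ! k})"
    using typed by fastforce
  then have "card ?K \<le> card (\<Union>k<length ps. {s \<in> slots. (\<phi> (src s), \<phi> (tgt s)) = ps ! k})"
    by (intro card_mono) (use finite_slots in auto)
  also have "\<dots> \<le> (\<Sum>k<length ps. card {s \<in> slots. (\<phi> (src s), \<phi> (tgt s)) = ps ! k})"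
    by (rule card_UN_le) simp
  also have "\<dots> \<le> d" unfolding hom_d_eq by (rule sum_mono) (use bound in auto)
  finally have le: "card ?K \<le> d" .
  \<comment> \<open>If \<open>u\<close> and \<open>v\<close> were separated, each of the forests
    \<open>0, ..., d\<close> would contain a cut arc, since otherwise \<open>connected\<close> would
    identify them: at least \<open>d + 1\<close> cut slots against the bound
    \<open>d\<close>.\<close>
  have "{..d} \<subseteq> fst ` ?K"
  proof
    fix i assume "i \<in> {..d}"
    then have i: "i \<le> d" by simp
    have uvn: "u \<in> {1..n}" "v \<in> {1..n}" using uv F.dropped_arcs F.arc_ends by auto
    have "\<not> (\<forall>l u v. S i l = Some (u, v) \<longrightarrow> \<phi> u = \<phi> v)"
    proof
      assume "\<forall>l u v. S i l = Some (u, v) \<longrightarrow> \<phi> u = \<phi> v"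
      then have "\<phi> u = \<phi> v"
        using F.connected[OF i _ uvn F.dropped_label[OF uv i], of \<phi>] by blast
      with ne show False ..
    qed
    then obtain l u' v' where l: "S i l = Some (u', v')" "\<phi> u' \<noteq> \<phi> v'" by blast
    then have "(i, l) \<in> ?K" by (simp add: slots_def src_def tgt_def)
    then show "i \<in> fst ` ?K" by force
  qed
  then have "card {..d} \<le> card ?K" using surj_card_le[OF finK] by blast
  with le show False by simp
qed

text \<open>A dropped arc has the same image at both ends, so it cannot be sent to
  \<open>(e1, e2)\<close> with distinct entries; every other arc occupies exactly one slot.\<close>

lemma card_arcs_eq_slots:
  fixes \<phi> :: "nat \<Rightarrow> nat"
  assumes uncut: "\<And>u v. (u, v) \<in> D \<Longrightarrow> \<phi> u = \<phi> v" and "e1 \<noteq> e2"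
  shows "card {(u, v) \<in> parcs (hom_G I). \<phi> u = e1 \<and> \<phi> v = e2} =
    card {s \<in> slots. (\<phi> (src s), \<phi> (tgt s)) = (e1, e2)}"
proof -
  have "bij_betw (\<lambda>s. (src s, tgt s)) {s \<in> slots. (\<phi> (src s), \<phi> (tgt s)) = (e1, e2)}
      {(u, v) \<in> parcs (hom_G I). \<phi> u = e1 \<and> \<phi> v = e2}"
  proof (rule bij_betw_imageI)
    show "inj_on (\<lambda>s. (src s, tgt s)) {s \<in> slots. (\<phi> (src s), \<phi> (tgt s)) = (e1, e2)}"
    proof (rule inj_onI)
      fix s t assume "s \<in> {s \<in> slots. (\<phi> (src s), \<phi> (tgt s)) = (e1, e2)}"
        "t \<in> {s \<in> slots. (\<phi> (src s), \<phi> (tgt s)) = (e1, e2)}" "(src s, tgt s) = (src t, tgt t)"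
      then show "s = t" using F.slot_inj slotD by (metis (no_types, lifting) mem_Collect_eq prod.collapse)
    qed
    show "(\<lambda>s. (src s, tgt s)) ` {s \<in> slots. (\<phi> (src s), \<phi> (tgt s)) = (e1, e2)} =
        {(u, v) \<in> parcs (hom_G I). \<phi> u = e1 \<and> \<phi> v = e2}" (is "?L = ?R")
    proof
      show "?L \<subseteq> ?R" using arc_in by auto
      show "?R \<subseteq> ?L"
      proof clarify
        fix u v assume uv: "(u, v) \<in> parcs (hom_G I)" "e1 = \<phi> u" "e2 = \<phi> v"
        then have "(u, v) \<notin> D" using uncut assms(2) by blast
        then obtain i l where "S i l = Some (u, v)" using F.slot_or_dropped[OF uv(1)] by blast
        then have "(i, l) \<in> slots" "src (i, l) = u" "tgt (i, l) = v"
          by (auto simp: slots_def src_def tgt_def)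
        then show "(u, v) \<in> (\<lambda>s. (src s, tgt s)) ` {s \<in> slots. (\<phi> (src s), \<phi> (tgt s)) = (\<phi> u, \<phi> v)}"
          by force
      qed
    qed
  qed
  then show ?thesis by (simp add: bij_betw_same_card)
qed

text \<open>An edge between different parts needs a positive demand, hence is a gadget pair. Since
  vertices of \<open>G\<close> use parts up to \<open>h\<close>, \<open>x\<close> avoids all
  \<open>q k\<close> and \<open>y\<close> all \<open>p k\<close>, the position of an edge on its
  path nearly determines the pair; counting settles the middle edge.\<close>

lemma hom_solution_of_allocation:
  assumes sol: "la_solution J (\<lambda>i. {v \<in> {1..N}. \<phi> v = i})"
  shows "hom_solution I \<phi>"
proof -
  have listed: "\<phi> v \<in> la_list J v" "\<phi> v \<in> {1..r}" if "v \<in> {1..N}" for v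
    using sol that unfolding la_solution_iff by blast+
  have counted: "cnt \<phi> {i, j} = gadget_alpha h ps \<alpha> {i, j}" if "i \<in> {1..r}" "j \<in> {1..r}" "i \<noteq> j" for i j
    using sol that unfolding la_solution_iff by blast
  have nN: "n \<le> N" by simp
  have inN: "src s \<in> {1..N}" "tgt s \<in> {1..N}" "x s \<in> {1..N}" "y s \<in> {1..N}" if "s \<in> slots" for s
    using end_range[OF that] x_range[OF that] y_range[OF that] nN
    by (auto intro: order_trans simp del: mult_Suc_right)
  have old: "\<phi> v \<in> arc_list D (loops I) (hom_list I) v" "\<phi> v \<in> hom_list I v" "\<phi> v \<in> {1..h}"
    if "v \<in> {1..n}" for v
  proof -
    have "v \<in> {1..N}" using that nN by (auto intro: order_trans simp del: mult_Suc_right)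
    then show 1: "\<phi> v \<in> arc_list D (loops I) (hom_list I) v"
      using listed(1)[of v] la_list_J(1)[of v] that by simp
    then show 2: "\<phi> v \<in> hom_list I v" using arc_list_sub by blast
    then show "\<phi> v \<in> {1..h}" using hom_list_range[OF that] by blast
  qed
  have U: "\<phi> (src s) \<in> {1..h}" and W: "\<phi> (tgt s) \<in> {1..h}" if "s \<in> slots" for s
    using end_range[OF that] old(3) by blast+
  have X: "\<phi> (x s) \<in> loops I \<or> (\<exists>k<length ps. \<phi> (x s) = p k) \<or> \<phi> (x s) = r"
    and Y: "\<phi> (y s) \<in> loops I \<or> (\<exists>k<length ps. \<phi> (y s) = q k) \<or> \<phi> (y s) = r" if "s \<in> slots" for s
    using listed(1)[OF inN(3)[OF that]] listed(1)[OF inN(4)[OF that]] la_list_x[OF that] la_list_y[OF that]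
    by (auto simp: xlist_def ylist_def)
  have Xq: "\<phi> (x s) \<noteq> q k" and Yp: "\<phi> (y s) \<noteq> p k" if "s \<in> slots" "k < length ps" for s k
    using X[OF that(1)] Y[OF that(1)] p_q_range[OF that(2)] loops_range by auto
  have fin: "finite {s \<in> slots. P s}" for P using finite_slots by simp
  have member: "0 < card {t \<in> slots. P t}" if "s \<in> slots" "P s" for s P
    using that fin[of P] card_gt_0_iff by blast
  have pos: "\<exists>k<length ps. {i, j} \<in> {{a k, p k}, {p k, q k}, {q k, b k}}"
    if "cnt \<phi> {i, j} > 0" "i \<in> {1..r}" "j \<in> {1..r}" "i \<noteq> j" for i j
    by (rule gadget_alpha_pos) (use counted[OF that(2-4)] that(1) in simp)
  \<comment> \<open>Of the three pairs of gadget \<open>k\<close>, \<open>{p k, q k}\<close> has no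
    old part for \<open>src s\<close>, and \<open>{q k, b k}\<close> would put \<open>x s\<close>
    into \<open>q k\<close>.\<close>
  have UX: "\<exists>k<length ps. \<phi> (src s) = a k \<and> \<phi> (x s) = p k"
    if s: "s \<in> slots" and ne: "\<phi> (src s) \<noteq> \<phi> (x s)" for s
  proof -
    have "0 < card {t \<in> slots. {\<phi> (src t), \<phi> (x t)} = {\<phi> (src s), \<phi> (x s)}}"
      by (rule member[OF s]) simp
    then have "cnt \<phi> {\<phi> (src s), \<phi> (x s)} > 0" unfolding cnt_def by linarith
    then obtain k where k: "k < length ps"
      "{\<phi> (src s), \<phi> (x s)} \<in> {{a k, p k}, {p k, q k}, {q k, b k}}"
      using pos listed(2) inN[OF s] ne by blast
    then show "\<exists>k<length ps. \<phi> (src s) = a k \<and> \<phi> (x s) = p k"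
      using U[OF s] p_q_range[OF k(1)] ps_arc[OF k(1)] Xq[OF s k(1)] by (auto simp: doubleton_eq_iff)
  qed
  have YW: "\<exists>k<length ps. \<phi> (y s) = q k \<and> \<phi> (tgt s) = b k"
    if s: "s \<in> slots" and ne: "\<phi> (y s) \<noteq> \<phi> (tgt s)" for s
  proof -
    have "0 < card {t \<in> slots. {\<phi> (y t), \<phi> (tgt t)} = {\<phi> (y s), \<phi> (tgt s)}}"
      by (rule member[OF s]) simp
    then have "cnt \<phi> {\<phi> (y s), \<phi> (tgt s)} > 0" unfolding cnt_def by linarith
    then obtain k where k: "k < length ps"
      "{\<phi> (y s), \<phi> (tgt s)} \<in> {{a k, p k}, {p k, q k}, {q k, b k}}"
      using pos listed(2) inN[OF s] ne by blast
    then show "\<exists>k<length ps. \<phi> (y s) = q k \<and> \<phi> (tgt s) = b k"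
      using W[OF s] p_q_range[OF k(1)] ps_arc[OF k(1)] Yp[OF s k(1)] by (auto simp: doubleton_eq_iff)
  qed
  \<comment> \<open>Only a disjunction so far: \<open>x s\<close> in \<open>p k\<close> with
    \<open>y s\<close> in a looped \<open>a k\<close> does not contradict the sign of any demand and
    is excluded later, by \<open>gadget\<close>.\<close>
  have XY: "\<exists>k<length ps. \<phi> (x s) = p k \<or> \<phi> (y s) = q k"
    if s: "s \<in> slots" and ne: "\<phi> (x s) \<noteq> \<phi> (y s)" for s
  proof -
    have "0 < card {t \<in> slots. {\<phi> (x t), \<phi> (y t)} = {\<phi> (x s), \<phi> (y s)}}"
      by (rule member[OF s]) simp
    then have "cnt \<phi> {\<phi> (x s), \<phi> (y s)} > 0" unfolding cnt_def by linarith
    then obtain k where k: "k < length ps"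
      "{\<phi> (x s), \<phi> (y s)} \<in> {{a k, p k}, {p k, q k}, {q k, b k}}"
      using pos listed(2) inN[OF s] ne by blast
    then show "\<exists>k<length ps. \<phi> (x s) = p k \<or> \<phi> (y s) = q k"
      using Xq[OF s k(1)] Yp[OF s k(1)] by (auto simp: doubleton_eq_iff)
  qed
  \<comment> \<open>The pair \<open>p k, q k\<close> is joined by \<open>\<alpha>\<close> edges, one for each of the at most \<open>\<alpha>\<close> slots with \<open>x\<close> in
    \<open>p k\<close>, so all of these have \<open>y\<close> in \<open>q k\<close>; and conversely.\<close>
  have gadget: "{s \<in> slots. \<phi> (x s) = p k} = {s \<in> slots. \<phi> (y s) = q k} \<and>
      card {s \<in> slots. \<phi> (x s) = p k} = \<alpha> (ps ! k)" if k: "k < length ps" for k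
  proof -
    let ?X = "{s \<in> slots. \<phi> (x s) = p k}" and ?Y = "{s \<in> slots. \<phi> (y s) = q k}"
    let ?PQ = "{s \<in> slots. {\<phi> (x s), \<phi> (y s)} = {p k, q k}}"
    have hk: "h < p k" "h < q k" "p k \<in> {1..r}" "q k \<in> {1..r}" "a k \<in> {1..r}" "b k \<in> {1..r}"
      "a k \<noteq> p k" "q k \<noteq> b k"
      using p_q_range[OF k] ps_arc[OF k] by auto
    \<comment> \<open>Each outer edge of a path has an end in a part at most \<open>h\<close>, so
      only middle edges can join \<open>p k\<close> to \<open>q k\<close>.\<close>
    have empty: "{s \<in> slots. {\<phi> (src s), \<phi> (x s)} = {p k, q k}} = {}"
      "{s \<in> slots. {\<phi> (y s), \<phi> (tgt s)} = {p k, q k}} = {}"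
      using U W hk by (force simp: doubleton_eq_iff)+
    have "card ?PQ = cnt \<phi> {p k, q k}" unfolding cnt_def empty by simp
    also have "\<dots> = \<alpha> (ps ! k)" using counted[of "p k" "q k"] hk gadget_alpha_eq[OF k] by simp
    finally have PQ: "card ?PQ = \<alpha> (ps ! k)" .
    have "?X \<subseteq> {s \<in> slots. {\<phi> (src s), \<phi> (x s)} = {a k, p k}}"
    proof
      fix s assume s: "s \<in> ?X"
      then have "\<phi> (src s) \<noteq> \<phi> (x s)" using U[of s] hk by auto
      then have "\<phi> (src s) = a k" using UX[of s] s by auto
      then show "s \<in> {s \<in> slots. {\<phi> (src s), \<phi> (x s)} = {a k, p k}}" using s by simp
    qed
    then have "card ?X \<le> card {s \<in> slots. {\<phi> (src s), \<phi> (x s)} = {a k, p k}}"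
      by (rule card_mono[OF fin])
    also have "\<dots> \<le> cnt \<phi> {a k, p k}" unfolding cnt_def by simp
    also have "\<dots> = \<alpha> (ps ! k)" using counted[of "a k" "p k"] hk gadget_alpha_eq[OF k] by simp
    finally have cX: "card ?X \<le> card ?PQ" using PQ by simp
    have "?Y \<subseteq> {s \<in> slots. {\<phi> (y s), \<phi> (tgt s)} = {q k, b k}}"
    proof
      fix s assume s: "s \<in> ?Y"
      then have "\<phi> (y s) \<noteq> \<phi> (tgt s)" using W[of s] hk by auto
      then have "\<phi> (tgt s) = b k" using YW[of s] s by auto
      then show "s \<in> {s \<in> slots. {\<phi> (y s), \<phi> (tgt s)} = {q k, b k}}" using s by simp
    qed
    then have "card ?Y \<le> card {s \<in> slots. {\<phi> (y s), \<phi> (tgt s)} = {q k, b k}}"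
      by (rule card_mono[OF fin])
    also have "\<dots> \<le> cnt \<phi> {q k, b k}" unfolding cnt_def by simp
    also have "\<dots> = \<alpha> (ps ! k)" using counted[of "q k" "b k"] hk gadget_alpha_eq[OF k] by simp
    finally have cY: "card ?Y \<le> card ?PQ" using PQ by simp
    have "?PQ \<subseteq> ?X" "?PQ \<subseteq> ?Y" using Xq[OF _ k] by (auto simp: doubleton_eq_iff)
    then have "?PQ = ?X" "?PQ = ?Y" using card_seteq[OF fin _ cX] card_seteq[OF fin _ cY] by auto
    then show ?thesis using PQ by simp
  qed
  have pq: "\<phi> (x s) = p k \<longleftrightarrow> \<phi> (y s) = q k" if "k < length ps" "s \<in> slots" for k s
    using gadget[OF that(1)] that(2) by blast
  have p_type: "ps ! k = (\<phi> (src s), \<phi> (tgt s))" if k: "k < length ps" "s \<in> slots" "\<phi> (x s) = p k" for k s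
  proof -
    have "\<phi> (y s) = q k" using pq that by blast
    then have "\<phi> (src s) \<noteq> \<phi> (x s)" "\<phi> (y s) \<noteq> \<phi> (tgt s)"
      using U[of s] W[of s] p_q_range[OF k(1)] that by auto
    then have "\<phi> (src s) = a k" "\<phi> (tgt s) = b k" using UX[of s] YW[of s] that \<open>\<phi> (y s) = q k\<close> by auto
    then show ?thesis by simp
  qed
  have uncut: "\<phi> (src s) = \<phi> (tgt s) \<and> \<phi> (src s) \<in> loops I"
    if s: "s \<in> slots" and np: "\<not> (\<exists>k<length ps. \<phi> (x s) = p k)" for s
  proof -
    have nq: "\<not> (\<exists>k<length ps. \<phi> (y s) = q k)" using np pq[OF _ s] by blast
    have ux: "\<phi> (src s) = \<phi> (x s)" using UX[OF s] np by blast
    have xy: "\<phi> (x s) = \<phi> (y s)" using XY[OF s] np nq by blast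
    have yw: "\<phi> (y s) = \<phi> (tgt s)" using YW[OF s] nq by blast
    \<comment> \<open>The choice \<open>r\<close> is ruled out because \<open>x s\<close> shares its
      part with \<open>src s\<close>, which is at most \<open>h\<close>, whereas \<open>r\<close> is
      larger.\<close>
    have "\<phi> (x s) \<in> loops I" using X[OF s] np U[OF s] ux by auto
    then show ?thesis using ux xy yw by simp
  qed
  have typed: "\<exists>k<length ps. ps ! k = (\<phi> (src s), \<phi> (tgt s)) \<and> \<phi> (x s) = p k"
    if "s \<in> slots" "\<phi> (src s) \<noteq> \<phi> (tgt s)" for s
    using p_type uncut that by blast
  have type_set: "{s \<in> slots. (\<phi> (src s), \<phi> (tgt s)) = ps ! k} = {s \<in> slots. \<phi> (x s) = p k}"
    if k: "k < length ps" for k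
  proof (intro Collect_cong conj_cong refl iffI)
    fix s assume s: "s \<in> slots" "(\<phi> (src s), \<phi> (tgt s)) = ps ! k"
    then have "\<phi> (src s) \<noteq> \<phi> (tgt s)" using ps_arc(2)[OF k] by (metis fst_conv snd_conv)
    then show "\<phi> (x s) = p k" using typed[OF s(1)] ps_inj[OF k] s(2) by metis
  next
    fix s assume "s \<in> slots" "\<phi> (x s) = p k"
    then show "(\<phi> (src s), \<phi> (tgt s)) = ps ! k" using p_type[OF k] by simp
  qed
  have dropped: "\<phi> u = \<phi> v" if "(u, v) \<in> D" for u v
  proof (rule dropped_uncut[OF _ _ that])
    show "\<exists>k<length ps. ps ! k = (\<phi> (src s), \<phi> (tgt s))" if "s \<in> slots" "\<phi> (src s) \<noteq> \<phi> (tgt s)" for s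
      using typed that by blast
    show "card {s \<in> slots. (\<phi> (src s), \<phi> (tgt s)) = ps ! k} \<le> \<alpha> (ps ! k)" if "k < length ps" for k
      using gadget[OF that, THEN conjunct2] unfolding type_set[OF that] by simp
  qed
  have verts: "pverts (hom_G I) = {1..n}" using valid by (simp add: hom_valid_def)
  show ?thesis
    unfolding hom_solution_def
  proof (intro conjI ballI)
    show "\<phi> v \<in> hom_list I v" if "v \<in> pverts (hom_G I)" for v using old(2) that verts by blast
  next
    fix e assume e: "e \<in> parcs (hom_G I)"
    show "case e of (u, v) \<Rightarrow> (\<phi> u, \<phi> v) \<in> parcs (hom_H I)"
    proof (cases e)
      case (Pair u v)
      have "(\<phi> u, \<phi> v) \<in> parcs (hom_H I)"
      proof (cases "(u, v) \<in> D")
        case True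
        then have "u \<in> {1..n}" "u \<in> Field D" using F.dropped_arcs F.arc_ends by (auto simp: Field_def)
        then have "\<phi> u \<in> loops I" using old(1)[of u] by (simp add: arc_list_def)
        then show ?thesis using dropped[OF True] by (simp add: loops_def)
      next
        case False
        then obtain i l where "S i l = Some (u, v)" using F.slot_or_dropped e Pair by blast
        then have s: "(i, l) \<in> slots" "src (i, l) = u" "tgt (i, l) = v"
          by (auto simp: slots_def src_def tgt_def)
        show ?thesis
        proof (cases "\<exists>k<length ps. \<phi> (x (i, l)) = p k")
          case True
          then obtain k where k: "k < length ps" "\<phi> (x (i, l)) = p k" by blast
          then show ?thesis using p_type[OF k(1) s(1) k(2)] ps_arc(1)[OF k(1)] s by simp
        next
          case False
          then show ?thesis using uncut[OF s(1)] s by (auto simp: loops_def)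
        qed
      qed
      then show ?thesis using Pair by simp
    qed
  next
    fix e assume e: "e \<in> nonloop_arcs (hom_H I)"
    obtain e1 e2 where e12: "e = (e1, e2)" "e1 \<noteq> e2" "(e1, e2) \<in> parcs (hom_H I)"
      using e by (auto simp: nonloop_arcs_def)
    have "card {s \<in> slots. (\<phi> (src s), \<phi> (tgt s)) = (e1, e2)} = \<alpha> (e1, e2)"
    proof (cases "\<alpha> (e1, e2) = 0")
      case False
      then obtain k where k: "k < length ps" "ps ! k = (e1, e2)" using in_ps e12 by blast
      then show ?thesis using gadget[OF k(1), THEN conjunct2] unfolding type_set[OF k(1), unfolded k(2)] by simp
    next
      \<comment> \<open>An arc of demand 0 is missing from \<open>ps\<close>, whereas every cut slot
        has its type in \<open>ps\<close>.\<close>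
      case True
      have none: False if s: "s \<in> slots" "(\<phi> (src s), \<phi> (tgt s)) = (e1, e2)" for s
      proof -
        have "\<phi> (src s) \<noteq> \<phi> (tgt s)" using s(2) e12(2) by simp
        then obtain k where "k < length ps" "ps ! k = (e1, e2)" using typed[OF s(1)] s(2) by auto
        then show False using ps_arc(5)[of k] True by simp
      qed
      then have empty: "{s \<in> slots. (\<phi> (src s), \<phi> (tgt s)) = (e1, e2)} = {}" by blast
      show ?thesis unfolding empty using True by simp
    qed
    then show "case e of (c, c') \<Rightarrow> card {(u, v) \<in> parcs (hom_G I). \<phi> u = c \<and> \<phi> v = c'} = \<alpha> (c, c')"
      using card_arcs_eq_slots[OF dropped e12(2)] e12(1) by simp
  qed
qed

text \<open>The inner vertices of an uncut slot join the common image of its ends, which is looped;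
  those of a cut slot go to the gadget of its type; vertices of empty slots go to
  \<open>r\<close>.\<close>

lemma allocation_of_hom_solution:
  assumes sol: "hom_solution I \<chi>"
  shows "\<exists>V. la_solution J V"
proof -
  have verts: "pverts (hom_G I) = {1..n}" using valid by (simp add: hom_valid_def)
  have listed: "\<chi> v \<in> hom_list I v" if "v \<in> {1..n}" for v
    using sol that verts by (auto simp: hom_solution_def)
  have arcs: "(\<chi> u, \<chi> v) \<in> parcs (hom_H I)" if "(u, v) \<in> parcs (hom_G I)" for u v
    using sol that by (auto simp: hom_solution_def)
  have counted: "card {(u, v) \<in> parcs (hom_G I). \<chi> u = e1 \<and> \<chi> v = e2} = \<alpha> (e1, e2)"
    if "(e1, e2) \<in> parcs (hom_H I)" "e1 \<noteq> e2" for e1 e2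
    using sol that by (auto simp: hom_solution_def nonloop_arcs_def)
  have "pair_digraph (hom_G I)" using valid by (simp add: hom_valid_def)
  then have "pair_fin_digraph (hom_G I)" by (simp add: pair_digraph_def)
  then have finG: "finite (parcs (hom_G I))" by (rule pair_fin_digraph.pair_finite_arcs)
  have typed: "\<exists>k<length ps. ps ! k = (\<chi> u, \<chi> v)" if "(u, v) \<in> parcs (hom_G I)" "\<chi> u \<noteq> \<chi> v" for u v
  proof (rule in_ps[OF arcs[OF that(1)] that(2)])
    have "(u, v) \<in> {(u', v') \<in> parcs (hom_G I). \<chi> u' = \<chi> u \<and> \<chi> v' = \<chi> v}" using that by simp
    moreover have "finite {(u', v') \<in> parcs (hom_G I). \<chi> u' = \<chi> u \<and> \<chi> v' = \<chi> v}"
      by (rule finite_subset[OF _ finG]) auto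
    ultimately have "card {(u', v') \<in> parcs (hom_G I). \<chi> u' = \<chi> u \<and> \<chi> v' = \<chi> v} > 0"
      by (auto simp: card_gt_0_iff)
    then show "0 < \<alpha> (\<chi> u, \<chi> v)" using counted[OF arcs[OF that(1)] that(2)] by simp
  qed
  have dropped: "\<chi> u = \<chi> v" if "(u, v) \<in> D" for u v
  proof (rule dropped_uncut[OF _ _ that])
    show "\<exists>k<length ps. ps ! k = (\<chi> (src s), \<chi> (tgt s))" if "s \<in> slots" "\<chi> (src s) \<noteq> \<chi> (tgt s)" for s
      using typed arc_in that by blast
    show "card {s \<in> slots. (\<chi> (src s), \<chi> (tgt s)) = ps ! k} \<le> \<alpha> (ps ! k)" if k: "k < length ps" for k
    proof -
      \<comment> \<open>Only an inequality at this point: that all arcs of this type sit in slots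
        follows once \<open>dropped\<close> is known, and \<open>type_card\<close> records the
        resulting equality.\<close>
      have "card {s \<in> slots. (\<chi> (src s), \<chi> (tgt s)) = ps ! k} \<le>
          card {(u, v) \<in> parcs (hom_G I). \<chi> u = a k \<and> \<chi> v = b k}"
      proof (rule card_inj_on_le[where f = "\<lambda>s. (src s, tgt s)"])
        show "inj_on (\<lambda>s. (src s, tgt s)) {s \<in> slots. (\<chi> (src s), \<chi> (tgt s)) = ps ! k}"
          by (rule inj_onI) (metis (no_types, lifting) F.slot_inj slotD mem_Collect_eq prod.collapse)
        show "(\<lambda>s. (src s, tgt s)) ` {s \<in> slots. (\<chi> (src s), \<chi> (tgt s)) = ps ! k}
            \<subseteq> {(u, v) \<in> parcs (hom_G I). \<chi> u = a k \<and> \<chi> v = b k}"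
          using arc_in by (auto simp: prod_eq_iff)
        show "finite {(u, v) \<in> parcs (hom_G I). \<chi> u = a k \<and> \<chi> v = b k}"
          by (rule finite_subset[OF _ finG]) auto
      qed
      then show ?thesis using counted[OF ps_arc(1,2)[OF k]] by simp
    qed
  qed
  have type_card: "card {s \<in> slots. (\<chi> (src s), \<chi> (tgt s)) = ps ! k} = \<alpha> (ps ! k)" if k: "k < length ps" for k
    using card_arcs_eq_slots[OF dropped ps_arc(2)[OF k]] counted[OF ps_arc(1,2)[OF k]] by simp
  define idx where "idx e = (SOME k. k < length ps \<and> ps ! k = e)" for e
  have idx: "idx (ps ! k) = k" if "k < length ps" for k
    unfolding idx_def by (rule some_equality) (use that ps_inj in auto)
  define \<phi> where "\<phi> v = (if v \<le> n then \<chi> v else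
     let s = slot_of n v in
     if s \<notin> slots then r
     else if \<chi> (src s) = \<chi> (tgt s) then \<chi> (src s)
     else if odd (block n v) then p (idx (\<chi> (src s), \<chi> (tgt s)))
     else q (idx (\<chi> (src s), \<chi> (tgt s))))" for v
  have U: "\<phi> (src s) = \<chi> (src s)" "\<phi> (tgt s) = \<chi> (tgt s)" if "s \<in> slots" for s
    using end_range[OF that] by (auto simp: \<phi>_def)
  have X: "\<phi> (x s) = (if \<chi> (src s) = \<chi> (tgt s) then \<chi> (src s) else p (idx (\<chi> (src s), \<chi> (tgt s))))"
    and Y: "\<phi> (y s) = (if \<chi> (src s) = \<chi> (tgt s) then \<chi> (src s) else q (idx (\<chi> (src s), \<chi> (tgt s))))"
    if "s \<in> slots" for s
    using x_range[OF that] y_range[OF that] that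
    by (auto simp: \<phi>_def Let_def slot_of_x slot_of_y block_x block_y)
  have loop: "\<chi> (src s) \<in> loops I" if "s \<in> slots" "\<chi> (src s) = \<chi> (tgt s)" for s
    using arcs[OF arc_in[OF that(1)]] that(2) by (simp add: loops_def)
  have cut: "\<exists>k<length ps. ps ! k = (\<chi> (src s), \<chi> (tgt s)) \<and> idx (\<chi> (src s), \<chi> (tgt s)) = k"
    if "s \<in> slots" "\<chi> (src s) \<noteq> \<chi> (tgt s)" for s
    using typed[OF arc_in[OF that(1)] that(2)] idx by metis
  have lists: "\<phi> v \<in> la_list J v" if "v \<in> {1..N}" for v
  proof (cases "v \<le> n")
    case True
    have "\<chi> v \<in> loops I" if vD: "v \<in> Field D"
    proof -
      obtain u where u: "(u, v) \<in> D \<or> (v, u) \<in> D" using vD by (auto simp: Field_def)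
      then show ?thesis using dropped arcs F.dropped_arcs unfolding loops_def
        by (metis (no_types, lifting) mem_Collect_eq subsetD)
    qed
    then show ?thesis using True that la_list_J(1)[OF True] listed[of v]
      by (simp add: \<phi>_def arc_list_def)
  next
    case False
    let ?s = "slot_of n v"
    have l: "la_list J v = insert r (if odd (block n v) then xlist h (loops I) (length ps)
            else ylist h (loops I) (length ps))" using False by (simp add: la_list_J)
    consider "?s \<notin> slots" | "?s \<in> slots" "\<chi> (src ?s) = \<chi> (tgt ?s)" | "?s \<in> slots" "\<chi> (src ?s) \<noteq> \<chi> (tgt ?s)"
      by blast
    then show ?thesis
    proof cases
      case 1
      then show ?thesis using False l by (simp add: \<phi>_def Let_def)
    next
      case 2
      then show ?thesis using False l loop[OF 2] by (simp add: \<phi>_def Let_def xlist_def ylist_def)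
    next
      case 3
      then show ?thesis using False l cut[OF 3] by (auto simp: \<phi>_def Let_def xlist_def ylist_def)
    qed
  qed
  have counts: "cnt \<phi> {i, j} = gadget_alpha h ps \<alpha> {i, j}" if ij: "i \<noteq> j" for i j
  proof -
    let ?T = "\<lambda>k. {s \<in> slots. (\<chi> (src s), \<chi> (tgt s)) = ps ! k}"
    \<comment> \<open>One count for all three edges of a path: \<open>g s\<close> is the image of
      the edge and \<open>f k\<close> the pair of gadget \<open>k\<close> at that position. Uncut
      slots give singletons, never \<open>{i, j}\<close>.\<close>
    have split: "card {s \<in> slots. g s = {i, j}} =
        (\<Sum>k<length ps. if {i, j} = f k then \<alpha> (ps ! k) else 0)"
      if g1: "\<And>s. s \<in> slots \<Longrightarrow> \<chi> (src s) = \<chi> (tgt s) \<Longrightarrow> g s = {\<chi> (src s)}"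
        and g2: "\<And>s k. s \<in> slots \<Longrightarrow> k < length ps \<Longrightarrow> ps ! k = (\<chi> (src s), \<chi> (tgt s)) \<Longrightarrow> g s = f k"
      for g :: "nat \<times> nat \<Rightarrow> nat set" and f
    proof -
      have "{s \<in> slots. g s = {i, j}} = (\<Union>k\<in>{k. k < length ps \<and> {i, j} = f k}. ?T k)"
      proof (rule set_eqI)
        fix s
        show "s \<in> {s \<in> slots. g s = {i, j}} \<longleftrightarrow> s \<in> (\<Union>k\<in>{k. k < length ps \<and> {i, j} = f k}. ?T k)"
        proof
          assume s: "s \<in> {s \<in> slots. g s = {i, j}}"
          then have "\<chi> (src s) \<noteq> \<chi> (tgt s)" using g1[of s] ij by (auto simp: doubleton_eq_iff)
          then obtain k where "k < length ps" "ps ! k = (\<chi> (src s), \<chi> (tgt s))" using cut[of s] s by auto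
          then show "s \<in> (\<Union>k\<in>{k. k < length ps \<and> {i, j} = f k}. ?T k)" using g2[of s k] s by auto
        next
          assume "s \<in> (\<Union>k\<in>{k. k < length ps \<and> {i, j} = f k}. ?T k)"
          then obtain k where "k < length ps" "{i, j} = f k" "s \<in> slots" "(\<chi> (src s), \<chi> (tgt s)) = ps ! k"
            by blast
          then show "s \<in> {s \<in> slots. g s = {i, j}}" using g2[of s k] by simp
        qed
      qed
      then have "card {s \<in> slots. g s = {i, j}} = (\<Sum>k\<in>{k. k < length ps \<and> {i, j} = f k}. card (?T k))"
        by (simp only:) (rule card_UN_disjoint; use finite_slots ps_inj in auto)
      also have "\<dots> = (\<Sum>k\<in>{k. k < length ps \<and> {i, j} = f k}. \<alpha> (ps ! k))"
        by (rule sum.cong) (use type_card in auto)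
      also have "\<dots> = (\<Sum>k<length ps. if {i, j} = f k then \<alpha> (ps ! k) else 0)"
        by (subst sum.inter_filter[symmetric]) (auto intro!: sum.cong)
      finally show ?thesis .
    qed
    have type: "\<chi> (src s) = a k" "\<chi> (tgt s) = b k" "a k \<noteq> b k" "idx (a k, b k) = k"
      if "k < length ps" "ps ! k = (\<chi> (src s), \<chi> (tgt s))" for s k
      using that ps_arc(2)[of k] idx[of k] by auto
    have 1: "card {s \<in> slots. {\<phi> (src s), \<phi> (x s)} = {i, j}} =
        (\<Sum>k<length ps. if {i, j} = {a k, p k} then \<alpha> (ps ! k) else 0)"
      by (rule split) (use U X type in auto)
    have 2: "card {s \<in> slots. {\<phi> (x s), \<phi> (y s)} = {i, j}} =
        (\<Sum>k<length ps. if {i, j} = {p k, q k} then \<alpha> (ps ! k) else 0)"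
      by (rule split) (use X Y type in auto)
    have 3: "card {s \<in> slots. {\<phi> (y s), \<phi> (tgt s)} = {i, j}} =
        (\<Sum>k<length ps. if {i, j} = {q k, b k} then \<alpha> (ps ! k) else 0)"
      by (rule split) (use U Y type in auto)
    show ?thesis unfolding cnt_def 1 2 3 gadget_alpha_sum3 by (simp add: sum.distrib)
  qed
  have "la_solution J (\<lambda>i. {v \<in> {1..N}. \<phi> v = i})"
    unfolding la_solution_iff using lists counts la_list_range by blast
  then show ?thesis by blast
qed

end

section \<open>Computing the instance\<close>

abbreviation seq (infixr ";;" 60) where "c ;; c' \<equiv> Seq c c'"
abbreviation var where "var x \<equiv> NCell x (NConst 0) (NConst 0)"
abbreviation assign where "assign x e \<equiv> NAssign x (NConst 0) (NConst 0) e"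
abbreviation svar where "svar x \<equiv> SCell x (NConst 0) (NConst 0)"
abbreviation sassign where "sassign x A \<equiv> SAssign x (NConst 0) (NConst 0) A"
abbreviation inc where "inc x \<equiv> assign x (NPlus (var x) (NConst 1))"
abbreviation equal where "equal e e' \<equiv> BAnd (BNot (BLess e e')) (BNot (BLess e' e))"

definition cell :: "(nat \<Rightarrow> nat \<Rightarrow> 'v) \<Rightarrow> nat \<Rightarrow> nat \<Rightarrow> 'v \<Rightarrow> nat \<Rightarrow> nat \<Rightarrow> 'v" where
  "cell f i j v = f(i := (f i)(j := v))"

lemma cell_apply: "cell f i j v i' j' = (if i' = i \<and> j' = j then v else f i' j')"
  by (simp add: cell_def)

lemma upd_apply [simp]: "upd m x i j v y = (if y = x then cell (m x) i j v else m y)"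
  by (simp add: upd_def cell_def)

lemma cell_same [simp]: "cell f i j v i j = v" by (simp add: cell_apply)

lemma cell_scalar [simp]: "cell (scalar a) 0 0 v = scalar v" "cell (\<lambda>_ _. 0) 0 0 v = scalar v"
  by (auto simp: cell_def scalar_def fun_eq_iff)

lemma scalar_00 [simp]: "scalar a 0 0 = a" by (simp add: scalar_def)

lemma scalar_0: "scalar 0 = (\<lambda>_ _. 0)" by (simp add: scalar_def fun_eq_iff)

lemma triples_Nil [simp]: "triples [] a = (\<lambda>_ _. 0)" by (simp add: triples_def fun_eq_iff)

lemma triples_snoc:
  "k = length xs \<Longrightarrow> v = a i j \<Longrightarrow>
     cell (cell (cell (triples xs a) k 0 i) k (Suc 0) j) k 2 v = triples (xs @ [(i, j)]) a"
  by (auto simp: triples_def cell_def fun_eq_iff nth_append)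

section \<open>Writing the demands and the lists of the inner vertices\<close>

definition push :: "nexp \<Rightarrow> nexp \<Rightarrow> nexp \<Rightarrow> com" where
  "push i j e =
     NAssign ''Palpha'' (var ''Plen'') (NConst 0) i ;;
     NAssign ''Palpha'' (var ''Plen'') (NConst 1) j ;;
     NAssign ''Palpha'' (var ''Plen'') (NConst 2) e ;;
     inc ''Plen''"

definition alpha_body :: com where
  "alpha_body =
     (let col = (\<lambda>m. NCell ''alpha'' (var ''k'') (NConst m));
          p = NPlus (var ''Pr'') (NConst 1); q = NPlus (var ''Pr'') (NConst 2) in
      push (col 0) p (col 2) ;; push p q (col 2) ;; push q (col 1) (col 2) ;;
      sassign ''X'' (SUnion (svar ''X'') (SSingle p)) ;;
      sassign ''Y'' (SUnion (svar ''Y'') (SSingle q)) ;;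
      assign ''Pr'' q ;;
      assign ''D'' (NPlus (var ''D'') (col 2)) ;;
      inc ''k'')"

text \<open>\<open>D\<close> starts at 1 because \<open>d + 1\<close> forests are needed.
  \<open>Pr\<close> is \<open>h + 2 * k\<close> at the start of pass \<open>k\<close>, and its last
  increment creates the part \<open>r\<close>.\<close>

definition alpha_phase :: com where
  "alpha_phase =
     (assign ''Pr'' (var ''h'') ;; assign ''D'' (NConst 1) ;; assign ''k'' (NConst 0) ;;
      sassign ''X'' (svar ''loops'') ;; sassign ''Y'' (svar ''loops'')) ;;
     While (BLess (var ''k'') (var ''len'')) alpha_body ;;
     (inc ''Pr'' ;;
      sassign ''X'' (SUnion (svar ''X'') (SSingle (var ''Pr''))) ;;
      sassign ''Y'' (SUnion (svar ''Y'') (SSingle (var ''Pr''))))"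

lemma triples_nth:
  "k < length ps \<Longrightarrow> triples ps a k 0 = fst (ps ! k)"
  "k < length ps \<Longrightarrow> triples ps a k (Suc 0) = snd (ps ! k)"
  "k < length ps \<Longrightarrow> triples ps a k 2 = a (fst (ps ! k)) (snd (ps ! k))"
  by (auto simp: triples_def split: prod.splits)

lemma gadget_enum_Suc: "gadget_enum h ps (Suc k) = ((gadget_enum h ps k @
    [(fst (ps ! k), ppart h k)]) @ [(ppart h k, qpart h k)]) @ [(qpart h k, snd (ps ! k))]"
  by (simp add: gadget_enum_def gadget_pairs_def)

text \<open>The output arrays are described as a whole, because the final store has to coincide with
  \<open>la_store\<close> everywhere. \<open>A\<close> is prescribed on the gadget pairs only, so
  that \<open>gadget_alpha\<close> can be substituted for it. A pass costs 12 steps for three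
  pushes, 5 further assignments and a test.\<close>

lemma halts_alpha_phase:
  assumes s: "num s ''h'' 0 0 = h" "num s ''len'' 0 0 = length ps"
      "num s ''alpha'' = triples ps (\<lambda>i j. \<alpha> (i, j))" "lst s ''loops'' 0 0 = L"
      "num s ''Palpha'' = (\<lambda>_ _. 0)" "num s ''Plen'' = (\<lambda>_ _. 0)" "num s ''Pr'' = (\<lambda>_ _. 0)"
    and A: "\<And>k i j. k < length ps \<Longrightarrow> (i, j) \<in> set (gadget_pairs h ps k) \<Longrightarrow> A i j = \<alpha> (ps ! k)"
  shows "halts alpha_phase s (length ps * 18 + 9) (\<lambda>s'.
     num s' ''Palpha'' = triples (gadget_enum h ps (length ps)) A \<and>
     num s' ''Plen'' = scalar (length (gadget_enum h ps (length ps))) \<and>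
     num s' ''Pr'' = scalar (h + 2 * length ps + 1) \<and>
     num s' ''D'' 0 0 = Suc (\<Sum>k<length ps. \<alpha> (ps ! k)) \<and>
     lst s' ''X'' 0 0 = insert (h + 2 * length ps + 1) (xlist h L (length ps)) \<and>
     lst s' ''Y'' 0 0 = insert (h + 2 * length ps + 1) (ylist h L (length ps)))"
    (is "halts _ _ _ ?R")
proof -
  define Inv where "Inv k s' \<longleftrightarrow>
     num s' ''k'' 0 0 = k \<and>
     num s' ''Palpha'' = triples (gadget_enum h ps k) A \<and>
     num s' ''Plen'' = scalar (length (gadget_enum h ps k)) \<and>
     num s' ''Pr'' = scalar (h + 2 * k) \<and>
     num s' ''D'' 0 0 = Suc (\<Sum>j<k. \<alpha> (ps ! j)) \<and>
     lst s' ''X'' 0 0 = xlist h L k \<and> lst s' ''Y'' 0 0 = ylist h L k" for k and s' :: store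
  define pre where "pre = assign ''Pr'' (var ''h'') ;; assign ''D'' (NConst 1) ;; assign ''k'' (NConst 0) ;;
      sassign ''X'' (svar ''loops'') ;; sassign ''Y'' (svar ''loops'')"
  have loop: "halts (While (BLess (var ''k'') (var ''len'')) alpha_body) (run pre s)
      (length ps * Suc 17 + 1) (Inv (length ps))"
  proof (rule halts_while)
    show "Inv 0 (run pre s)"
      using s by (simp add: Inv_def pre_def gadget_enum_def xlist_def ylist_def scalar_0)
  next
    fix k and s' :: store
    assume k: "k < length ps" and inv: "Inv k s'"
      and fr: "\<And>x. x \<notin> nwrites alpha_body \<Longrightarrow> num s' x = num (run pre s) x"
    have s': "num s' ''len'' 0 0 = length ps" "num s' ''alpha'' = triples ps (\<lambda>i j. \<alpha> (i, j))"
      using fr[of "''len''"] fr[of "''alpha''"] s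
      by (simp_all add: alpha_body_def push_def Let_def pre_def)
    have A': "A (fst (ps ! k)) (ppart h k) = \<alpha> (ps ! k)" "A (ppart h k) (qpart h k) = \<alpha> (ps ! k)"
      "A (qpart h k) (snd (ps ! k)) = \<alpha> (ps ! k)"
      using A[OF k] by (simp_all add: gadget_pairs_def)
    have "Inv (Suc k) (run alpha_body s')"
      using inv s' k A' unfolding Inv_def gadget_enum_Suc
      by (simp add: alpha_body_def push_def Let_def triples_nth triples_snoc xlist_def ylist_def
          lessThan_Suc ppart_def qpart_def)
    then show "bval (BLess (var ''k'') (var ''len'')) s' \<and> halts alpha_body s' 17 (Inv (Suc k))"
      using inv s' k by (auto intro!: halts_run simp: Inv_def alpha_body_def push_def Let_def)
  next
    fix s'
    assume "Inv (length ps) s'" and fr: "\<And>x. x \<notin> nwrites alpha_body \<Longrightarrow> num s' x = num (run pre s) x"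
    then show "\<not> bval (BLess (var ''k'') (var ''len'')) s'"
      using fr[of "''len''"] s by (simp add: Inv_def alpha_body_def push_def Let_def pre_def)
  qed
  show ?thesis
    unfolding alpha_phase_def pre_def[symmetric]
    by (rule halts_mono[OF halts_prefix[OF _ halts_suffix[OF loop, where R = ?R]]])
      (auto simp: pre_def Inv_def)
qed

section \<open>Initial labels and the lists of the inner vertices\<close>

definition list_array :: "nat \<Rightarrow> (nat \<Rightarrow> nat set) \<Rightarrow> nat set \<Rightarrow> nat set \<Rightarrow> (nat \<times> nat) set \<Rightarrow> nat \<Rightarrow> nat \<Rightarrow> nat set" where
  "list_array n lam XL YL Z v j =
     (if j \<noteq> 0 then {} else if v \<in> {1..n} then lam v
      else if v \<in> (\<lambda>(i, l). xid n i l) ` Z then XL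
      else if v \<in> (\<lambda>(i, l). yid n i l) ` Z then YL else {})"

lemma xid_ne_yid:
  assumes "l \<in> {1..n}" "l' \<in> {1..n}" shows "xid n i l \<noteq> yid n i' l'"
proof
  assume "xid n i l = yid n i' l'"
  then have "2 * i + 1 = 2 * i' + 2" using block_xid[OF assms(1), of i] block_yid[OF assms(2), of i'] by simp
  then show False by presburger
qed

lemma list_array_empty:
  "list_array n lam XL YL {} = (\<lambda>v j. if v \<in> {1..n} \<and> j = 0 then lam v else {})"
  by (auto simp: list_array_def fun_eq_iff)

lemma list_array_insert:
  assumes l: "l \<in> {1..n}" and Z: "Z \<subseteq> UNIV \<times> {1..n}"
  shows "cell (cell (list_array n lam XL YL Z) (xid n i l) 0 XL) (yid n i l) 0 YL =
    list_array n lam XL YL (insert (i, l) Z)"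
proof (intro ext)
  fix v j
  have "xid n i l \<notin> {1..n}" "yid n i l \<notin> {1..n}" using xid_bounds[OF l, of i i] yid_bounds[OF l, of i i] by auto
  moreover have "xid n i l \<noteq> yid n i l" by (rule xid_ne_yid[OF l l])
  \<comment> \<open>\<open>list_array\<close> tests for an \<open>x\<close>-vertex before a
    \<open>y\<close>-vertex, so the new \<open>y\<close>-vertex must not be mistaken for an old
    \<open>x\<close>-vertex.\<close>
  moreover have "yid n i l \<notin> (\<lambda>(i, l). xid n i l) ` Z"
    using xid_ne_yid[OF _ l] Z by (auto simp: image_iff) (metis UNIV_I mem_Sigma_iff subsetD atLeastAtMost_iff)
  ultimately show "cell (cell (list_array n lam XL YL Z) (xid n i l) 0 XL) (yid n i l) 0 YL v j =
    list_array n lam XL YL (insert (i, l) Z) v j"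
    by (auto simp: list_array_def cell_apply)
qed

definition init_body :: com where
  "init_body =
     inc ''l'' ;;
     NAssign ''C'' (var ''i'') (var ''l'') (var ''l'') ;;
     SAssign ''lambda'' (NPlus (var ''Pn'') (var ''l'')) (NConst 0) (svar ''X'') ;;
     SAssign ''lambda'' (NPlus (NPlus (var ''Pn'') (var ''n'')) (var ''l'')) (NConst 0) (svar ''Y'')"

text \<open>\<open>Pn\<close> is the offset \<open>n * (2 * i + 1)\<close> of the current
  \<open>x\<close>-block; advanced by \<open>2 * n\<close> per forest, it ends at the number of
  vertices of the constructed graph.\<close>

definition init_phase :: com where
  "init_phase =
     (assign ''Pn'' (var ''n'') ;; assign ''i'' (NConst 0)) ;;
     While (BLess (var ''i'') (var ''D''))
       (assign ''l'' (NConst 0) ;;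
        While (BLess (var ''l'') (var ''n'')) init_body ;;
        (assign ''Pn'' (NPlus (NPlus (var ''Pn'') (var ''n'')) (var ''n'')) ;; inc ''i''))"

definition label_array :: "(nat \<times> nat) set \<Rightarrow> nat \<Rightarrow> nat \<Rightarrow> nat" where
  "label_array Z i l = (if (i, l) \<in> Z then l else 0)"

lemma label_array_empty: "label_array {} = (\<lambda>_ _. 0)"
  by (simp add: label_array_def fun_eq_iff)

lemma label_array_insert: "cell (label_array Z) i l l = label_array (insert (i, l) Z)"
  by (auto simp: label_array_def cell_apply fun_eq_iff)

lemma halts_init_phase:
  assumes s: "num s ''n'' 0 0 = n" "num s ''D'' 0 0 = m" "num s ''C'' = (\<lambda>_ _. 0)" "num s ''Pn'' = (\<lambda>_ _. 0)"
    "lst s ''X'' 0 0 = XL" "lst s ''Y'' 0 0 = YL"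
    "lst s ''lambda'' = (\<lambda>v j. if v \<in> {1..n} \<and> j = 0 then lam v else {})"
  shows "halts init_phase s (m * (n * 5 + 5) + 3) (\<lambda>s'.
     num s' ''Pn'' = scalar (n * (2 * m + 1)) \<and>
     num s' ''C'' = label_array ({..<m} \<times> {1..n}) \<and>
     lst s' ''lambda'' = list_array n lam XL YL ({..<m} \<times> {1..n}))"
proof -
  \<comment> \<open>The rows before \<open>k\<close> are complete and \<open>j\<close> entries of
    row \<open>k\<close> are done. The last two assignments of a pass turn a full row
    \<open>Q k n\<close> into \<open>Q (Suc k) 0\<close>.\<close>
  define Q where "Q k j s' \<longleftrightarrow> num s' ''i'' 0 0 = k \<and>
     num s' ''Pn'' = scalar (n * (2 * k + 1)) \<and>
     num s' ''C'' = label_array ({..<k} \<times> {1..n} \<union> {k} \<times> {1..j}) \<and>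
     lst s' ''lambda'' = list_array n lam XL YL ({..<k} \<times> {1..n} \<union> {k} \<times> {1..j})" for k j and s' :: store
  define pre where "pre = assign ''Pn'' (var ''n'') ;; assign ''i'' (NConst 0)"
  define body where "body = assign ''l'' (NConst 0) ;;
        While (BLess (var ''l'') (var ''n'')) init_body ;;
        (assign ''Pn'' (NPlus (NPlus (var ''Pn'') (var ''n'')) (var ''n'')) ;; inc ''i'')"
  have loop: "halts (While (BLess (var ''i'') (var ''D'')) body) (run pre s) (m * Suc (n * 5 + 4) + 1) (\<lambda>s'. Q m 0 s')"
  proof (rule halts_while)
    show "Q 0 0 (run pre s)"
      using s label_array_empty list_array_empty[of n lam XL YL] by (simp add: Q_def pre_def)
  next
    fix k and s' :: store
    assume k: "k < m" and inv: "Q k 0 s'"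
      and fr: "\<And>x. x \<notin> nwrites body \<Longrightarrow> num s' x = num (run pre s) x"
      "\<And>x. x \<notin> swrites body \<Longrightarrow> lst s' x = lst (run pre s) x"
    have s': "num s' ''n'' 0 0 = n" "num s' ''D'' 0 0 = m" "lst s' ''X'' 0 0 = XL" "lst s' ''Y'' 0 0 = YL"
      using fr(1)[of "''n''"] fr(1)[of "''D''"] fr(2)[of "''X''"] fr(2)[of "''Y''"] s
      by (simp_all add: body_def init_body_def pre_def)
    let ?s = "run (assign ''l'' (NConst 0)) s'"
    have "halts (While (BLess (var ''l'') (var ''n'')) init_body) ?s (n * Suc 4 + 1)
        (\<lambda>s. num s ''l'' 0 0 = n \<and> Q k n s)"
    proof (rule halts_while[where Inv = "\<lambda>j s. num s ''l'' 0 0 = j \<and> Q k j s"])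
      show "num ?s ''l'' 0 0 = 0 \<and> Q k 0 ?s" using inv by (simp add: Q_def)
    next
      fix j s2
      assume j: "j < n" and inv2: "num s2 ''l'' 0 0 = j \<and> Q k j s2"
        and fr2: "\<And>x. x \<notin> nwrites init_body \<Longrightarrow> num s2 x = num ?s x"
        "\<And>x. x \<notin> swrites init_body \<Longrightarrow> lst s2 x = lst ?s x"
      have s2: "num s2 ''n'' 0 0 = n" "lst s2 ''X'' 0 0 = XL" "lst s2 ''Y'' 0 0 = YL"
        using fr2(1)[of "''n''"] fr2(2)[of "''X''"] fr2(2)[of "''Y''"] s'
        by (simp_all add: init_body_def)
      have Z: "{..<k} \<times> {1..n} \<union> {k} \<times> {1..Suc j} = insert (k, Suc j) ({..<k} \<times> {1..n} \<union> {k} \<times> {1..j})"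
        by auto
      have x: "n * (2 * k + 1) + Suc j = xid n k (Suc j)" "n * (2 * k + 1) + n + Suc j = yid n k (Suc j)"
        by (simp_all add: xid_def yid_def)
      have la: "list_array n lam XL YL (insert (k, Suc j) ({..<k} \<times> {1..n} \<union> {k} \<times> {1..j})) =
          cell (cell (list_array n lam XL YL ({..<k} \<times> {1..n} \<union> {k} \<times> {1..j}))
            (n * (2 * k + 1) + Suc j) 0 XL) (n * (2 * k + 1) + n + Suc j) 0 YL"
        unfolding x by (rule list_array_insert[symmetric]) (use j in auto)
      have "num (run init_body s2) ''l'' 0 0 = Suc j \<and> Q k (Suc j) (run init_body s2)"
        using inv2 s2 unfolding Q_def Z la label_array_insert[symmetric]
        by (simp add: init_body_def del: mult_Suc_right)
      then show "bval (BLess (var ''l'') (var ''n'')) s2 \<and>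
          halts init_body s2 4 (\<lambda>s. num s ''l'' 0 0 = Suc j \<and> Q k (Suc j) s)"
        using j inv2 s2 by (auto intro!: halts_run simp: init_body_def)
    next
      fix s2
      assume "num s2 ''l'' 0 0 = n \<and> Q k n s2"
        and fr2: "\<And>x. x \<notin> nwrites init_body \<Longrightarrow> num s2 x = num ?s x"
      then show "\<not> bval (BLess (var ''l'') (var ''n'')) s2"
        using fr2[of "''n''"] s' by (simp add: init_body_def)
    qed
    then have "halts body s' (1 + (n * Suc 4 + 1 + 2)) (Q (Suc k) 0)"
      unfolding body_def
    proof (intro halts_mono[OF halts_prefix[OF _ halts_suffix[where R = "Q (Suc k) 0"]]])
      fix s2
      assume inv2: "num s2 ''l'' 0 0 = n \<and> Q k n s2"
        and fr2: "\<And>x. x \<notin> nwrites (While (BLess (var ''l'') (var ''n'')) init_body) \<Longrightarrow> num s2 x = num ?s x"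
      have "num s2 ''n'' 0 0 = n" using fr2[of "''n''"] s' by (simp add: init_body_def)
      moreover have "{..<Suc k} \<times> {1..n} \<union> {Suc k} \<times> {1..0} = {..<k} \<times> {1..n} \<union> {k} \<times> {1..n}" by auto
      ultimately show "Q (Suc k) 0 (run (assign ''Pn'' (NPlus (NPlus (var ''Pn'') (var ''n'')) (var ''n'')) ;; inc ''i'') s2)"
        using inv2 by (simp add: Q_def algebra_simps)
    qed auto
    then have "halts body s' (n * 5 + 4) (Q (Suc k) 0)" by (rule halts_mono) auto
    then show "bval (BLess (var ''i'') (var ''D'')) s' \<and> halts body s' (n * 5 + 4) (Q (Suc k) 0)"
      using k inv s' by (simp add: Q_def)
  next
    fix s'
    assume "Q m 0 s'" and fr: "\<And>x. x \<notin> nwrites body \<Longrightarrow> num s' x = num (run pre s) x"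
    then show "\<not> bval (BLess (var ''i'') (var ''D'')) s'"
      using fr[of "''D''"] s by (simp add: Q_def body_def init_body_def pre_def)
  qed
  show ?thesis
    unfolding init_phase_def pre_def[symmetric] body_def[symmetric]
    by (rule halts_mono[OF halts_prefix[OF _ loop]]) (auto simp: pre_def Q_def)
qed

section \<open>Distributing the arcs of \<open>G\<close> over the forests\<close>

definition edge_array :: "nat set set \<Rightarrow> nat \<Rightarrow> nat \<Rightarrow> nat" where
  "edge_array E v w = of_bool ({v, w} \<in> E)"

text \<open>The slot must be empty: an overwritten arc would leave its edges behind in the
  matrix.\<close>

lemma slot_edges_insert:
  assumes "S i l = None"
  shows "slot_edges n (S(i := (S i)(l := Some (u, v)))) =
    insert {yid n i l, v} (insert {xid n i l, yid n i l} (insert {u, xid n i l} (slot_edges n S)))"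
proof -
  have iff: "(S(i := (S i)(l := Some (u, v)))) i' l' = Some (u', v') \<longleftrightarrow>
      S i' l' = Some (u', v') \<or> i' = i \<and> l' = l \<and> u' = u \<and> v' = v" for i' l' u' v'
    using assms by auto
  show ?thesis
    unfolding slot_edges_def iff by (rule set_eqI, unfold insert_iff mem_Collect_eq) blast
qed

lemma edge_array_insert:
  "cell (cell (edge_array E) u v (Suc 0)) v u (Suc 0) = edge_array (insert {u, v} E)"
proof (rule ext, rule ext)
  fix a b
  have L: "cell (cell (edge_array E) u v (Suc 0)) v u (Suc 0) a b =
      (if a = v \<and> b = u then Suc 0 else if a = u \<and> b = v then Suc 0 else edge_array E a b)"
    unfolding cell_apply by (rule refl)
  have R: "edge_array (insert {u, v} E) a b = (if {a, b} = {u, v} then Suc 0 else edge_array E a b)"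
    by (simp add: edge_array_def)
  show "cell (cell (edge_array E) u v (Suc 0)) v u (Suc 0) a b = edge_array (insert {u, v} E) a b"
    unfolding L R doubleton_eq_iff by argo
qed

text \<open>A list is cut down again for each dropped arc at its vertex; intersection is idempotent,
  so the outcome depends only on whether the vertex lies in \<open>Field D\<close>.\<close>

lemma list_array_restrict:
  assumes uv: "u \<in> {1..n}" "v \<in> {1..n}"
    and f: "f = list_array n (arc_list D L lam) XL YL Z" and g: "g = cell f u 0 (f u 0 \<inter> L)"
  shows "cell g v 0 (g v 0 \<inter> L) = list_array n (arc_list (insert (u, v) D) L lam) XL YL Z"
proof (intro ext)
  fix w j
  have F: "w \<in> Field (insert (u, v) D) \<longleftrightarrow> w = u \<or> w = v \<or> w \<in> Field D"
    by (auto simp: Field_insert)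
  have g': "g w' j' = (if w' = u \<and> j' = 0 then f u 0 \<inter> L else f w' j')" for w' j'
    by (simp add: g cell_apply)
  show "cell g v 0 (g v 0 \<inter> L) w j = list_array n (arc_list (insert (u, v) D) L lam) XL YL Z w j"
  proof (cases "j = 0 \<and> w \<in> {1..n}")
    case True
    have "f w' 0 = arc_list D L lam w'" if "w' \<in> {1..n}" for w'
      using that by (simp add: f list_array_def)
    then have "f w 0 = arc_list D L lam w" "f u 0 = arc_list D L lam u" "f v 0 = arc_list D L lam v"
      using True uv by blast+
    moreover have "list_array n (arc_list (insert (u, v) D) L lam) XL YL Z w j =
        arc_list (insert (u, v) D) L lam w"
      using True by (simp add: list_array_def)
    ultimately show ?thesis
      using True unfolding cell_apply g' by (simp add: arc_list_def F Int_assoc)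
  next
    case False
    then have ne: "(w = u \<and> j = 0) = False" "(w = v \<and> j = 0) = False" using uv by blast+
    have "cell g v 0 (g v 0 \<inter> L) w j = f w j" unfolding cell_apply g' ne by simp
    also have "f w j = list_array n (arc_list (insert (u, v) D) L lam) XL YL Z w j"
      using False by (auto simp: f list_array_def)
    finally show ?thesis .
  qed
qed

text \<open>\<open>b\<close> follows \<open>n * (2 * i + 1)\<close>, the offset of the
  \<open>x\<close>-block of forest \<open>i\<close>. Ending with \<open>i = D\<close> means that no
  forest accepts the arc.\<close>

definition find_forest :: com where
  "find_forest =
     (assign ''i'' (NConst 0) ;; assign ''b'' (var ''n'')) ;;
     While (BAnd (BLess (var ''i'') (var ''D''))
         (equal (NCell ''C'' (var ''i'') (var ''u'')) (NCell ''C'' (var ''i'') (var ''v''))))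
       (inc ''i'' ;; assign ''b'' (NPlus (NPlus (var ''b'') (var ''n'')) (var ''n'')))"

text \<open>Both labels are saved in \<open>l\<close> and \<open>m\<close> beforehand, as the loop
  overwrites cells from which they are read.\<close>

definition keep_arc :: com where
  "keep_arc =
     (assign ''l'' (NCell ''C'' (var ''i'') (var ''u'')) ;;
      assign ''m'' (NCell ''C'' (var ''i'') (var ''v'')) ;;
      assign ''x'' (NPlus (var ''b'') (var ''l'')) ;;
      assign ''y'' (NPlus (NPlus (var ''b'') (var ''n'')) (var ''l'')) ;;
      NAssign ''PE'' (var ''u'') (var ''x'') (NConst 1) ;;
      NAssign ''PE'' (var ''x'') (var ''u'') (NConst 1) ;;
      NAssign ''PE'' (var ''x'') (var ''y'') (NConst 1) ;;
      NAssign ''PE'' (var ''y'') (var ''x'') (NConst 1) ;;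
      NAssign ''PE'' (var ''y'') (var ''v'') (NConst 1) ;;
      NAssign ''PE'' (var ''v'') (var ''y'') (NConst 1) ;;
      assign ''w'' (NConst 0)) ;;
     While (BLess (var ''w'') (var ''n''))
       (inc ''w'' ;;
        Cond (equal (NCell ''C'' (var ''i'') (var ''w'')) (var ''l''))
          (NAssign ''C'' (var ''i'') (var ''w'') (var ''m'')) Skip)"

definition drop_arc :: com where
  "drop_arc =
     SAssign ''lambda'' (var ''u'') (NConst 0) (SInter (SCell ''lambda'' (var ''u'') (NConst 0)) (svar ''loops'')) ;;
     SAssign ''lambda'' (var ''v'') (NConst 0) (SInter (SCell ''lambda'' (var ''v'') (NConst 0)) (svar ''loops''))"

definition arc_step :: com where
  "arc_step =
     Cond (BLess (NConst 0) (NCell ''G'' (var ''u'') (var ''v'')))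
       (find_forest ;; Cond (BLess (var ''i'') (var ''D'')) keep_arc drop_arc) Skip"

definition arc_phase :: com where
  "arc_phase =
     assign ''u'' (NConst 0) ;;
     While (BLess (var ''u'') (var ''n''))
       (inc ''u'' ;; assign ''v'' (NConst 0) ;;
        While (BLess (var ''v'') (var ''n'')) (inc ''v'' ;; arc_step))"

lemma halts_find_forest:
  assumes s: "num s ''n'' 0 0 = n" "num s ''D'' 0 0 = m" "num s ''u'' 0 0 = u" "num s ''v'' 0 0 = v"
    "num s ''C'' = C"
  shows "halts find_forest s (m * 3 + 3) (\<lambda>s'. \<exists>i\<le>m. num s' ''i'' 0 0 = i \<and> num s' ''b'' 0 0 = n * (2 * i + 1) \<and>
     (\<forall>j<i. C j u = C j v) \<and> (i < m \<longrightarrow> C i u \<noteq> C i v))"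
proof -
  \<comment> \<open>The loop rule asks for the number of passes beforehand: the least index with
    different labels, or \<open>m\<close>.\<close>
  define i where "i = (LEAST i. i = m \<or> C i u \<noteq> C i v)"
  have i: "i = m \<or> C i u \<noteq> C i v" unfolding i_def by (rule LeastI[of _ m]) simp
  have im: "i \<le> m" unfolding i_def by (rule Least_le) simp
  have lt: "j \<noteq> m \<and> C j u = C j v" if "j < i" for j using that not_less_Least unfolding i_def by blast
  let ?pre = "assign ''i'' (NConst 0) ;; assign ''b'' (var ''n'')"
  let ?body = "inc ''i'' ;; assign ''b'' (NPlus (NPlus (var ''b'') (var ''n'')) (var ''n''))"
  let ?b = "BAnd (BLess (var ''i'') (var ''D''))
         (equal (NCell ''C'' (var ''i'') (var ''u'')) (NCell ''C'' (var ''i'') (var ''v'')))"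
  have loop: "halts (While ?b ?body) (run ?pre s) (i * Suc 2 + 1)
     (\<lambda>s'. num s' ''i'' 0 0 = i \<and> num s' ''b'' 0 0 = n * (2 * i + 1))"
  proof (rule halts_while[where Inv = "\<lambda>i s'. num s' ''i'' 0 0 = i \<and> num s' ''b'' 0 0 = n * (2 * i + 1)"])
    show "num (run ?pre s) ''i'' 0 0 = 0 \<and> num (run ?pre s) ''b'' 0 0 = n * (2 * 0 + 1)"
      using s by simp
  next
    fix k and s' :: store
    assume k: "k < i" and inv: "num (s'::store) ''i'' 0 0 = k \<and> num s' ''b'' 0 0 = n * (2 * k + 1)"
      and fr: "\<And>x. x \<notin> nwrites ?body \<Longrightarrow> num s' x = num (run ?pre s) x"
    have s': "num s' ''n'' 0 0 = n" "num s' ''D'' 0 0 = m" "num s' ''u'' 0 0 = u" "num s' ''v'' 0 0 = v"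
      "num s' ''C'' = C"
      using fr[of "''n''"] fr[of "''D''"] fr[of "''u''"] fr[of "''v''"] fr[of "''C''"] s by simp_all
    show "bval ?b s' \<and> halts ?body s' 2 (\<lambda>s'. num s' ''i'' 0 0 = Suc k \<and> num s' ''b'' 0 0 = n * (2 * Suc k + 1))"
    proof
      show "bval ?b s'" using s' inv lt[OF k] k im by simp
      show "halts ?body s' 2 (\<lambda>s'. num s' ''i'' 0 0 = Suc k \<and> num s' ''b'' 0 0 = n * (2 * Suc k + 1))"
        by (rule halts_run) (use s' inv in \<open>auto simp: algebra_simps\<close>)
    qed
  next
    fix s' :: store
    assume inv: "num s' ''i'' 0 0 = i \<and> num s' ''b'' 0 0 = n * (2 * i + 1)"
      and fr: "\<And>x. x \<notin> nwrites ?body \<Longrightarrow> num s' x = num (run ?pre s) x"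
    have s': "num s' ''n'' 0 0 = n" "num s' ''D'' 0 0 = m" "num s' ''u'' 0 0 = u" "num s' ''v'' 0 0 = v"
      "num s' ''C'' = C"
      using fr[of "''n''"] fr[of "''D''"] fr[of "''u''"] fr[of "''v''"] fr[of "''C''"] s by simp_all
    show "\<not> bval ?b s'" using i im inv s' by auto
  qed
  show ?thesis unfolding find_forest_def
    by (rule halts_mono[OF halts_prefix[OF _ loop]]) (use i im lt in auto)
qed

lemma relabel_Suc:
  "relabel (Suc k) i l m C = (if C i (Suc k) = l then cell (relabel k i l m C) i (Suc k) m else relabel k i l m C)"
proof (intro ext)
  fix i' w
  have "w \<in> {1..Suc k} \<longleftrightarrow> w = Suc k \<or> w \<in> {1..k}" by auto
  then show "relabel (Suc k) i l m C i' w =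
    (if C i (Suc k) = l then cell (relabel k i l m C) i (Suc k) m else relabel k i l m C) i' w"
    by (simp add: relabel_def cell_apply del: atLeastAtMost_iff)
qed

lemma relabel_0: "relabel 0 i l m C = C"
  by (auto simp: relabel_def fun_eq_iff)

lemma halts_keep_arc:
  assumes s: "num s ''n'' 0 0 = n" "num s ''u'' 0 0 = u" "num s ''v'' 0 0 = v" "num s ''i'' 0 0 = i"
    "num s ''b'' 0 0 = n * (2 * i + 1)" "num s ''C'' = C" "num s ''PE'' = edge_array (slot_edges n S)"
    and free: "S i (C i u) = None"
  shows "halts keep_arc s (n * 4 + 12) (\<lambda>s'. num s' ''C'' = relabel n i (C i u) (C i v) C \<and>
     num s' ''PE'' = edge_array (slot_edges n (S(i := (S i)(C i u := Some (u, v))))))"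
proof -
  define pre where "pre = 
     assign ''l'' (NCell ''C'' (var ''i'') (var ''u'')) ;;
      assign ''m'' (NCell ''C'' (var ''i'') (var ''v'')) ;;
      assign ''x'' (NPlus (var ''b'') (var ''l'')) ;;
      assign ''y'' (NPlus (NPlus (var ''b'') (var ''n'')) (var ''l'')) ;;
      NAssign ''PE'' (var ''u'') (var ''x'') (NConst 1) ;;
      NAssign ''PE'' (var ''x'') (var ''u'') (NConst 1) ;;
      NAssign ''PE'' (var ''x'') (var ''y'') (NConst 1) ;;
      NAssign ''PE'' (var ''y'') (var ''x'') (NConst 1) ;;
      NAssign ''PE'' (var ''y'') (var ''v'') (NConst 1) ;;
      NAssign ''PE'' (var ''v'') (var ''y'') (NConst 1) ;;
      assign ''w'' (NConst 0)"
  let ?body = "inc ''w'' ;;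
        Cond (equal (NCell ''C'' (var ''i'') (var ''w'')) (var ''l''))
          (NAssign ''C'' (var ''i'') (var ''w'') (var ''m'')) Skip"
  let ?b = "BLess (var ''w'') (var ''n'')"
  have pre: "num (run pre s) ''n'' 0 0 = n" "num (run pre s) ''i'' 0 0 = i" "num (run pre s) ''l'' 0 0 = C i u"
    "num (run pre s) ''m'' 0 0 = C i v" "num (run pre s) ''w'' 0 0 = 0" "num (run pre s) ''C'' = C"
    using s by (simp_all add: pre_def)
  have xy: "n * (2 * i + 1) + C i u = xid n i (C i u)" "n * (2 * i + 1) + n + C i u = yid n i (C i u)"
    by (simp_all add: xid_def yid_def)
  have PE: "num (run pre s) ''PE'' = edge_array (slot_edges n (S(i := (S i)(C i u := Some (u, v)))))"
    unfolding slot_edges_insert[where S = S and i = i and l = "C i u", OF free]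
      edge_array_insert[symmetric] xy[symmetric]
    using s by (simp add: pre_def del: mult_Suc_right)
  have loop: "halts (While ?b ?body) (run pre s) (n * Suc 3 + 1)
     (\<lambda>s'. num s' ''w'' 0 0 = n \<and> num s' ''C'' = relabel n i (C i u) (C i v) C \<and>
        num s' ''PE'' = num (run pre s) ''PE'')"
  proof (rule halts_while[where Inv = "\<lambda>k s'. num s' ''w'' 0 0 = k \<and> num s' ''C'' = relabel k i (C i u) (C i v) C \<and>
        num s' ''PE'' = num (run pre s) ''PE''"])
    show "num (run pre s) ''w'' 0 0 = 0 \<and> num (run pre s) ''C'' = relabel 0 i (C i u) (C i v) C \<and>
        num (run pre s) ''PE'' = num (run pre s) ''PE''"
      using pre by (simp add: relabel_0)
  next
    fix k and s' :: store
    assume k: "k < n" and inv: "num s' ''w'' 0 0 = k \<and> num s' ''C'' = relabel k i (C i u) (C i v) C \<and>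
        num s' ''PE'' = num (run pre s) ''PE''"
      and fr: "\<And>x. x \<notin> nwrites ?body \<Longrightarrow> num s' x = num (run pre s) x"
    have s': "num s' ''n'' 0 0 = n" "num s' ''i'' 0 0 = i" "num s' ''l'' 0 0 = C i u"
      "num s' ''m'' 0 0 = C i v"
      using fr[of "''n''"] fr[of "''i''"] fr[of "''l''"] fr[of "''m''"] pre by simp_all
    \<comment> \<open>This pass treats vertex \<open>Suc k\<close>, whose label is still the
      original one.\<close>
    have old: "relabel k i (C i u) (C i v) C i (Suc k) = C i (Suc k)" by (simp add: relabel_def)
    have "num (run ?body s') ''w'' 0 0 = Suc k \<and>
        num (run ?body s') ''C'' = relabel (Suc k) i (C i u) (C i v) C \<and>
        num (run ?body s') ''PE'' = num (run pre s) ''PE''"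
      unfolding relabel_Suc using s' inv old by auto
    then show "bval ?b s' \<and> halts ?body s' 3 (\<lambda>s'. num s' ''w'' 0 0 = Suc k \<and>
        num s' ''C'' = relabel (Suc k) i (C i u) (C i v) C \<and> num s' ''PE'' = num (run pre s) ''PE'')"
      using s' inv k by (auto intro!: halts_run simp del: run.simps)
  next
    fix s' :: store
    assume inv: "num s' ''w'' 0 0 = n \<and> num s' ''C'' = relabel n i (C i u) (C i v) C \<and>
        num s' ''PE'' = num (run pre s) ''PE''"
      and fr: "\<And>x. x \<notin> nwrites ?body \<Longrightarrow> num s' x = num (run pre s) x"
    show "\<not> bval ?b s'" using inv fr[of "''n''"] pre by simp
  qed
  show ?thesis unfolding keep_arc_def pre_def[symmetric]
    by (rule halts_mono[OF halts_prefix[OF _ loop]]) (auto simp: PE, simp_all add: pre_def)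
qed

text \<open>\<open>S\<close> and \<open>D\<close> are ghost data: memory holds only the labels, the
  adjacency matrix and the restricted lists.\<close>

definition arc_inv :: "nat \<Rightarrow> nat \<Rightarrow> nat set \<Rightarrow> (nat \<Rightarrow> nat set) \<Rightarrow> nat set \<Rightarrow> nat set \<Rightarrow> (nat \<times> nat) set \<Rightarrow>
    store \<Rightarrow> bool" where
  "arc_inv n d L lam XL YL A s \<longleftrightarrow> (\<exists>S D. forests n d A S D (num s ''C'') \<and>
     num s ''PE'' = edge_array (slot_edges n S) \<and>
     lst s ''lambda'' = list_array n (arc_list D L lam) XL YL ({..<Suc d} \<times> {1..n}))"

lemma arc_inv_cong:
  "num s' ''C'' = num s ''C'' \<Longrightarrow> num s' ''PE'' = num s ''PE'' \<Longrightarrow> lst s' ''lambda'' = lst s ''lambda'' \<Longrightarrow>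
   arc_inv n d L lam XL YL A s' \<longleftrightarrow> arc_inv n d L lam XL YL A s"
  by (simp add: arc_inv_def)

lemma halts_arc_step:
  assumes s: "num s ''n'' 0 0 = n" "num s ''D'' 0 0 = Suc d" "num s ''u'' 0 0 = u" "num s ''v'' 0 0 = v"
      "num s ''G'' = (\<lambda>u v. of_bool ((u, v) \<in> G))" "lst s ''loops'' 0 0 = L"
    and uv: "u \<in> {1..n}" "v \<in> {1..n}" "(u, v) \<notin> A"
    and inv: "arc_inv n d L lam XL YL A s"
  shows "halts arc_step s (Suc d * 3 + n * 4 + 17)
    (arc_inv n d L lam XL YL (if (u, v) \<in> G then insert (u, v) A else A))"
proof -
  have skip: "halts Skip s (Suc d * 3 + n * 4 + 16) (arc_inv n d L lam XL YL (if (u, v) \<in> G then insert (u, v) A else A))"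
    if "(u, v) \<notin> G"
    by (rule halts_run) (use inv that in auto)
  have step: "halts (find_forest ;; Cond (BLess (var ''i'') (var ''D'')) keep_arc drop_arc) s
      ((Suc d * 3 + 3) + Suc (n * 4 + 12)) (arc_inv n d L lam XL YL (if (u, v) \<in> G then insert (u, v) A else A))"
    if arc: "(u, v) \<in> G"
  proof (rule halts_seq[OF halts_find_forest[OF s(1-4) refl]])
    fix s' :: store
    assume ex: "\<exists>i\<le>Suc d. num s' ''i'' 0 0 = i \<and> num s' ''b'' 0 0 = n * (2 * i + 1) \<and>
        (\<forall>j<i. num s ''C'' j u = num s ''C'' j v) \<and> (i < Suc d \<longrightarrow> num s ''C'' i u \<noteq> num s ''C'' i v)"
      and fr: "\<And>x. x \<notin> nwrites find_forest \<Longrightarrow> num s' x = num s x"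
        "\<And>x. x \<notin> swrites find_forest \<Longrightarrow> lst s' x = lst s x"
    define i where "i = num s' ''i'' 0 0"
    have i: "i \<le> Suc d" "num s' ''b'' 0 0 = n * (2 * i + 1)" "\<And>j. j < i \<Longrightarrow> num s ''C'' j u = num s ''C'' j v"
      "i < Suc d \<Longrightarrow> num s ''C'' i u \<noteq> num s ''C'' i v"
      using ex unfolding i_def by blast+
    have s': "num s' ''n'' 0 0 = n" "num s' ''D'' 0 0 = Suc d" "num s' ''u'' 0 0 = u" "num s' ''v'' 0 0 = v"
      "lst s' ''loops'' 0 0 = L" "num s' ''C'' = num s ''C''" "num s' ''PE'' = num s ''PE''"
      "lst s' ''lambda'' = lst s ''lambda''"
      using fr(1)[of "''n''"] fr(1)[of "''D''"] fr(1)[of "''u''"] fr(1)[of "''v''"] fr(2)[of "''loops''"]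
        fr(1)[of "''C''"] fr(1)[of "''PE''"] fr(2)[of "''lambda''"] s
      by (simp_all add: find_forest_def)
    obtain S D where F: "forests n d A S D (num s ''C'')" and PE: "num s ''PE'' = edge_array (slot_edges n S)"
      and lam: "lst s ''lambda'' = list_array n (arc_list D L lam) XL YL ({..<Suc d} \<times> {1..n})"
      using inv unfolding arc_inv_def by blast
    show "halts (Cond (BLess (var ''i'') (var ''D'')) keep_arc drop_arc) s' (Suc (n * 4 + 12))
        (arc_inv n d L lam XL YL (if (u, v) \<in> G then insert (u, v) A else A))"
    proof (rule halts_cond)
      assume "bval (BLess (var ''i'') (var ''D'')) s'"
      then have id: "i < Suc d" using s'(2) by (simp add: i_def)
      let ?C = "num s ''C''"
      have free: "S i (?C i u) = None"
        using forests.slot_label[OF F _ uv(1), of i "?C i u"] by (cases "S i (?C i u)") auto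
      have "halts keep_arc s' (n * 4 + 12) (\<lambda>s2. num s2 ''C'' = relabel n i (?C i u) (?C i v) ?C \<and>
          num s2 ''PE'' = edge_array (slot_edges n (S(i := (S i)(?C i u := Some (u, v))))))"
        by (rule halts_keep_arc[where S = S and i = i and C = ?C, OF s'(1,3,4) i_def[symmetric] i(2) s'(6) _ free])
          (simp add: s' PE)
      from halts_frame[OF this] have "halts keep_arc s' (n * 4 + 12) (\<lambda>s2. (num s2 ''C'' = relabel n i (?C i u) (?C i v) ?C \<and>
          num s2 ''PE'' = edge_array (slot_edges n (S(i := (S i)(?C i u := Some (u, v)))))) \<and>
          lst s2 ''lambda'' = lst s' ''lambda'')"
      proof (rule halts_mono[OF _ order_refl], elim conjE, intro conjI)
        fix s2 :: store
        assume "\<forall>x. x \<notin> swrites keep_arc \<longrightarrow> lst s2 x = lst s' x"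
        then show "lst s2 ''lambda'' = lst s' ''lambda''" by (simp add: keep_arc_def)
      qed
      then show "halts keep_arc s' (n * 4 + 12)
          (arc_inv n d L lam XL YL (if (u, v) \<in> G then insert (u, v) A else A))"
      proof (rule halts_mono)
        fix s2 :: store
        assume s2: "(num s2 ''C'' = relabel n i (?C i u) (?C i v) ?C \<and>
          num s2 ''PE'' = edge_array (slot_edges n (S(i := (S i)(?C i u := Some (u, v)))))) \<and>
          lst s2 ''lambda'' = lst s' ''lambda''"
        have c: "num s2 ''C'' = relabel n i (?C i u) (?C i v) ?C"
          "num s2 ''PE'' = edge_array (slot_edges n (S(i := (S i)(?C i u := Some (u, v)))))"
          "lst s2 ''lambda'' = list_array n (arc_list D L lam) XL YL ({..<Suc d} \<times> {1..n})"
          using s2 lam s'(8) by simp_all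
        have "forests n d (insert (u, v) A) (S(i := (S i)(?C i u := Some (u, v)))) D
           (relabel n i (?C i u) (?C i v) ?C)"
          by (rule forests.forests_keep[OF F uv]) (use id i(4) in auto)
        then show "arc_inv n d L lam XL YL (if (u, v) \<in> G then insert (u, v) A else A) s2"
          unfolding arc_inv_def c if_P[OF arc] by blast
      qed simp
    next
      assume "\<not> bval (BLess (var ''i'') (var ''D'')) s'"
      \<comment> \<open>All rows \<open>0, ..., d\<close> have been passed, so the ends agree in
        every forest and the arc is dropped.\<close>
      then have id: "i = Suc d" using s'(2) i(1) by (simp add: i_def)
      have "forests n d (insert (u, v) A) S (insert (u, v) D) (num s ''C'')"
        by (rule forests.forests_drop[OF F uv(1,2)]) (use id i(3) in auto)
      moreover have "lst (run drop_arc s') ''lambda'' =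
          list_array n (arc_list (insert (u, v) D) L lam) XL YL ({..<Suc d} \<times> {1..n})"
        unfolding list_array_restrict[OF uv(1,2) refl refl, symmetric]
        using s' lam by (simp add: drop_arc_def)
      moreover have "num (run drop_arc s') = num s'" by (simp add: drop_arc_def)
      ultimately have "arc_inv n d L lam XL YL (insert (u, v) A) (run drop_arc s')"
        unfolding arc_inv_def using s'(6) s'(7) PE by auto
      then show "halts drop_arc s' (n * 4 + 12)
          (arc_inv n d L lam XL YL (if (u, v) \<in> G then insert (u, v) A else A))"
        using arc by (intro halts_run) (simp_all add: drop_arc_def)
    qed
  qed
  have "halts arc_step s (Suc (Suc d * 3 + n * 4 + 16))
    (arc_inv n d L lam XL YL (if (u, v) \<in> G then insert (u, v) A else A))"
    unfolding arc_step_def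
  proof (rule halts_cond)
    assume "bval (BLess (NConst 0) (NCell ''G'' (var ''u'') (var ''v''))) s"
    then have "(u, v) \<in> G" using s by (simp split: if_splits)
    from step[OF this] show "halts (find_forest ;; Cond (BLess (var ''i'') (var ''D'')) keep_arc drop_arc) s
        (Suc d * 3 + n * 4 + 16) (arc_inv n d L lam XL YL (if (u, v) \<in> G then insert (u, v) A else A))"
      by (rule halts_mono) auto
  next
    assume "\<not> bval (BLess (NConst 0) (NCell ''G'' (var ''u'') (var ''v''))) s"
    then have "(u, v) \<notin> G" using s by simp
    then show "halts Skip s (Suc d * 3 + n * 4 + 16)
        (arc_inv n d L lam XL YL (if (u, v) \<in> G then insert (u, v) A else A))" by (rule skip)
  qed
  then show ?thesis by simp
qed

lemma halts_arc_phase: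
  assumes s: "num s ''n'' 0 0 = n" "num s ''D'' 0 0 = Suc d"
      "num s ''G'' = (\<lambda>u v. of_bool ((u, v) \<in> G))" "lst s ''loops'' 0 0 = L"
      "num s ''PE'' = (\<lambda>_ _. 0)" "num s ''C'' = label_array ({..<Suc d} \<times> {1..n})"
      "lst s ''lambda'' = list_array n lam XL YL ({..<Suc d} \<times> {1..n})"
    and G: "G \<subseteq> {1..n} \<times> {1..n}"
  shows "halts arc_phase s (n * (n * (Suc d * 3 + n * 4 + 19) + 4) + 2) (arc_inv n d L lam XL YL G)"
proof -
  \<comment> \<open>The arcs met so far when the matrix is scanned row by row: rows up to
    \<open>u\<close> and \<open>v\<close> entries of the next row. Vertices start at 1, so
    \<open>R 0 0\<close> is empty.\<close>
  define R where "R u v = {(u', v') \<in> G. u' \<le> u \<or> u' = Suc u \<and> v' \<le> v}" for u v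
  have R0: "R 0 0 = {}" using G by (auto simp: R_def)
  have Rn: "R u n = R (Suc u) 0" for u using G by (auto simp: R_def le_Suc_eq)
  have RG: "R n 0 = G" using G by (auto simp: R_def)
  have RS: "R u (Suc v) = (if (Suc u, Suc v) \<in> G then insert (Suc u, Suc v) (R u v) else R u v)" for u v
    by (auto simp: R_def le_Suc_eq)
  have Rnot: "(Suc u, Suc v) \<notin> R u v" for u v by (auto simp: R_def)
  let ?I = "arc_inv n d L lam XL YL"
  let ?inner = "inc ''v'' ;; arc_step"
  let ?outer' = "inc ''u'' ;; assign ''v'' (NConst 0) ;; While (BLess (var ''v'') (var ''n'')) ?inner"
  let ?s0 = "run (assign ''u'' (NConst 0)) s"
  have w: "(nwrites ?inner \<union> swrites ?inner) \<inter> {''n'', ''D'', ''G'', ''loops'', ''u''} = {}"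
    "(nwrites ?outer' \<union> swrites ?outer') \<inter> {''n'', ''D'', ''G'', ''loops''} = {}"
    "nwrites arc_step \<inter> {''u'', ''v''} = {}"
    by (simp_all add: arc_step_def find_forest_def keep_arc_def drop_arc_def)
  have loop: "halts (While (BLess (var ''u'') (var ''n'')) ?outer') ?s0
      (n * Suc (n * (Suc d * 3 + n * 4 + 19) + 3) + 1) (\<lambda>s'. num s' ''u'' 0 0 = n \<and> ?I (R n 0) s')"
  proof (rule halts_while[where Inv = "\<lambda>k s'. num s' ''u'' 0 0 = k \<and> ?I (R k 0) s'"])
    have "forests n d {} (\<lambda>_ _. None) {} (num s ''C'')"
      by (rule forests_empty) (simp add: s(6) label_array_def)
    moreover have "edge_array (slot_edges n (\<lambda>_ _. None)) = (\<lambda>_ _. 0)"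
      by (simp add: edge_array_def slot_edges_def fun_eq_iff)
    moreover have "arc_list {} L lam = lam" by (simp add: arc_list_def fun_eq_iff)
    ultimately have "?I {} s" unfolding arc_inv_def using s(5,7) by metis
    then have "?I (R 0 0) ?s0" unfolding R0 by (subst arc_inv_cong) simp_all
    then show "num ?s0 ''u'' 0 0 = 0 \<and> ?I (R 0 0) ?s0" by simp
  next
    fix u and s1 :: store
    assume u: "u < n" and inv: "num s1 ''u'' 0 0 = u \<and> ?I (R u 0) s1"
      and fr: "\<And>x. x \<notin> nwrites ?outer' \<Longrightarrow> num s1 x = num ?s0 x"
        "\<And>x. x \<notin> swrites ?outer' \<Longrightarrow> lst s1 x = lst ?s0 x"
    have s1: "num s1 ''n'' 0 0 = n" "num s1 ''D'' 0 0 = Suc d" "num s1 ''G'' = (\<lambda>u v. of_bool ((u, v) \<in> G))"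
      "lst s1 ''loops'' 0 0 = L"
      using fr(1)[of "''n''"] fr(1)[of "''D''"] fr(1)[of "''G''"] fr(2)[of "''loops''"] s w(2) by auto
    let ?s1 = "run (inc ''u'') s1"
    let ?s2 = "run (assign ''v'' (NConst 0)) ?s1"
    have inner: "halts (While (BLess (var ''v'') (var ''n'')) ?inner) ?s2
        (n * Suc (Suc d * 3 + n * 4 + 18) + 1) (\<lambda>s'. num s' ''v'' 0 0 = n \<and> num s' ''u'' 0 0 = Suc u \<and> ?I (R u n) s')"
    proof (rule halts_while[where Inv = "\<lambda>k s'. num s' ''v'' 0 0 = k \<and> num s' ''u'' 0 0 = Suc u \<and> ?I (R u k) s'"])
      have "?I (R u 0) ?s2" using inv by (subst arc_inv_cong[of _ s1]) simp_all
      then show "num ?s2 ''v'' 0 0 = 0 \<and> num ?s2 ''u'' 0 0 = Suc u \<and> ?I (R u 0) ?s2" using inv by simp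
    next
      fix v and s3 :: store
      assume v: "v < n" and inv3: "num s3 ''v'' 0 0 = v \<and> num s3 ''u'' 0 0 = Suc u \<and> ?I (R u v) s3"
        and fr3: "\<And>x. x \<notin> nwrites ?inner \<Longrightarrow> num s3 x = num ?s2 x"
          "\<And>x. x \<notin> swrites ?inner \<Longrightarrow> lst s3 x = lst ?s2 x"
      have s3: "num s3 ''n'' 0 0 = n" "num s3 ''D'' 0 0 = Suc d" "num s3 ''G'' = (\<lambda>u v. of_bool ((u, v) \<in> G))"
        "lst s3 ''loops'' 0 0 = L"
        using fr3(1)[of "''n''"] fr3(1)[of "''D''"] fr3(1)[of "''G''"] fr3(2)[of "''loops''"] s1 w(1) by auto
      let ?s4 = "run (inc ''v'') s3"
      have "?I (R u v) ?s4" using inv3 by (subst arc_inv_cong[of _ s3]) simp_all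
      then have "halts arc_step ?s4 (Suc d * 3 + n * 4 + 17)
          (?I (if (Suc u, Suc v) \<in> G then insert (Suc u, Suc v) (R u v) else R u v))"
        by (rule halts_arc_step[rotated -1]) (use s3 inv3 u v Rnot in auto)
      then have "halts arc_step ?s4 (Suc d * 3 + n * 4 + 17) (\<lambda>s'. num s' ''v'' 0 0 = Suc v \<and>
          num s' ''u'' 0 0 = Suc u \<and> ?I (R u (Suc v)) s')"
        unfolding RS halts_def using inv3 w(3) by (elim exE conjE) (intro exI conjI, assumption+, auto)
      then have "halts ?inner s3 (Suc d * 3 + n * 4 + 18) (\<lambda>s'. num s' ''v'' 0 0 = Suc v \<and>
          num s' ''u'' 0 0 = Suc u \<and> ?I (R u (Suc v)) s')"
        by (intro halts_mono[OF halts_prefix]) auto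
      then show "bval (BLess (var ''v'') (var ''n'')) s3 \<and> halts ?inner s3 (Suc d * 3 + n * 4 + 18)
          (\<lambda>s'. num s' ''v'' 0 0 = Suc v \<and> num s' ''u'' 0 0 = Suc u \<and> ?I (R u (Suc v)) s')"
        using s3 inv3 v by simp
    next
      fix s3 :: store
      assume "num s3 ''v'' 0 0 = n \<and> num s3 ''u'' 0 0 = Suc u \<and> ?I (R u n) s3"
        and fr3: "\<And>x. x \<notin> nwrites ?inner \<Longrightarrow> num s3 x = num ?s2 x"
      then show "\<not> bval (BLess (var ''v'') (var ''n'')) s3"
        using fr3[of "''n''"] s1 w(1) by auto
    qed
    show "bval (BLess (var ''u'') (var ''n'')) s1 \<and> halts ?outer' s1
        (n * (Suc d * 3 + n * 4 + 19) + 3) (\<lambda>s'. num s' ''u'' 0 0 = Suc u \<and> ?I (R (Suc u) 0) s')"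
    proof
      show "bval (BLess (var ''u'') (var ''n'')) s1" using s1 inv u by simp
      show "halts ?outer' s1 (n * (Suc d * 3 + n * 4 + 19) + 3)
          (\<lambda>s'. num s' ''u'' 0 0 = Suc u \<and> ?I (R (Suc u) 0) s')"
        by (rule halts_mono[OF halts_prefix[OF _ halts_prefix[OF _ inner]]]) (auto simp: Rn)
    qed
  next
    fix s1 :: store
    assume "num s1 ''u'' 0 0 = n \<and> ?I (R n 0) s1"
      and fr: "\<And>x. x \<notin> nwrites ?outer' \<Longrightarrow> num s1 x = num ?s0 x"
    then show "\<not> bval (BLess (var ''u'') (var ''n'')) s1"
      using fr[of "''n''"] s w(2) by auto
  qed
  show ?thesis unfolding arc_phase_def
    by (rule halts_mono[OF halts_prefix[OF _ loop]]) (auto simp: RG)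
qed

text \<open>
  The given program for List Allocation runs on renamed copies of its arrays, which are all blank in
  the input of the homomorphism problem.  Only \<open>lambda\<close>, which is extended in place, and the output
  are shared.
\<close>

definition ren_name :: "string \<Rightarrow> string" where
  "ren_name x = (if x \<in> {''out'', ''ans'', ''lambda''} then x else CHR ''P'' # x)"

text \<open>None of the three shared names starts with \<open>P\<close>, so a prefixed name never
  collides with them.\<close>

lemma inj_ren_name: "inj ren_name"
  by (rule injI) (auto simp: ren_name_def split: if_splits)

definition prep :: com where
  "prep = alpha_phase ;; init_phase ;; arc_phase"

section \<open>The prepared store as an input of List Allocation\<close>

context reduction begin

text \<open>The slots of all \<open>d + 1\<close> forests exhaust the vertices from
  \<open>n + 1\<close> to \<open>N\<close>, so for \<open>j = 0\<close> the default
  \<open>{}\<close> of \<open>list_array\<close> is met only outside \<open>{1..N}\<close>.\<close>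

lemma list_array_J:
  "list_array n (arc_list D (loops I) (hom_list I)) (insert r (xlist h (loops I) (length ps)))
     (insert r (ylist h (loops I) (length ps))) ({..<Suc d} \<times> {1..n}) =
   (\<lambda>v j. if v \<in> {1..N} \<and> j = 0 then la_list J v else {})"
proof (rule ext, rule ext)
  fix v j
  let ?Z = "{..<Suc d} \<times> {1..n}"
  let ?x = "(\<lambda>(i, l). xid n i l) ` ?Z" and ?y = "(\<lambda>(i, l). yid n i l) ` ?Z"
  let ?A = "list_array n (arc_list D (loops I) (hom_list I)) (insert r (xlist h (loops I) (length ps)))
     (insert r (ylist h (loops I) (length ps))) ?Z"
  show "?A v j = (if v \<in> {1..N} \<and> j = 0 then la_list J v else {})"
  proof (cases "v \<in> {1..N} \<and> j = 0")
    case True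
    then have "v \<in> {1..N}" by blast
    then show ?thesis
    proof (cases rule: vertex_cases)
      case 1
      then show ?thesis using True by (simp add: list_array_def la_list_J)
    next
      case (2 i l)
      have "v \<notin> {1..n}" "n < v" using 2 xid_bounds[OF 2(2,1)] by auto
      moreover have "v \<in> ?x" using 2 by (auto intro!: image_eqI[of _ _ "(i, l)"])
      moreover have "block n v = 2 * i + 1" using 2 by simp
      ultimately show ?thesis using True by (simp add: list_array_def la_list_J)
    next
      case (3 i l)
      have "v \<notin> {1..n}" "n < v" using 3 yid_bounds[OF 3(2,1)] by auto
      moreover have "v \<notin> ?x"
      proof
        assume "v \<in> ?x"
        then obtain i' l' where "l' \<in> {1..n}" "v = xid n i' l'" by auto
        then show False using xid_ne_yid[of l' n l i' i] 3 by simp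
      qed
      moreover have "v \<in> ?y" using 3 by (auto intro!: image_eqI[of _ _ "(i, l)"])
      moreover have "block n v = 2 * i + 2" using 3 by simp
      ultimately show ?thesis using True by (simp add: list_array_def la_list_J)
    qed
  next
    case False
    have "?A v j = {}"
    proof (cases "j = 0")
      case True
      then have v: "v \<notin> {1..N}" using False by blast
      have "n \<le> N" by simp
      then have "v \<notin> {1..n}" using v by (meson atLeastAtMost_iff le_trans)
      moreover have "v \<notin> ?x"
      proof
        assume "v \<in> ?x"
        then obtain z where "z \<in> ?Z" "v = (case z of (i, l) \<Rightarrow> xid n i l)" by (elim imageE)
        then show False using xid_bounds[of "snd z" n "fst z" d] v by (cases z) auto
      qed
      moreover have "v \<notin> ?y"
      proof
        assume "v \<in> ?y"
        then obtain z where "z \<in> ?Z" "v = (case z of (i, l) \<Rightarrow> yid n i l)" by (elim imageE)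
        then show False using yid_bounds[of "snd z" n "fst z" d] v by (cases z) auto
      qed
      ultimately show ?thesis unfolding list_array_def by metis
    qed (simp add: list_array_def)
    then show ?thesis using if_not_P[OF False] by metis
  qed
qed

lemma edge_array_J: "edge_array (slot_edges n S) = (\<lambda>u v. count (la_edges J) {u, v})"
  by (intro ext) (simp add: edge_array_def finite_slot_edges)

end

context hom_input begin

text \<open>The given program is guaranteed to work from \<open>la_store\<close> only, so the store
  seen through \<open>ren_name\<close> has to equal it exactly, blank arrays included.\<close>

lemma halts_prep:
  "halts prep (hom_store I ps)
     ((length ps * 18 + 9) + ((Suc d * (n * 5 + 5) + 3) + (n * (n * (Suc d * 3 + n * 4 + 19) + 4) + 2)))
     (\<lambda>s. \<exists>S D C. reduction I ps S D C \<and>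
        pullback ren_name s = la_store (allocation I ps S D) (gadget_enum h ps (length ps)))"
proof -
  let ?s0 = "hom_store I ps" and ?L = "loops I"
  let ?XL = "insert r (xlist h ?L (length ps))" and ?YL = "insert r (ylist h ?L (length ps))"
  let ?A = "\<lambda>i j. gadget_alpha h ps \<alpha> {i, j}"
  let ?Z = "{..<Suc d} \<times> {1..n}"
  have verts: "pverts (hom_G I) = {1..n}" using valid by (simp add: hom_valid_def)
  have arcs: "parcs (hom_G I) \<subseteq> {1..n} \<times> {1..n}"
  proof -
    have "pair_digraph (hom_G I)" using valid by (simp add: hom_valid_def)
    then have "pair_wf_digraph (hom_G I)" by (simp add: pair_digraph_def pair_fin_digraph_def)
    then show ?thesis
      using pair_wf_digraph.arc_fst_in_verts pair_wf_digraph.arc_snd_in_verts verts by fastforce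
  qed
  have nw: "nwrites alpha_phase = {''Pr'', ''D'', ''k'', ''Palpha'', ''Plen''}"
    "nwrites init_phase = {''Pn'', ''i'', ''l'', ''C''}"
    "nwrites arc_phase = {''u'', ''v'', ''i'', ''b'', ''l'', ''m'', ''x'', ''y'', ''PE'', ''w'', ''C''}"
    "swrites alpha_phase = {''X'', ''Y''}" "swrites init_phase = {''lambda''}" "swrites arc_phase = {''lambda''}"
    by (auto simp: alpha_phase_def alpha_body_def push_def Let_def init_phase_def init_body_def arc_phase_def
        arc_step_def find_forest_def keep_arc_def drop_arc_def)
  have s0: "num ?s0 ''h'' 0 0 = h" "num ?s0 ''len'' 0 0 = length ps"
    "num ?s0 ''alpha'' = triples ps (\<lambda>i j. \<alpha> (i, j))" "lst ?s0 ''loops'' 0 0 = ?L"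
    "num ?s0 ''Palpha'' = (\<lambda>_ _. 0)" "num ?s0 ''Plen'' = (\<lambda>_ _. 0)" "num ?s0 ''Pr'' = (\<lambda>_ _. 0)"
    "num ?s0 ''n'' 0 0 = n" "num ?s0 ''C'' = (\<lambda>_ _. 0)" "num ?s0 ''Pn'' = (\<lambda>_ _. 0)" "num ?s0 ''PE'' = (\<lambda>_ _. 0)"
    "lst ?s0 ''lambda'' = (\<lambda>v j. if v \<in> {1..n} \<and> j = 0 then hom_list I v else {})"
    "num ?s0 ''G'' = (\<lambda>u v. of_bool ((u, v) \<in> parcs (hom_G I)))"
    by (simp_all add: hom_store_def loops_def verts)
  have A: "?A i j = \<alpha> (ps ! k)" if "k < length ps" "(i, j) \<in> set (gadget_pairs h ps k)" for k i j
    using gadget_alpha_eq[OF that(1), of "{i, j}"] that(2) by (auto simp: gadget_pairs_def)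
  show ?thesis
    unfolding prep_def
  proof (rule halts_seq[OF halts_alpha_phase[OF s0(1-7) A]], assumption, assumption)
    fix s1 :: store
    assume s1: "num s1 ''Palpha'' = triples (gadget_enum h ps (length ps)) ?A \<and>
       num s1 ''Plen'' = scalar (length (gadget_enum h ps (length ps))) \<and>
       num s1 ''Pr'' = scalar r \<and> num s1 ''D'' 0 0 = Suc (\<Sum>k<length ps. \<alpha> (ps ! k)) \<and>
       lst s1 ''X'' 0 0 = ?XL \<and> lst s1 ''Y'' 0 0 = ?YL"
      and fr1: "\<And>x. x \<notin> nwrites alpha_phase \<Longrightarrow> num s1 x = num ?s0 x"
        "\<And>x. x \<notin> swrites alpha_phase \<Longrightarrow> lst s1 x = lst ?s0 x"
    have s1': "num s1 ''n'' 0 0 = n" "num s1 ''D'' 0 0 = Suc d" "num s1 ''C'' = (\<lambda>_ _. 0)" "num s1 ''Pn'' = (\<lambda>_ _. 0)"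
      "lst s1 ''X'' 0 0 = ?XL" "lst s1 ''Y'' 0 0 = ?YL"
      "lst s1 ''lambda'' = (\<lambda>v j. if v \<in> {1..n} \<and> j = 0 then hom_list I v else {})"
      using s1 fr1(1)[of "''n''"] fr1(1)[of "''C''"] fr1(1)[of "''Pn''"] fr1(2)[of "''lambda''"] s0 hom_d_eq
      by (simp_all add: nw)
    show "halts (init_phase ;; arc_phase) s1
       ((Suc d * (n * 5 + 5) + 3) + (n * (n * (Suc d * 3 + n * 4 + 19) + 4) + 2))
       (\<lambda>s. \<exists>S D C. reduction I ps S D C \<and>
         pullback ren_name s = la_store (allocation I ps S D) (gadget_enum h ps (length ps)))"
    proof (rule halts_seq[OF halts_init_phase[OF s1']])
      fix s2 :: store
      assume s2: "num s2 ''Pn'' = scalar (n * (2 * Suc d + 1)) \<and> num s2 ''C'' = label_array ?Z \<and>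
         lst s2 ''lambda'' = list_array n (hom_list I) ?XL ?YL ?Z"
        and fr2: "\<And>x. x \<notin> nwrites init_phase \<Longrightarrow> num s2 x = num s1 x"
          "\<And>x. x \<notin> swrites init_phase \<Longrightarrow> lst s2 x = lst s1 x"
      have s2': "num s2 ''n'' 0 0 = n" "num s2 ''D'' 0 0 = Suc d"
        "num s2 ''G'' = (\<lambda>u v. of_bool ((u, v) \<in> parcs (hom_G I)))" "lst s2 ''loops'' 0 0 = ?L"
        "num s2 ''PE'' = (\<lambda>_ _. 0)" "num s2 ''C'' = label_array ?Z"
        "lst s2 ''lambda'' = list_array n (hom_list I) ?XL ?YL ?Z"
        using s2 fr2(1)[of "''n''"] fr2(1)[of "''D''"] fr2(1)[of "''G''"] fr2(1)[of "''PE''"] fr2(2)[of "''loops''"]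
          fr1(1)[of "''G''"] fr1(1)[of "''PE''"] fr1(2)[of "''loops''"] s1' s0
        by (simp_all add: nw)
      show "halts arc_phase s2 (n * (n * (Suc d * 3 + n * 4 + 19) + 4) + 2)
         (\<lambda>s. \<exists>S D C. reduction I ps S D C \<and>
           pullback ren_name s = la_store (allocation I ps S D) (gadget_enum h ps (length ps)))"
      proof (rule halts_mono[OF halts_frame[OF halts_arc_phase[OF s2' arcs]] order_refl], elim conjE)
        fix s3 :: store
        assume inv: "arc_inv n d ?L (hom_list I) ?XL ?YL (parcs (hom_G I)) s3"
          and fr3: "\<forall>x. x \<notin> nwrites arc_phase \<longrightarrow> num s3 x = num s2 x"
            "\<forall>x. x \<notin> swrites arc_phase \<longrightarrow> lst s3 x = lst s2 x"
        obtain S D where F: "forests n d (parcs (hom_G I)) S D (num s3 ''C'')"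
          and PE: "num s3 ''PE'' = edge_array (slot_edges n S)"
          and lam: "lst s3 ''lambda'' = list_array n (arc_list D ?L (hom_list I)) ?XL ?YL ?Z"
          using inv unfolding arc_inv_def by blast
        interpret reduction I ps S D "num s3 ''C''" 
          by (intro reduction.intro reduction_axioms.intro hom_input_axioms F)
        have "num s3 (ren_name x) = num (la_store J (gadget_enum h ps (length ps))) x" for x
        proof -
          have "num s3 ''Pn'' = scalar N" using fr3 s2 by (simp add: nw algebra_simps)
          moreover have "num s3 ''Pr'' = scalar r" "num s3 ''Plen'' = scalar (length (gadget_enum h ps (length ps)))"
            "num s3 ''Palpha'' = triples (gadget_enum h ps (length ps)) ?A"
            using fr3 fr2 s1 by (simp_all add: nw)
          \<comment> \<open>Scratch arrays of the preparation have names that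
            \<open>ren_name\<close> never produces, so whatever else the program sees is untouched
            and blank.\<close>
          moreover have "num s3 (ren_name x) = (\<lambda>_ _. 0)" if "x \<notin> {''n'', ''r'', ''E'', ''len'', ''alpha''}"
          proof -
            have "ren_name x \<notin> nwrites arc_phase \<union> nwrites init_phase \<union> nwrites alpha_phase"
              using that by (auto simp: nw ren_name_def)
            then have "num s3 (ren_name x) = num ?s0 (ren_name x)" using fr1 fr2 fr3 by simp
            also have "\<dots> = (\<lambda>_ _. 0)" by (auto simp: hom_store_def ren_name_def)
            finally show ?thesis .
          qed
          ultimately show ?thesis using PE edge_array_J
            by (cases "x \<in> {''n'', ''r'', ''E'', ''len'', ''alpha''}") (auto simp: la_store_def ren_name_def)
        qed
        moreover have "lst s3 (ren_name x) = lst (la_store J (gadget_enum h ps (length ps))) x" for x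
        proof (cases "x = ''lambda''")
          case True
          then show ?thesis using lam list_array_J by (simp add: la_store_def ren_name_def)
        next
          case False
          then have "ren_name x \<notin> swrites arc_phase \<union> swrites init_phase \<union> swrites alpha_phase"
            by (auto simp: nw ren_name_def)
          then have "lst s3 (ren_name x) = lst ?s0 (ren_name x)" using fr1 fr2 fr3 by simp
          also have "\<dots> = (\<lambda>_ _. {})" using False by (auto simp: hom_store_def ren_name_def)
          finally show ?thesis using False by (simp add: la_store_def)
        qed
        ultimately have "pullback ren_name s3 = la_store J (gadget_enum h ps (length ps))"
          by (simp add: pullback_def fun_eq_iff store.equality)
        then show "\<exists>S D C. reduction I ps S D C \<and>
           pullback ren_name s3 = la_store (allocation I ps S D) (gadget_enum h ps (length ps))"
          using reduction_axioms by blast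
      qed
    qed
  qed
qed

text \<open>\<open>length ps\<close> is at most \<open>d\<close>, as every listed arc has demand at
  least 1. The scan of the matrix dominates, with order \<open>n^2 * (d + n)\<close>. As
  \<open>M\<close> and \<open>m\<close> are at least 1, each monomial is at most
  \<open>M * m ^ 4\<close>, and the coefficients add up to 85.\<close>

lemma prep_time_bound:
  "(length ps * 18 + 9) + ((Suc d * (n * 5 + 5) + 3) + (n * (n * (Suc d * 3 + n * 4 + 19) + 4) + 2))
     \<le> 100 * (max 1 d * (max 1 n) ^ 4)"
proof -
  define M where "M = max 1 d"
  define m where "m = max 1 n"
  have "length ps = (\<Sum>k<length ps. 1)" by simp
  also have "\<dots> \<le> d" unfolding hom_d_eq by (rule sum_mono) (use ps_arc(5) in force)
  finally have len: "length ps \<le> M" by (simp add: M_def)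
  have d: "Suc d \<le> 2 * M" and n: "n \<le> m" and m: "1 \<le> m" and M: "1 \<le> M" by (auto simp: M_def m_def)
  have "n * (n * (Suc d * 3 + n * 4 + 19) + 4) \<le> m * (m * (2 * M * 3 + m * 4 + 19) + 4)"
    by (intro mult_mono add_mono d n) auto
  also have "\<dots> = 6 * (M * m ^ 2) + 4 * m ^ 3 + 19 * m ^ 2 + 4 * m"
    by (simp add: algebra_simps power2_eq_square power3_eq_cube)
  also have "\<dots> \<le> 6 * (M * m ^ 4) + 4 * (M * m ^ 4) + 19 * (M * m ^ 4) + 4 * (M * m ^ 4)"
  proof -
    have "m ^ 2 \<le> m ^ 4" "m ^ 3 \<le> m ^ 4" "m \<le> m ^ 4"
      using m power_increasing[of 2 4 m] power_increasing[of 3 4 m] power_increasing[of 1 4 m] by simp_all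
    moreover have "m ^ 4 \<le> M * m ^ 4" using M by simp
    ultimately show ?thesis by (intro add_mono mult_le_mono2) (auto intro: order_trans)
  qed
  finally have 1: "n * (n * (Suc d * 3 + n * 4 + 19) + 4) \<le> 33 * (M * m ^ 4)" by simp
  have m4: "m \<le> m ^ 4" "1 \<le> m ^ 4" using m power_increasing[of 1 4 m] by simp_all
  have "Suc d * (n * 5 + 5) \<le> 2 * M * (m * 5 + m * 5)"
    by (intro mult_mono add_mono d) (use n m in auto)
  also have "\<dots> = 20 * (M * m)" by simp
  also have "\<dots> \<le> 20 * (M * m ^ 4)" by (intro mult_le_mono2 m4)
  finally have 2: "Suc d * (n * 5 + 5) \<le> 20 * (M * m ^ 4)" .
  have "M * 1 \<le> M * m ^ 4" by (rule mult_le_mono2[OF m4(2)])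
  then have 3: "M \<le> M * m ^ 4" "length ps \<le> M * m ^ 4" "1 \<le> M * m ^ 4" using len M by linarith+
  show ?thesis using 1 2 3 unfolding M_def[symmetric] m_def[symmetric] by linarith
qed

end

theorem theorem6:
  fixes T :: "nat \<Rightarrow> nat \<Rightarrow> nat"
  assumes "\<exists>P. solves_la P (\<lambda>I. T (la_n I) (la_w I))"
  shows "\<exists>Q. \<exists>c::nat. \<exists>(f :: nat \<Rightarrow> nat \<Rightarrow> nat) (g :: nat \<Rightarrow> nat) (p :: nat \<Rightarrow> nat \<Rightarrow> nat).
           (\<forall>d n. f d n \<le> c * (max 1 d * n)) \<and>
           (\<forall>d. g d \<le> c * d) \<and>
           (\<forall>d n. p d n \<le> c * (max 1 d * (max 1 n) ^ 4)) \<and>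
           solves_hom Q (\<lambda>I. T (f (hom_d I) (hom_n I)) (g (hom_d I)) + p (hom_d I) (hom_n I))"
proof -
  obtain P where P: "solves_la P (\<lambda>I. T (la_n I) (la_w I))" using assms by blast
  let ?f = "\<lambda>d n. n * (2 * d + 3)" and ?g = "\<lambda>d. 3 * d"
  let ?p = "\<lambda>d n. 100 * (max 1 d * (max 1 n) ^ 4)"
  have f: "?f d n \<le> 100 * (max 1 d * n)" for d n :: nat
  proof -
    \<comment> \<open>The \<open>max\<close> covers \<open>d = 0\<close>, where one forest, and with
      it the factor 3, remains.\<close>
    have "n * (2 * d + 3) \<le> n * (5 * max 1 d)" by (intro mult_le_mono2) auto
    also have "\<dots> \<le> 100 * (max 1 d * n)" by simp
    finally show ?thesis .
  qed
  have "solves_hom (Seq prep (cren ren_name P))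
      (\<lambda>I. T (?f (hom_d I) (hom_n I)) (?g (hom_d I)) + ?p (hom_d I) (hom_n I))"
    unfolding solves_hom_def
  proof (intro allI impI)
    fix I ps
    assume "hom_valid I \<and> hom_enum I ps"
    then interpret hom_input I ps by unfold_locales auto
    have "halts prep (hom_store I ps) (?p d n) (\<lambda>s. \<exists>S D C. reduction I ps S D C \<and>
        pullback ren_name s = la_store (allocation I ps S D) (gadget_enum h ps (length ps)))"
      by (rule halts_mono[OF halts_prep prep_time_bound])
    then obtain t s where prep: "exec prep (hom_store I ps) t s" "t \<le> ?p d n"
      and "\<exists>S D C. reduction I ps S D C \<and>
        pullback ren_name s = la_store (allocation I ps S D) (gadget_enum h ps (length ps))"
      by (rule haltsE)
    then obtain S D C where red: "reduction I ps S D C"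
      and s: "pullback ren_name s = la_store (allocation I ps S D) (gadget_enum h ps (length ps))"
      by (elim exE conjE)
    interpret reduction I ps S D C by (rule red)
    obtain t' \<sigma> where P': "exec P (la_store J (gadget_enum h ps (length ps))) t' \<sigma>"
      "t' \<le> T N (3 * d)" "la_correct J \<sigma>"
      using P[unfolded solves_la_def, rule_format, OF conjI[OF la_valid_J la_enum_J]]
      unfolding la_J la_w_J by (elim exE conjE)
    obtain s' where s': "exec (cren ren_name P) s t' s'" "\<sigma> = pullback ren_name s'"
      using exec_cren[OF inj_ren_name P'(1) s[symmetric]] by blast
    have out: "num \<sigma> ''ans'' = num s' ''ans''" "num \<sigma> ''out'' = num s' ''out''"
      by (simp_all add: s'(2) pullback_def ren_name_def)
    \<comment> \<open>\<open>V(G)\<close> is block 0 and its vertices have their images as part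
      numbers, so the shared array \<open>out\<close> already holds the homomorphism and no further
      pass is made.\<close>
    have "hom_correct I s'"
      using P'(3) hom_solution_of_allocation[of "\<lambda>v. num s' ''out'' v 0"] allocation_of_hom_solution
      unfolding la_correct_def hom_correct_def out la_J by auto
    then show "\<exists>t s. exec (Seq prep (cren ren_name P)) (hom_store I ps) t s \<and>
        t \<le> T (?f d n) (?g d) + ?p d n \<and> hom_correct I s"
      using exec.Seq[OF prep(1) s'(1)] prep(2) P'(2) by (intro exI[of _ "t + t'"] exI[of _ s']) auto
  qed
  then show ?thesis
    by (intro exI[of _ "Seq prep (cren ren_name P)"] exI[of _ 100] exI[of _ ?f] exI[of _ ?g] exI[of _ ?p])
      (use f in auto)
qed

end
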